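(* (Lelong-Jensen formula) Let $1\le m<n$ be integers, $\Omega\subset\mathbb{C}^n$ an open set, and $T$ a current of bidimension $(p,p)$ on $\Omega$, with $m+p\ge n$, such that $T$ and $dd^cT$ are of order zero on $\Omega$. Then for every $a\in\Omega$ and $0<r_1<r_2<d(a,\partial\Omega)$, $$\begin{aligned} \nu_T(a,r_2)-\nu_T(a,r_1) ={}&\frac{1}{r_2^{\frac{2n}{m}(m+p-n)}}\int_{\mathbb{B}(a,r_2)}T\wedge\beta^p-\frac{1}{r_1^{\frac{2n}{m}(m+p-n)}}\int_{\mathbb{B}(a,r_1)}T\wedge\beta^p\\ ={}&\int_{r_1}^{r_2}\left(\frac{1}{t^{\frac{2n}{m}(m+p-n)}}-\frac{1}{r_2^{\frac{2n}{m}(m+p-n)}}\right)2t\,dt\int_{\mathbb{B}(a,t)}dd^cT\wedge\beta^{p-1}\\ &+\int_0^{r_1}\left(\frac{1}{r_1^{\frac{2n}{m}(m+p-n)}}-\frac{1}{r_2^{\frac{2n}{m}(m+p-n)}}\right)2t\,dt\int_{\mathbb{B}(a,t)}dd^cT\wedge\beta^{p-1}\\ &+\int_{\mathbb{B}(a,r_1,r_2)}T(\xi)\wedge\beta(\xi)^{n-m}\wedge\bigl(dd^c\widetilde\phi_m(\xi-a)\bigr)^{m+p-n}. \end{aligned}$$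
   Context: Conventions: $d=\partial+\overline\partial$, $d^c=\frac{i}{4\pi}(\overline\partial-\partial)$, so $dd^c=\frac{i}{2\pi}\partial\overline\partial$; $\beta=dd^c|z|^2$; $\mathbb{B}(a,r)=\{z\in\mathbb{C}^n: |z-a|<r\}$ (open ball) and $\mathbb{B}(a,r_1,r_2)=\{z\in\mathbb{C}^n: r_1<|z-a|<r_2\}$ (open annulus). For $r>0$, $\phi_m(r)=-\dfrac{1}{(\frac nm-1)\,r^{2(\frac nm-1)}}$, and $\widetilde\phi_m(\zeta)=\phi_m(|\zeta|)$ for $\zeta\in\mathbb{C}^n\setminus\{0\}$. A current is of order zero if its coefficients are (complex) measures. For a current $T$ of bidimension $(p,p)$, $$\nu_T(a,r)=\frac{1}{r^{\frac{2n}{m}(m+p-n)}}\int_{\mathbb{B}(a,r)}T\wedge\beta^p .$$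
   Formalization: With open balls and the open annulus the formula fails if T∧β^p charges the sphere |ξ-a|=r_1. Proved instead: the formula with last integral over r_1≤|ξ-a|<r_2, and the formula as written whenever T∧β^p has zero mass on that sphere. *)

theory Defs
  imports "HOL-Analysis.Analysis"
begin

section \<open>Differential forms on complex n-space\<close>

text \<open>
  The generators of the exterior algebra are indexed by \<open>'n + 'n\<close>: \<open>Inl j\<close> stands for
  \<open>dz\<^sub>j\<close> and \<open>Inr j\<close> for its conjugate. A covector is given by its coefficients on the basis
  consisting of the wedge products, in increasing order, of the generators in a set \<open>K\<close>.
\<close>

type_synonym 'n covec = "('n + 'n) set \<Rightarrow> complex"
type_synonym 'n form = "complex ^ 'n \<Rightarrow> 'n covec"

fun gen_less :: "'n::linorder + 'n \<Rightarrow> 'n + 'n \<Rightarrow> bool" where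
  "gen_less (Inl i) (Inl j) \<longleftrightarrow> i < j"
| "gen_less (Inl i) (Inr j) \<longleftrightarrow> True"
| "gen_less (Inr i) (Inl j) \<longleftrightarrow> False"
| "gen_less (Inr i) (Inr j) \<longleftrightarrow> i < j"

definition inversions :: "('n::linorder + 'n) set \<Rightarrow> ('n + 'n) set \<Rightarrow> nat" where
  "inversions A B = card {(x, y). x \<in> A \<and> y \<in> B \<and> gen_less y x}"

definition basis_covec :: "('n + 'n) set \<Rightarrow> 'n covec" where
  "basis_covec K = (\<lambda>L. if L = K then 1 else 0)"

definition wedge :: "'n::{finite,linorder} covec \<Rightarrow> 'n covec \<Rightarrow> 'n covec" where
  "wedge a b = (\<lambda>K. \<Sum>A\<in>Pow K. (- 1) ^ inversions A (K - A) * a A * b (K - A))"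

definition form_wedge :: "'n::{finite,linorder} form \<Rightarrow> 'n form \<Rightarrow> 'n form"
    (infixr \<open>\<and>\<^sub>f\<close> 70) where
  "\<alpha> \<and>\<^sub>f \<beta> = (\<lambda>z. wedge (\<alpha> z) (\<beta> z))"

definition fun_form :: "(complex ^ 'n \<Rightarrow> complex) \<Rightarrow> 'n form" where
  "fun_form f = (\<lambda>z K. f z * basis_covec {} K)"

primrec form_power :: "'n::{finite,linorder} form \<Rightarrow> nat \<Rightarrow> 'n form" where
  "form_power \<alpha> 0 = fun_form (\<lambda>z. 1)"
| "form_power \<alpha> (Suc k) = \<alpha> \<and>\<^sub>f form_power \<alpha> k"

definition bidegree_indices :: "nat \<Rightarrow> nat \<Rightarrow> ('n::finite + 'n) set set" where
  "bidegree_indices p q = {K. card (Inl -` K) = p \<and> card (Inr -` K) = q}"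

definition dir_deriv ::
  "'a::real_normed_vector \<Rightarrow> ('a \<Rightarrow> 'b::real_normed_vector) \<Rightarrow> 'a \<Rightarrow> 'b" where
  "dir_deriv v f = (\<lambda>x. frechet_derivative f (at x) v)"

definition wirtinger :: "'n::finite \<Rightarrow> (complex ^ 'n \<Rightarrow> complex) \<Rightarrow> complex ^ 'n \<Rightarrow> complex" where
  "wirtinger j f z = (dir_deriv (axis j 1) f z - \<i> * dir_deriv (axis j \<i>) f z) / 2"

definition wirtinger_bar :: "'n::finite \<Rightarrow> (complex ^ 'n \<Rightarrow> complex) \<Rightarrow> complex ^ 'n \<Rightarrow> complex" where
  "wirtinger_bar j f z = (dir_deriv (axis j 1) f z + \<i> * dir_deriv (axis j \<i>) f z) / 2"

definition del :: "'n::{finite,linorder} form \<Rightarrow> 'n form" where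
  "del \<alpha> = (\<lambda>z K. \<Sum>j\<in>UNIV.
      wedge (basis_covec {Inl j}) (\<lambda>L. wirtinger j (\<lambda>w. \<alpha> w L) z) K)"

definition delbar :: "'n::{finite,linorder} form \<Rightarrow> 'n form" where
  "delbar \<alpha> = (\<lambda>z K. \<Sum>j\<in>UNIV.
      wedge (basis_covec {Inr j}) (\<lambda>L. wirtinger_bar j (\<lambda>w. \<alpha> w L) z) K)"

definition d_form :: "'n::{finite,linorder} form \<Rightarrow> 'n form" where
  "d_form \<alpha> = (\<lambda>z K. del \<alpha> z K + delbar \<alpha> z K)"

definition dc_form :: "'n::{finite,linorder} form \<Rightarrow> 'n form" where
  "dc_form \<alpha> = (\<lambda>z K. \<i> / (4 * of_real pi) * (delbar \<alpha> z K - del \<alpha> z K))"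

definition ddc :: "'n::{finite,linorder} form \<Rightarrow> 'n form" where
  "ddc \<alpha> = d_form (dc_form \<alpha>)"

definition beta_form :: "'n::{finite,linorder} form" where
  "beta_form = ddc (fun_form (\<lambda>z. of_real ((norm z)\<^sup>2)))"

section \<open>Currents\<close>

text \<open>All iterated directional derivatives exist and are differentiable, i.e. f is smooth.\<close>

definition smooth_fun :: "('a::real_normed_vector \<Rightarrow> 'b::real_normed_vector) \<Rightarrow> bool" where
  "smooth_fun f \<longleftrightarrow> (\<forall>vs. foldr dir_deriv vs f differentiable_on UNIV)"

definition test_fun :: "'a::real_normed_vector set \<Rightarrow> ('a \<Rightarrow> complex) \<Rightarrow> bool" where
  "test_fun \<Omega> f \<longleftrightarrow> smooth_fun f \<and> (\<exists>C. compact C \<and> C \<subseteq> \<Omega> \<and> (\<forall>z. z \<notin> C \<longrightarrow> f z = 0))"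

definition test_form :: "(complex ^ 'n::finite) set \<Rightarrow> nat \<Rightarrow> 'n form \<Rightarrow> bool" where
  "test_form \<Omega> p \<phi> \<longleftrightarrow>
     (\<forall>K. test_fun \<Omega> (\<lambda>z. \<phi> z K)) \<and> (\<forall>z K. K \<notin> bidegree_indices p p \<longrightarrow> \<phi> z K = 0)"

text \<open>
  A current of bidimension \<open>(p, p)\<close> is a functional on the smooth, compactly supported
  \<open>(p, p)\<close>-forms that is linear and continuous; its values on other forms are irrelevant.
  Continuity is the usual seminorm estimate on each compact set, for a bound \<open>M\<close> on all
  partial derivatives of order at most \<open>N\<close>.
\<close>

definition is_current :: "(complex ^ 'n::finite) set \<Rightarrow> nat \<Rightarrow> ('n form \<Rightarrow> complex) \<Rightarrow> bool" where
  "is_current \<Omega> p T \<longleftrightarrow>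
     (\<forall>\<phi> \<psi>. test_form \<Omega> p \<phi> \<and> test_form \<Omega> p \<psi> \<longrightarrow> T (\<lambda>z K. \<phi> z K + \<psi> z K) = T \<phi> + T \<psi>) \<and>
     (\<forall>c \<phi>. test_form \<Omega> p \<phi> \<longrightarrow> T (\<lambda>z K. c * \<phi> z K) = c * T \<phi>) \<and>
     (\<forall>C. compact C \<and> C \<subseteq> \<Omega> \<longrightarrow> (\<exists>B N. \<forall>\<phi> M.
        test_form \<Omega> p \<phi> \<and> (\<forall>z K. z \<notin> C \<longrightarrow> \<phi> z K = 0) \<and>
        (\<forall>vs z K. set vs \<subseteq> Basis \<and> length vs \<le> N \<longrightarrow>
           cmod (foldr dir_deriv vs (\<lambda>w. \<phi> w K) z) \<le> M)
        \<longrightarrow> cmod (T \<phi>) \<le> B * M))"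

text \<open>If \<open>T\<close> has bidimension \<open>(p, p)\<close>, this acts on \<open>(p - 1, p - 1)\<close>-forms. No sign occurs: the two
  integrations by parts and the anticommutation of \<open>d\<close> and \<open>d\<^sup>c\<close> cancel.\<close>

definition ddc_current ::
  "('n::{finite,linorder} form \<Rightarrow> complex) \<Rightarrow> 'n form \<Rightarrow> complex" where
  "ddc_current T = (\<lambda>\<phi>. T (ddc \<phi>))"

text \<open>
  A complex Radon measure on \<open>\<Omega>\<close> is given by its polar decomposition \<open>h d\<mu>\<close>: \<open>\<mu>\<close> is a positive
  Borel measure, finite on the compact subsets of \<open>\<Omega>\<close> (the total variation), and \<open>h\<close> is a Borel
  function of modulus one. The behaviour of \<open>\<mu>\<close> outside \<open>\<Omega>\<close> is irrelevant.
\<close>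

type_synonym 'a cmeasure = "'a measure \<times> ('a \<Rightarrow> complex)"

definition complex_radon :: "'a::topological_space set \<Rightarrow> 'a cmeasure \<Rightarrow> bool" where
  "complex_radon \<Omega> \<nu> \<longleftrightarrow>
     sets (fst \<nu>) = sets borel \<and>
     (\<forall>C. compact C \<and> C \<subseteq> \<Omega> \<longrightarrow> emeasure (fst \<nu>) C < \<infinity>) \<and>
     snd \<nu> \<in> borel_measurable borel \<and> (\<forall>x. cmod (snd \<nu> x) = 1)"

definition cmeasure_int :: "'a cmeasure \<Rightarrow> 'a set \<Rightarrow> ('a \<Rightarrow> complex) \<Rightarrow> complex" where
  "cmeasure_int \<nu> A f = (LINT x:A|fst \<nu>. f x * snd \<nu> x)"

text \<open>
  The coefficient of \<open>T\<close> dual to the basis covector \<open>K\<close> is the distribution taking \<open>f\<close> to the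
  value of \<open>T\<close> at \<open>f\<close> times that covector. It is, up to a nonzero constant factor, the
  coefficient of \<open>T\<close> at the complementary basis covector when \<open>T\<close> is viewed as a form of
  bidegree \<open>(n - p, n - p)\<close> with distribution coefficients.
\<close>

definition represents_coeff ::
  "(complex ^ 'n::finite) set \<Rightarrow> ('n form \<Rightarrow> complex) \<Rightarrow> ('n + 'n) set \<Rightarrow>
   (complex ^ 'n) cmeasure \<Rightarrow> bool" where
  "represents_coeff \<Omega> T K \<nu> \<longleftrightarrow>
     complex_radon \<Omega> \<nu> \<and>
     (\<forall>f. test_fun \<Omega> f \<longrightarrow> T (\<lambda>z L. f z * basis_covec K L) = cmeasure_int \<nu> \<Omega> f)"

definition order_zero :: "(complex ^ 'n::finite) set \<Rightarrow> nat \<Rightarrow> ('n form \<Rightarrow> complex) \<Rightarrow> bool" where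
  "order_zero \<Omega> p T \<longleftrightarrow> (\<forall>K\<in>bidegree_indices p p. \<exists>\<nu>. represents_coeff \<Omega> T K \<nu>)"

text \<open>As a complex measure on \<open>\<Omega>\<close>, the coefficient is uniquely determined by \<open>T\<close>.\<close>

definition coeff_measure ::
  "(complex ^ 'n::finite) set \<Rightarrow> ('n form \<Rightarrow> complex) \<Rightarrow> ('n + 'n) set \<Rightarrow> (complex ^ 'n) cmeasure" where
  "coeff_measure \<Omega> T K = (SOME \<nu>. represents_coeff \<Omega> T K \<nu>)"

text \<open>
  For \<open>T\<close> of bidimension \<open>(p, p)\<close> and order zero on \<open>\<Omega>\<close>, the integral over \<open>A\<close> of the measure
  \<open>T \<and> \<alpha>\<close>, where \<open>\<alpha>\<close> is a \<open>(p, p)\<close>-form with coefficients bounded and Borel on \<open>A\<close>.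
\<close>

definition current_int ::
  "(complex ^ 'n::finite) set \<Rightarrow> nat \<Rightarrow> ('n form \<Rightarrow> complex) \<Rightarrow> (complex ^ 'n) set \<Rightarrow> 'n form \<Rightarrow> complex" where
  "current_int \<Omega> p T A \<alpha> =
     (\<Sum>K\<in>bidegree_indices p p. cmeasure_int (coeff_measure \<Omega> T K) A (\<lambda>z. \<alpha> z K))"

section \<open>Data of the Lelong-Jensen formula\<close>

definition phi :: "nat \<Rightarrow> nat \<Rightarrow> real \<Rightarrow> real" where
  "phi n m r = - 1 / ((real n / real m - 1) * r powr (2 * (real n / real m - 1)))"

definition phi_tilde :: "nat \<Rightarrow> complex ^ 'n::finite \<Rightarrow> real" where
  "phi_tilde m \<zeta> = phi CARD('n) m (norm \<zeta>)"

definition lelong_exponent :: "nat \<Rightarrow> nat \<Rightarrow> nat \<Rightarrow> real" where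
  "lelong_exponent n m p = 2 * real n / real m * (real m + real p - real n)"

definition lelong_nu ::
  "(complex ^ 'n::{finite,linorder}) set \<Rightarrow> nat \<Rightarrow> nat \<Rightarrow> ('n form \<Rightarrow> complex) \<Rightarrow>
   complex ^ 'n::{finite,linorder} \<Rightarrow> real \<Rightarrow> complex" where
  "lelong_nu \<Omega> m p T a r =
     of_real (1 / r powr lelong_exponent CARD('n) m p) *
     current_int \<Omega> p T (ball a r) (form_power beta_form p)"

text \<open>
  A current of order zero whose \<open>dd\<^sup>c\<close> is of order zero may charge spheres: for \<open>n = 2\<close>, with \<open>P\<close>
  the orthogonal projection onto the complex tangent spaces of the unit sphere and \<open>\<sigma>\<close> the surface
  measure, the matrix-valued measure \<open>1\<^sub>B Id - (1/2) P \<sigma>\<close> defines such a current of bidimension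
  \<open>(1, 1)\<close>, with \<open>dd\<^sup>c\<close> equal to zero. Passing from an open ball of radius \<open>r\<^sub>1\<close> to one of radius
  \<open>r\<^sub>2\<close> therefore adds the open annulus together with its inner sphere.
\<close>

definition annulus :: "'a::metric_space \<Rightarrow> real \<Rightarrow> real \<Rightarrow> 'a set" where
  "annulus a r\<^sub>1 r\<^sub>2 = {z. r\<^sub>1 < dist a z \<and> dist a z < r\<^sub>2}"

text \<open>Extended-real valued, so that it is infinite when the boundary is empty.\<close>

definition boundary_dist :: "'a::metric_space \<Rightarrow> 'a set \<Rightarrow> ereal" where
  "boundary_dist a \<Omega> = (INF z\<in>frontier \<Omega>. ereal (dist a z))"

end

theory Submission
  imports Defs
begin

text \<open>
  Put \<open>s = |z - a|\<^sup>2\<close> and \<open>\<theta> = ds \<and> d\<^sup>cs\<close>. For a function \<open>h\<close> of one real variable,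
  \<open>dd\<^sup>c(h(s)) = h'(s) \<beta> + h''(s) \<theta>\<close>; as \<open>\<beta>\<close> is closed, testing \<open>T\<close> against \<open>dd\<^sup>c(h(s) \<beta>\<^sup>p\<^sup>-\<^sup>1)\<close> gives
  \<open>\<integral> h'(s) T \<and> \<beta>\<^sup>p + \<integral> h''(s) T \<and> \<theta> \<and> \<beta>\<^sup>p\<^sup>-\<^sup>1 = \<integral> h(s) dd\<^sup>cT \<and> \<beta>\<^sup>p\<^sup>-\<^sup>1\<close> whenever \<open>h\<close> is smooth and vanishes
  for \<open>s \<ge> r\<^sub>2\<^sup>2\<close>. The identity survives bounded pointwise limits of \<open>h''\<close>. The formula is the limit case
  \<open>h'' = - (e / 2) s\<^sup>-\<^sup>e\<^sup>/\<^sup>2\<^sup>-\<^sup>1\<close> for \<open>r\<^sub>1\<^sup>2 \<le> s < r\<^sub>2\<^sup>2\<close> and \<open>h'' = 0\<close> elsewhere, for which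
  \<open>h'(s) = max(s, r\<^sub>1\<^sup>2)\<^sup>-\<^sup>e\<^sup>/\<^sup>2 - r\<^sub>2\<^sup>-\<^sup>e\<close>: since \<open>\<theta>\<^sup>2 = 0\<close>, the form paired with \<open>T\<close> between the two
  spheres is \<open>\<beta>\<^sup>n\<^sup>-\<^sup>m \<and> (dd\<^sup>c\<phi>)\<^sup>m\<^sup>+\<^sup>p\<^sup>-\<^sup>n - r\<^sub>2\<^sup>-\<^sup>e \<beta>\<^sup>p\<close>, and Fubini's theorem turns the right-hand side into
  integrals over balls. Both \<open>r\<^sub>1\<^sup>2 \<le> s\<close> and \<open>r\<^sub>1\<^sup>2 < s\<close> are allowed as the lower cut-off, which
  settles the contribution of the inner sphere.
\<close>

section \<open>The exterior algebra\<close>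

text \<open>The exponent \<open>e\<close> is fixed by \<phi>: as a function of \<open>s\<close> its
  derivative is \<open>s powr (- n / m)\<close>, so the power \<open>m + p - n\<close> of its
  \<open>ddc\<close> carries \<open>s powr (- e / 2)\<close> in front of \<beta> and, as at most one
  factor \<theta> survives, the derivative of that same function in front of \<theta>. The annulus
  term thus has the shape \<open>h'\<close>, \<open>h''\<close> that testing \<open>T\<close>
  against a radial function produces.

  This profile is singular at the centre, and its truncation is not smooth at either sphere, so it
  is never tested directly. Smoothness is arranged for \<open>h''\<close> alone; \<open>h'\<close>
  and \<open>h\<close> are recovered by integrating from \<open>s\<close> out to the outer radius,
  which makes them vanish there, bounds them, and carries limits of \<open>h''\<close> over to them.
  Convergence has to hold at every point, since coefficient measures can charge spheres.

  Powers of \<beta> have constant coefficients. The forms paired with \<open>T\<close> therefore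
  reduce to commuting operators on covectors and a single Hessian computation.\<close>

lemma inversions_Un_left:
  fixes A A' B :: "('n::{finite,linorder} + 'n) set"
  assumes "A \<inter> A' = {}"
  shows "inversions (A \<union> A') B = inversions A B + inversions A' B"
proof -
  have "{(x, y). x \<in> A \<union> A' \<and> y \<in> B \<and> gen_less y x} =
     {(x, y). x \<in> A \<and> y \<in> B \<and> gen_less y x} \<union> {(x, y). x \<in> A' \<and> y \<in> B \<and> gen_less y x}"
    by auto
  then show ?thesis
    unfolding inversions_def using assms by (simp only:) (subst card_Un_disjoint; auto)
qed

lemma inversions_Un_right:
  fixes A B B' :: "('n::{finite,linorder} + 'n) set"
  assumes "B \<inter> B' = {}"
  shows "inversions A (B \<union> B') = inversions A B + inversions A B'"
proof -
  have "{(x, y). x \<in> A \<and> y \<in> B \<union> B' \<and> gen_less y x} =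
     {(x, y). x \<in> A \<and> y \<in> B \<and> gen_less y x} \<union> {(x, y). x \<in> A \<and> y \<in> B' \<and> gen_less y x}"
    by auto
  then show ?thesis
    unfolding inversions_def using assms by (simp only:) (subst card_Un_disjoint; auto)
qed

text \<open>Both sides sum over the ways of splitting \<open>K\<close> into three ordered blocks.
  \<open>inversions\<close> is additive over disjoint unions in each argument, so either bracketing
  gives the sign of the total number of inversions between an earlier and a later block.\<close>

lemma wedge_assoc: "wedge (wedge a b) c = wedge a (wedge b c)"
  for a b c :: "'n::{finite,linorder} covec"
proof (rule ext)
  fix K :: "('n + 'n) set"
  let ?s = "\<lambda>A B. (- 1 :: complex) ^ inversions A B"
  have "wedge (wedge a b) c K =
      (\<Sum>M\<in>Pow K. \<Sum>A\<in>Pow M. ?s M (K - M) * ?s A (M - A) * a A * b (M - A) * c (K - M))"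
    unfolding wedge_def by (simp add: sum_distrib_left sum_distrib_right mult_ac)
  also have "\<dots> = (\<Sum>(M, A)\<in>Sigma (Pow K) Pow.
      ?s M (K - M) * ?s A (M - A) * a A * b (M - A) * c (K - M))"
    by (rule sum.Sigma) auto
  also have "\<dots> = (\<Sum>(A, B)\<in>Sigma (Pow K) (\<lambda>A. Pow (K - A)).
      ?s A (K - A) * ?s B (K - A - B) * a A * b B * c (K - A - B))"
  proof (rule sum.reindex_bij_witness[where i = "\<lambda>(A, B). (A \<union> B, A)" and j = "\<lambda>(M, A). (A, M - A)"],
      goal_cases)
    case (5 x)
    then obtain M A where x: "x = (M, A)" "M \<subseteq> K" "A \<subseteq> M" by auto
    have 1: "inversions M (K - M) = inversions A (K - M) + inversions (M - A) (K - M)"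
      using inversions_Un_left[of A "M - A" "K - M"] x by (simp add: Un_absorb1)
    have "K - A = (M - A) \<union> (K - M)" using x by auto
    then have 2: "inversions A (K - A) = inversions A (M - A) + inversions A (K - M)"
      using inversions_Un_right[of "M - A" "K - M" A] by auto
    have "K - A - (M - A) = K - M" using x by auto
    then show ?case using 1 2 x by (simp add: power_add)
  qed auto
  also have "\<dots> = (\<Sum>A\<in>Pow K. \<Sum>B\<in>Pow (K - A).
      ?s A (K - A) * ?s B (K - A - B) * a A * b B * c (K - A - B))"
    by (rule sum.Sigma[symmetric]) auto
  also have "\<dots> = wedge a (wedge b c) K"
    unfolding wedge_def by (simp add: sum_distrib_left sum_distrib_right mult_ac)
  finally show "wedge (wedge a b) c K = wedge a (wedge b c) K" .
qed

lemma wedge_sum_left: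
  "wedge (\<lambda>K. \<Sum>i\<in>I. f i K) b = (\<lambda>K. \<Sum>i\<in>I. wedge (f i) b K)"
  unfolding wedge_def
  by (rule ext, subst sum.swap) (simp add: sum_distrib_left sum_distrib_right)

lemma wedge_scale_left: "wedge (\<lambda>K. c * a K) b = (\<lambda>K. c * wedge a b K)"
  unfolding wedge_def by (rule ext) (simp add: sum_distrib_left mult_ac)

lemma inversions_empty [simp]: "inversions {} B = 0" "inversions A {} = 0"
  by (simp_all add: inversions_def)

lemma wedge_one_left [simp]: "wedge (basis_covec {}) b = b"
  for b :: "'n::{finite,linorder} covec"
proof (rule ext)
  fix K :: "('n + 'n) set"
  have "wedge (basis_covec {}) b K = (\<Sum>A\<in>Pow K. if A = {} then b K else 0)"
    unfolding wedge_def by (rule sum.cong) (auto simp: basis_covec_def)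
  then show "wedge (basis_covec {}) b K = b K" by simp
qed

text \<open>Exterior derivatives and multiplication by (1,1)-forms are combinations of these
  operators, so beyond associativity the only sign rule to handle is the exchange of two
  generators.\<close>

definition gen_wedge :: "'n + 'n \<Rightarrow> 'n::{finite,linorder} covec \<Rightarrow> 'n covec" where
  "gen_wedge x = wedge (basis_covec {x})"

lemma gen_wedge_apply:
  "gen_wedge x b K = (if x \<in> K then (- 1) ^ inversions {x} (K - {x}) * b (K - {x}) else 0)"
proof -
  have "gen_wedge x b K =
    (\<Sum>A\<in>Pow K. if A = {x} then (- 1) ^ inversions {x} (K - {x}) * b (K - {x}) else 0)"
    unfolding wedge_def gen_wedge_def by (rule sum.cong) (auto simp: basis_covec_def)
  then show ?thesis by simp
qed

lemma inversions_singleton: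
  "inversions {x} {y} = (if gen_less y x then 1 else 0)"
proof -
  have "{(u, v). u \<in> {x} \<and> v \<in> {y} \<and> gen_less v u} = (if gen_less y x then {(x, y)} else {})"
    by auto
  then show ?thesis unfolding inversions_def by simp
qed

lemma gen_less_linear: "x \<noteq> y \<Longrightarrow> gen_less x y \<longleftrightarrow> \<not> gen_less y x"
  by (cases x; cases y) auto

text \<open>Removing \<open>x\<close> and \<open>y\<close> from \<open>K\<close> in either order
  leaves the same set. The two signs differ by the inversion between \<open>x\<close> and
  \<open>y\<close>, which occurs in exactly one of the orders; for \<open>x = y\<close> both sides
  vanish.\<close>

lemma gen_wedge_anticommute: "gen_wedge x (gen_wedge y b) = (\<lambda>K. - gen_wedge y (gen_wedge x b) K)"
  for b :: "'n::{finite,linorder} covec"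
proof (rule ext)
  fix K :: "('n + 'n) set"
  show "gen_wedge x (gen_wedge y b) K = - gen_wedge y (gen_wedge x b) K"
  proof (cases "x \<in> K \<and> y \<in> K \<and> x \<noteq> y")
    case True
    define L where "L = K - {x, y}"
    have L: "K - {y} - {x} = L" "K - {x} - {y} = L" by (auto simp: L_def)
    have x: "K - {x} = L \<union> {y}" and y: "K - {y} = L \<union> {x}" using True by (auto simp: L_def)
    have "x \<notin> L" "y \<notin> L" by (auto simp: L_def)
    then have 1: "inversions {x} (K - {x}) = inversions {x} L + (if gen_less y x then 1 else 0)"
      and 2: "inversions {y} (K - {y}) = inversions {y} L + (if gen_less x y then 1 else 0)"
      unfolding x y by (subst inversions_Un_right; auto simp: inversions_singleton)+
    have K: "x \<in> K" "y \<in> K" "x \<in> K - {y}" "y \<in> K - {x}" using True by auto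
    show ?thesis
      unfolding gen_wedge_apply[of x "gen_wedge y b"] gen_wedge_apply[of y "gen_wedge x b"]
        gen_wedge_apply[of y b "K - {x}"] gen_wedge_apply[of x b "K - {y}"] L 1 2
      using K True gen_less_linear[of x y] by (simp add: power_add)
  qed (auto simp: gen_wedge_apply)
qed

lemma gen_wedge_sum: "gen_wedge x (\<lambda>K. \<Sum>i\<in>I. f i K) = (\<lambda>K. \<Sum>i\<in>I. gen_wedge x (f i) K)"
  by (rule ext) (simp add: gen_wedge_apply sum_distrib_left)

lemma gen_wedge_scale: "gen_wedge x (\<lambda>K. c * b K) = (\<lambda>K. c * gen_wedge x b K)"
  by (rule ext) (simp add: gen_wedge_apply)

lemma gen_wedge_add: "gen_wedge x (\<lambda>K. a K + b K) = (\<lambda>K. gen_wedge x a K + gen_wedge x b K)"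
  by (rule ext) (simp add: gen_wedge_apply algebra_simps)

lemma gen_wedge_minus: "gen_wedge x (\<lambda>K. - b K) = (\<lambda>K. - gen_wedge x b K)"
  by (rule ext) (simp add: gen_wedge_apply)

lemma wedge_gen_wedge: "wedge (gen_wedge x a) b = gen_wedge x (wedge a b)"
  by (simp add: gen_wedge_def wedge_assoc)

section \<open>Multiplication by (1,1)-covectors as an operator\<close>

definition ddc_const :: complex where
  "ddc_const = \<i> / (2 * of_real pi)"

text \<open>Wedge multiplication by the \<open>(1, 1)\<close>-covector with coefficient matrix \<open>G\<close>, normalised so
  that the complex Hessian \<open>G\<close> of a function corresponds to its \<open>dd\<^sup>c\<close>.\<close>

definition hess_wedge ::
  "('n \<Rightarrow> 'n \<Rightarrow> complex) \<Rightarrow> 'n::{finite,linorder} covec \<Rightarrow> 'n covec" where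
  "hess_wedge G b = (\<lambda>K. ddc_const *
     (\<Sum>j\<in>UNIV. \<Sum>k\<in>UNIV. G j k * gen_wedge (Inl j) (gen_wedge (Inr k) b) K))"

lemma hess_wedge_add: "hess_wedge G (\<lambda>K. a K + b K) = (\<lambda>K. hess_wedge G a K + hess_wedge G b K)"
  unfolding hess_wedge_def by (simp add: gen_wedge_add algebra_simps sum.distrib)

lemma hess_wedge_scale: "hess_wedge G (\<lambda>K. c * b K) = (\<lambda>K. c * hess_wedge G b K)"
  unfolding hess_wedge_def by (simp add: gen_wedge_scale algebra_simps sum_distrib_left)

lemma hess_wedge_sum:
  "hess_wedge G (\<lambda>K. \<Sum>i\<in>I. f i K) = (\<lambda>K. \<Sum>i\<in>I. hess_wedge G (f i) K)"
proof (cases "finite I")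
  case True
  then show ?thesis
  proof (induction I rule: finite_induct)
    case empty
    show ?case using hess_wedge_scale[of G 0 "\<lambda>_. 0"] by simp
  next
    case (insert i I)
    then show ?case by (simp add: hess_wedge_add)
  qed
next
  case False
  then show ?thesis using hess_wedge_scale[of G 0 "\<lambda>_. 0"] by simp
qed

lemma hess_wedge_lincomb:
  "hess_wedge (\<lambda>j k. c * G j k + d * H j k) b = (\<lambda>K. c * hess_wedge G b K + d * hess_wedge H b K)"
  unfolding hess_wedge_def by (simp add: algebra_simps sum.distrib sum_distrib_left)

lemma wedge_hess_wedge: "wedge (hess_wedge G a) b = hess_wedge G (wedge a b)"
  unfolding hess_wedge_def
  by (simp add: wedge_scale_left wedge_sum_left wedge_gen_wedge)

lemma hess_wedge_hess_wedge:
  "hess_wedge G (hess_wedge H b) K = ddc_const\<^sup>2 *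
     (\<Sum>j\<in>UNIV. \<Sum>k\<in>UNIV. \<Sum>l\<in>UNIV. \<Sum>m\<in>UNIV. G j k * H l m *
        gen_wedge (Inl j) (gen_wedge (Inr k) (gen_wedge (Inl l) (gen_wedge (Inr m) b))) K)"
  unfolding hess_wedge_def
  by (simp add: gen_wedge_scale gen_wedge_sum sum_distrib_left power2_eq_square mult_ac)

text \<open>Four exchanges of neighbouring generators move \<open>u\<close> and \<open>v\<close> in
  front of \<open>x\<close> and \<open>y\<close>, so the signs cancel. This is why multiplications
  by (1,1)-covectors commute.\<close>

lemma gen_wedge_pair_commute:
  "gen_wedge x (gen_wedge y (gen_wedge u (gen_wedge v b))) =
   gen_wedge u (gen_wedge v (gen_wedge x (gen_wedge y b)))"
proof -
  have "gen_wedge x (gen_wedge y (gen_wedge u (gen_wedge v b))) =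
      gen_wedge x (\<lambda>K. - gen_wedge u (\<lambda>K. - gen_wedge v (gen_wedge y b) K) K)"
    by (subst gen_wedge_anticommute, subst (2) gen_wedge_anticommute) simp
  also have "\<dots> = gen_wedge x (gen_wedge u (gen_wedge v (gen_wedge y b)))"
    by (simp add: gen_wedge_minus)
  also have "\<dots> = (\<lambda>K. - gen_wedge u (gen_wedge x (gen_wedge v (gen_wedge y b))) K)"
    by (rule gen_wedge_anticommute)
  also have "\<dots> = (\<lambda>K. - gen_wedge u (\<lambda>K. - gen_wedge v (gen_wedge x (gen_wedge y b)) K) K)"
    by (subst gen_wedge_anticommute[of x v]) simp
  also have "\<dots> = gen_wedge u (gen_wedge v (gen_wedge x (gen_wedge y b)))"
    by (simp add: gen_wedge_minus)
  finally show ?thesis .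
qed

lemma sum_swap_pairs:
  "(\<Sum>j\<in>A. \<Sum>k\<in>B. \<Sum>l\<in>C. \<Sum>m\<in>D. f j k l m) =
   (\<Sum>l\<in>C. \<Sum>m\<in>D. \<Sum>j\<in>A. \<Sum>k\<in>B. f j k l m)"
proof -
  have "(\<Sum>x\<in>A \<times> B. \<Sum>y\<in>C \<times> D. f (fst x) (snd x) (fst y) (snd y)) =
      (\<Sum>y\<in>C \<times> D. \<Sum>x\<in>A \<times> B. f (fst x) (snd x) (fst y) (snd y))"
    by (rule sum.swap)
  then show ?thesis by (simp add: sum.cartesian_product')
qed

lemma hess_wedge_commute: "hess_wedge G (hess_wedge H b) = hess_wedge H (hess_wedge G b)"
proof (rule ext)
  fix K
  have "(\<Sum>j\<in>UNIV. \<Sum>k\<in>UNIV. \<Sum>l\<in>UNIV. \<Sum>m\<in>UNIV. G j k * H l m *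
        gen_wedge (Inl j) (gen_wedge (Inr k) (gen_wedge (Inl l) (gen_wedge (Inr m) b))) K) =
      (\<Sum>l\<in>UNIV. \<Sum>m\<in>UNIV. \<Sum>j\<in>UNIV. \<Sum>k\<in>UNIV. G j k * H l m *
        gen_wedge (Inl j) (gen_wedge (Inr k) (gen_wedge (Inl l) (gen_wedge (Inr m) b))) K)"
    by (rule sum_swap_pairs)
  also have "\<dots> = (\<Sum>l\<in>UNIV. \<Sum>m\<in>UNIV. \<Sum>j\<in>UNIV. \<Sum>k\<in>UNIV. H l m * G j k *
        gen_wedge (Inl l) (gen_wedge (Inr m) (gen_wedge (Inl j) (gen_wedge (Inr k) b))) K)"
    by (intro sum.cong refl) (subst gen_wedge_pair_commute, simp only: mult.commute)
  finally show "hess_wedge G (hess_wedge H b) K = hess_wedge H (hess_wedge G b) K"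
    by (simp only: hess_wedge_hess_wedge)
qed

text \<open>The coefficient product is symmetric under exchanging \<open>j\<close> and
  \<open>l\<close>, while the fourfold wedge changes sign (three neighbouring exchanges), so the sum
  is its own negative. A rank-one matrix stands for the wedge of a (1,0)- and a (0,1)-covector; the
  case of interest is \<theta>.\<close>

lemma hess_wedge_rank_one_square:
  "hess_wedge (\<lambda>j k. c j * d k) (hess_wedge (\<lambda>j k. c j * d k) b) = (\<lambda>K. 0)"
proof (rule ext)
  fix K
  let ?g = "\<lambda>j k l m. gen_wedge (Inl j) (gen_wedge (Inr k) (gen_wedge (Inl l) (gen_wedge (Inr m) b))) K"
  let ?S = "\<Sum>j\<in>UNIV. \<Sum>k\<in>UNIV. \<Sum>l\<in>UNIV. \<Sum>m\<in>UNIV. c j * d k * (c l * d m) * ?g j k l m"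
  have swap: "?g j k l m = - ?g l k j m" for j k l m
  proof -
    have "?g j k l m =
        - gen_wedge (Inl j) (gen_wedge (Inl l) (gen_wedge (Inr k) (gen_wedge (Inr m) b))) K"
      by (subst (2) gen_wedge_anticommute) (simp add: gen_wedge_minus)
    also have "\<dots> = gen_wedge (Inl l) (gen_wedge (Inl j) (gen_wedge (Inr k) (gen_wedge (Inr m) b))) K"
      by (subst gen_wedge_anticommute) simp
    also have "\<dots> = - ?g l k j m"
      by (subst (2) gen_wedge_anticommute) (simp add: gen_wedge_minus)
    finally show ?thesis .
  qed
  have "?S = (\<Sum>k\<in>UNIV. \<Sum>j\<in>UNIV. \<Sum>l\<in>UNIV. \<Sum>m\<in>UNIV. c j * d k * (c l * d m) * ?g j k l m)"
    by (rule sum.swap)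
  also have "\<dots> = (\<Sum>k\<in>UNIV. \<Sum>l\<in>UNIV. \<Sum>j\<in>UNIV. \<Sum>m\<in>UNIV. c j * d k * (c l * d m) * ?g j k l m)"
    by (rule sum.cong[OF refl]) (rule sum.swap)
  also have "\<dots> = - (\<Sum>k\<in>UNIV. \<Sum>l\<in>UNIV. \<Sum>j\<in>UNIV. \<Sum>m\<in>UNIV. c l * d k * (c j * d m) * ?g l k j m)"
    unfolding sum_negf[symmetric]
  proof (intro sum.cong refl)
    fix k l j m
    have "c j * d k * (c l * d m) * ?g j k l m = c j * d k * (c l * d m) * - ?g l k j m"
      by (simp only: swap[of j k l m])
    also have "\<dots> = - (c l * d k * (c j * d m) * ?g l k j m)"
      by (simp only: mult_minus_right mult.commute mult.left_commute)
    finally show "c j * d k * (c l * d m) * ?g j k l m = - (c l * d k * (c j * d m) * ?g l k j m)" .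
  qed
  also have "\<dots> = - ?S"
    by (simp only: sum.swap[of "\<lambda>k l. \<Sum>j\<in>UNIV. \<Sum>m\<in>UNIV. c l * d k * (c j * d m) * ?g l k j m"])
  finally have "?S = 0" by simp
  then show "hess_wedge (\<lambda>j k. c j * d k) (hess_wedge (\<lambda>j k. c j * d k) b) K = 0"
    by (simp only: hess_wedge_hess_wedge mult_zero_right)
qed

text \<open>A binomial expansion for two commuting operators, cut off after the term of first order
  in \<open>H\<close>. For \<open>q = 0\<close> the truncated \<open>q - 1\<close> is harmless
  because of the factor \<open>of_nat q\<close>.\<close>

lemma hess_wedge_power_lincomb:
  fixes G H :: "'n::{finite,linorder} \<Rightarrow> 'n \<Rightarrow> complex"
  assumes "\<And>b. hess_wedge H (hess_wedge H b) = (\<lambda>K. 0)"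
  shows "(hess_wedge (\<lambda>j k. u * G j k + v * H j k) ^^ q) b K =
    u ^ q * (hess_wedge G ^^ q) b K +
    of_nat q * u ^ (q - 1) * v * hess_wedge H ((hess_wedge G ^^ (q - 1)) b) K"
proof (induction q arbitrary: K)
  case (Suc q)
  let ?B = "hess_wedge G" and ?H = "hess_wedge H"
  have HG: "?B (?H ((?B ^^ (q - 1)) b)) K = ?H ((?B ^^ q) b) K" if "q > 0" for K
    using that by (cases q) (simp_all add: hess_wedge_commute)
  have IH: "(hess_wedge (\<lambda>j k. u * G j k + v * H j k) ^^ q) b =
    (\<lambda>K. u ^ q * (?B ^^ q) b K + of_nat q * u ^ (q - 1) * v * ?H ((?B ^^ (q - 1)) b) K)"
    using Suc by blast
  have "(hess_wedge (\<lambda>j k. u * G j k + v * H j k) ^^ Suc q) b K =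
     u * (u ^ q * ?B ((?B ^^ q) b) K + of_nat q * u ^ (q - 1) * v * ?B (?H ((?B ^^ (q - 1)) b)) K)
     + v * (u ^ q * ?H ((?B ^^ q) b) K)"
    by (simp add: IH hess_wedge_lincomb hess_wedge_add hess_wedge_scale assms)
  also have "\<dots> = u ^ Suc q * (?B ^^ Suc q) b K + of_nat (Suc q) * u ^ q * v * ?H ((?B ^^ q) b) K"
  proof (cases q)
    case (Suc k)
    then show ?thesis using HG[of K] by (simp add: algebra_simps)
  qed simp
  finally show ?case by simp
qed simp

section \<open>Bidegrees and expansion in basis covectors\<close>

lemma gen_wedge_Inl_bidegree:
  assumes "\<And>K. K \<notin> bidegree_indices p q \<Longrightarrow> b K = 0" "K \<notin> bidegree_indices (Suc p) q"
  shows "gen_wedge (Inl j) b K = 0"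
proof (cases "Inl j \<in> K")
  case True
  have "Inl -` (K - {Inl j}) = Inl -` K - {j}" "Inr -` (K - {Inl j}) = Inr -` K" by auto
  then have "K - {Inl j} \<notin> bidegree_indices p q"
    using assms(2) True unfolding bidegree_indices_def
    by (auto simp: card_Diff_singleton_if split: if_splits)
       (metis Suc_pred card_gt_0_iff empty_iff finite vimageI)
  then show ?thesis using assms(1) by (simp add: gen_wedge_apply)
qed (simp add: gen_wedge_apply)

lemma gen_wedge_Inr_bidegree:
  assumes "\<And>K. K \<notin> bidegree_indices p q \<Longrightarrow> b K = 0" "K \<notin> bidegree_indices p (Suc q)"
  shows "gen_wedge (Inr j) b K = 0"
proof (cases "Inr j \<in> K")
  case True
  have "Inr -` (K - {Inr j}) = Inr -` K - {j}" "Inl -` (K - {Inr j}) = Inl -` K" by auto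
  then have "K - {Inr j} \<notin> bidegree_indices p q"
    using assms(2) True unfolding bidegree_indices_def
    by (auto simp: card_Diff_singleton_if split: if_splits)
       (metis Suc_pred card_gt_0_iff empty_iff finite vimageI)
  then show ?thesis using assms(1) by (simp add: gen_wedge_apply)
qed (simp add: gen_wedge_apply)

lemma hess_wedge_bidegree:
  assumes "\<And>K. K \<notin> bidegree_indices p p \<Longrightarrow> b K = 0" "K \<notin> bidegree_indices (Suc p) (Suc p)"
  shows "hess_wedge G b K = 0"
proof -
  have "gen_wedge (Inr k) b L = 0" if "L \<notin> bidegree_indices p (Suc p)" for k L
    using gen_wedge_Inr_bidegree[OF assms(1) that] .
  then have "gen_wedge (Inl j) (gen_wedge (Inr k) b) K = 0" for j k
    using gen_wedge_Inl_bidegree[OF _ assms(2)] by blast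
  then show ?thesis by (simp add: hess_wedge_def)
qed

lemma hess_wedge_power_bidegree:
  assumes "K \<notin> bidegree_indices p p"
  shows "(hess_wedge G ^^ p) (basis_covec {}) K = 0"
  using assms
proof (induction p arbitrary: K)
  case 0
  then show ?case by (auto simp: basis_covec_def bidegree_indices_def)
next
  case (Suc p)
  then show ?case using hess_wedge_bidegree[of p "(hess_wedge G ^^ p) (basis_covec {})"] by simp
qed

lemma covec_basis_expansion:
  fixes b :: "'n::finite covec"
  assumes "\<And>K. K \<notin> S \<Longrightarrow> b K = 0"
  shows "b = (\<lambda>L. \<Sum>K\<in>S. b K * basis_covec K L)"
proof (rule ext)
  fix L
  have "(\<Sum>K\<in>S. b K * basis_covec K L) = (\<Sum>K\<in>S. if K = L then b L else 0)"
    by (rule sum.cong) (auto simp: basis_covec_def)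
  then show "b L = (\<Sum>K\<in>S. b K * basis_covec K L)" using assms[of L] by simp
qed

text \<open>Powers of a (1,1)-form become iterates of one operator, also when acting on a further
  covector, so that no general wedge product has to be expanded afterwards.\<close>

lemma form_power_hess_wedge:
  assumes "\<alpha> z = hess_wedge G (basis_covec {})"
  shows "form_power \<alpha> k z = (hess_wedge G ^^ k) (basis_covec {})"
    and "wedge (form_power \<alpha> k z) b = (hess_wedge G ^^ k) b"
proof -
  show 1: "form_power \<alpha> k z = (hess_wedge G ^^ k) (basis_covec {})"
  proof (induction k)
    case (Suc k)
    then show ?case by (simp add: form_wedge_def assms wedge_hess_wedge)
  qed (simp add: fun_form_def)
  show "wedge (form_power \<alpha> k z) b = (hess_wedge G ^^ k) b"
    unfolding 1 by (induction k) (simp_all add: wedge_hess_wedge)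
qed

section \<open>Second derivatives of radial functions\<close>

text \<open>The Wirtinger combination is taken of a real-linear map, not of a function. Chain and
  product rules can then be used for real derivatives, and the translation to generators comes
  last.\<close>

definition gen_coeff :: "'n::finite + 'n \<Rightarrow> (complex ^ 'n \<Rightarrow> complex) \<Rightarrow> complex" where
  "gen_coeff x l = (case x of
      Inl j \<Rightarrow> (l (axis j 1) - \<i> * l (axis j \<i>)) / 2
    | Inr j \<Rightarrow> (l (axis j 1) + \<i> * l (axis j \<i>)) / 2)"

definition gen_deriv :: "'n::finite + 'n \<Rightarrow> (complex ^ 'n \<Rightarrow> complex) \<Rightarrow> complex ^ 'n \<Rightarrow> complex" where
  "gen_deriv x f z = gen_coeff x (frechet_derivative f (at z))"

lemma gen_deriv_eq:
  assumes "(f has_derivative f') (at z)"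
  shows "gen_deriv x f z = gen_coeff x f'"
  unfolding gen_deriv_def using frechet_derivative_at[OF assms] by simp

definition gen_sign :: "'n + 'n \<Rightarrow> complex" where
  "gen_sign x = (case x of Inl j \<Rightarrow> - 1 | Inr j \<Rightarrow> 1)"

lemma sum_UNIV_Plus: "(\<Sum>x\<in>UNIV. f x) = (\<Sum>j\<in>UNIV. f (Inl j)) + (\<Sum>j\<in>UNIV. f (Inr j))"
  for f :: "'a::finite + 'a \<Rightarrow> complex"
  unfolding UNIV_Plus_UNIV[symmetric] by (subst sum.Plus) (simp_all add: comp_def)

lemma d_form_eq: "d_form \<alpha> z K = (\<Sum>x\<in>UNIV. gen_wedge x (\<lambda>L. gen_deriv x (\<lambda>w. \<alpha> w L) z) K)"
  unfolding d_form_def del_def delbar_def sum_UNIV_Plus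
  by (simp add: gen_wedge_def gen_deriv_def gen_coeff_def wirtinger_def[abs_def]
      wirtinger_bar_def[abs_def] dir_deriv_def)

lemma dc_form_eq:
  "dc_form \<alpha> z K = \<i> / (4 * of_real pi) *
    (\<Sum>x\<in>UNIV. gen_sign x * gen_wedge x (\<lambda>L. gen_deriv x (\<lambda>w. \<alpha> w L) z) K)"
  unfolding dc_form_def del_def delbar_def sum_UNIV_Plus
  by (simp add: gen_sign_def gen_wedge_def gen_deriv_def gen_coeff_def wirtinger_def[abs_def]
      wirtinger_bar_def[abs_def] dir_deriv_def sum_negf)

text \<open>The coefficients of \<open>d|w|\<^sup>2\<close>.\<close>

definition gen_grad :: "'n::finite + 'n \<Rightarrow> complex ^ 'n \<Rightarrow> complex" where
  "gen_grad x w = (case x of Inl j \<Rightarrow> cnj (w $ j) | Inr j \<Rightarrow> w $ j)"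

lemma bounded_linear_gen_grad: "bounded_linear (gen_grad x)"
proof (cases x)
  case (Inl j)
  have "gen_grad x = (\<lambda>w. cnj (w $ j))" by (simp add: fun_eq_iff gen_grad_def Inl)
  then show ?thesis
    by (simp add: bounded_linear_compose[OF bounded_linear_cnj bounded_linear_vec_nth])
next
  case (Inr j)
  have "gen_grad x = (\<lambda>w. w $ j)" by (simp add: fun_eq_iff gen_grad_def Inr)
  then show ?thesis by (simp add: bounded_linear_vec_nth)
qed

lemma has_derivative_radial:
  fixes z a :: "complex ^ 'n::finite"
  assumes "(h has_real_derivative h') (at ((norm (z - a))\<^sup>2))"
  shows "((\<lambda>w. complex_of_real (h ((norm (w - a))\<^sup>2))) has_derivative
     (\<lambda>v. of_real (h' * (2 * ((z - a) \<bullet> v))))) (at z)"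
proof -
  have "((\<lambda>w. (norm (w - a))\<^sup>2) has_derivative (\<lambda>v. 2 * ((z - a) \<bullet> v))) (at z)"
    unfolding power2_norm_eq_inner
    by (auto intro!: derivative_eq_intros simp: inner_commute)
  then have "((\<lambda>w. h ((norm (w - a))\<^sup>2)) has_derivative (\<lambda>v. h' * (2 * ((z - a) \<bullet> v)))) (at z)"
    using has_derivative_compose[of "\<lambda>w. (norm (w - a))\<^sup>2" _ z UNIV h "(*) h'"] assms
    by (simp add: has_field_derivative_def)
  then show ?thesis by (rule has_derivative_of_real)
qed

lemma gen_coeff_inner: "gen_coeff x (\<lambda>v. of_real (c * (2 * (w \<bullet> v)))) = of_real c * gen_grad x w"
  for w :: "complex ^ 'n::finite"
  by (cases x) (auto simp: gen_coeff_def gen_grad_def inner_axis complex_eq_iff inner_complex_def)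

text \<open>The second derivatives of the squared norm, of which only the mixed ones survive. All
  four blocks are kept because \<open>d_form\<close> and \<open>dc_form\<close> run over all
  generators.\<close>

definition gen_hess :: "'n + 'n \<Rightarrow> 'n + 'n \<Rightarrow> complex" where
  "gen_hess x y = (case x of
      Inl j \<Rightarrow> (case y of Inl k \<Rightarrow> 0 | Inr k \<Rightarrow> if j = k then 1 else 0)
    | Inr j \<Rightarrow> (case y of Inl k \<Rightarrow> if j = k then 1 else 0 | Inr k \<Rightarrow> 0))"

lemma gen_coeff_grad: "gen_coeff x (gen_grad y) = gen_hess x y" for x :: "'n::finite + 'n"
  by (cases x; cases y)
     (auto simp: gen_coeff_def gen_grad_def gen_hess_def axis_def complex_eq_iff)

lemma gen_coeff_add: "gen_coeff x (\<lambda>v. f v + g v) = gen_coeff x f + gen_coeff x g"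
  by (cases x) (auto simp: gen_coeff_def field_simps)

lemma gen_coeff_scale: "gen_coeff x (\<lambda>v. c * f v) = c * gen_coeff x f"
  by (cases x) (auto simp: gen_coeff_def field_simps)

lemma gen_coeff_scale_right: "gen_coeff x (\<lambda>v. f v * c) = gen_coeff x f * c"
  by (cases x) (auto simp: gen_coeff_def field_simps)

lemma gen_coeff_sum: "gen_coeff x (\<lambda>v. \<Sum>i\<in>I. f i v) = (\<Sum>i\<in>I. gen_coeff x (f i))"
  by (cases x) (auto simp: gen_coeff_def sum.distrib sum_subtractf sum_distrib_left sum_divide_distrib
      diff_divide_distrib add_divide_distrib)

text \<open>A symmetric coefficient meets an anticommuting wedge, so terms cancel in pairs. This
  removes the purely holomorphic and purely antiholomorphic blocks of a Hessian from
  \<open>ddc\<close>.\<close>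

lemma gen_wedge_symmetric_sum:
  assumes "\<And>j k. S j k = S k j"
  shows "(\<Sum>j\<in>I. \<Sum>k\<in>I. S j k * gen_wedge (c j) (gen_wedge (c k) b) K) = 0"
proof -
  have "(\<Sum>j\<in>I. \<Sum>k\<in>I. S j k * gen_wedge (c j) (gen_wedge (c k) b) K) =
    (\<Sum>k\<in>I. \<Sum>j\<in>I. S j k * gen_wedge (c j) (gen_wedge (c k) b) K)"
    by (rule sum.swap)
  also have "\<dots> = (\<Sum>k\<in>I. \<Sum>j\<in>I. - (S k j * gen_wedge (c k) (gen_wedge (c j) b) K))"
  proof (intro sum.cong refl)
    fix k j
    have "gen_wedge (c j) (gen_wedge (c k) b) K = - gen_wedge (c k) (gen_wedge (c j) b) K"
      by (subst gen_wedge_anticommute) simp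
    then show "S j k * gen_wedge (c j) (gen_wedge (c k) b) K =
        - (S k j * gen_wedge (c k) (gen_wedge (c j) b) K)"
      using assms[of j k] by simp
  qed
  finally show ?thesis by (simp add: sum_negf)
qed

text \<open>By the chain rule the complex Hessian of \<open>h(s)\<close> is \<open>h'\<close> times
  the identity plus \<open>h''\<close> times a rank-one matrix, and the constant covector
  \<open>b\<close> passes through both derivatives. Asking for \<open>h'\<close> on an open set
  only, and for \<open>h''\<close> only at one point, makes the result usable for globally smooth
  profiles and also for \<phi> away from its pole.\<close>

lemma ddc_radial:
  fixes z a :: "complex ^ 'n::{finite,linorder}" and b :: "'n covec"
  assumes "open U" and z: "(norm (z - a))\<^sup>2 \<in> U"
    and h': "\<And>s. s \<in> U \<Longrightarrow> (h has_real_derivative h' s) (at s)"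
    and h'': "(h' has_real_derivative h'') (at ((norm (z - a))\<^sup>2))"
  shows "ddc (\<lambda>w L. complex_of_real (h ((norm (w - a))\<^sup>2)) * b L) z =
    hess_wedge (\<lambda>j k. of_real (h' ((norm (z - a))\<^sup>2)) * (if j = k then 1 else 0)
      + of_real h'' * (cnj ((z - a) $ j) * (z - a) $ k)) b"
proof (rule ext)
  fix K
  let ?\<alpha> = "\<lambda>w L. complex_of_real (h ((norm (w - a))\<^sup>2)) * b L"
  let ?c = "\<i> / (4 * complex_of_real pi)"
  let ?s = "\<lambda>w. (norm (w - a))\<^sup>2"
  \<comment> \<open>\<open>d_form\<close> differentiates the coefficients of \<open>dc_form\<close>
    at \<open>z\<close>, so their formula is needed on a whole neighbourhood of
    \<open>z\<close>.\<close>
  define V where "V = {w. ?s w \<in> U}"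
  have "open V"
  proof -
    have "open (?s -` U)" by (rule open_vimage[OF \<open>open U\<close>]) (intro continuous_intros)
    then show ?thesis by (simp add: V_def vimage_def)
  qed
  have "z \<in> V" using z by (simp add: V_def)
  define H where "H x y = of_real h'' * gen_grad x (z - a) * gen_grad y (z - a)
      + of_real (h' (?s z)) * gen_hess x y" for x y :: "'n + 'n"
  have dc: "dc_form ?\<alpha> w L = (\<Sum>y\<in>UNIV. ?c * gen_sign y * gen_wedge y b L *
      (of_real (h' (?s w)) * gen_grad y (w - a)))" if "w \<in> V" for w L
  proof -
    have "gen_deriv y (\<lambda>w. ?\<alpha> w L) w = of_real (h' (?s w)) * gen_grad y (w - a) * b L" for y L
    proof -
      have "(h has_real_derivative h' (?s w)) (at (?s w))" using that h' by (simp add: V_def)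
      from has_derivative_mult_left[OF has_derivative_radial[OF this]]
      have "((\<lambda>w. ?\<alpha> w L) has_derivative (\<lambda>v. of_real (h' (?s w) * (2 * ((w - a) \<bullet> v))) * b L)) (at w)" .
      from gen_deriv_eq[OF this] show ?thesis
        by (simp only: gen_coeff_scale_right gen_coeff_inner)
    qed
    then show ?thesis
      by (simp only: dc_form_eq gen_wedge_scale) (simp only: sum_distrib_left mult.assoc mult.commute mult.left_commute)
  qed
  have dH: "((\<lambda>w. of_real (h' (?s w)) * gen_grad y (w - a)) has_derivative
      (\<lambda>v. of_real (h' (?s z)) * gen_grad y v
        + of_real (h'' * (2 * ((z - a) \<bullet> v))) * gen_grad y (z - a))) (at z)" for y :: "'n + 'n"
  proof -
    have "((\<lambda>w. gen_grad y (w - a)) has_derivative gen_grad y) (at z)"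
      by (rule bounded_linear.has_derivative[OF bounded_linear_gen_grad])
         (auto intro!: derivative_eq_intros)
    from has_derivative_mult[OF has_derivative_radial[OF h''] this] show ?thesis .
  qed
  have "gen_deriv x (\<lambda>w. dc_form ?\<alpha> w L) z =
      (\<Sum>y\<in>UNIV. ?c * gen_sign y * gen_wedge y b L * H x y)" for x L
  proof -
    have "((\<lambda>w. \<Sum>y\<in>UNIV. ?c * gen_sign y * gen_wedge y b L *
        (of_real (h' (?s w)) * gen_grad y (w - a))) has_derivative
      (\<lambda>v. \<Sum>y\<in>UNIV. ?c * gen_sign y * gen_wedge y b L * (of_real (h' (?s z)) * gen_grad y v
        + of_real (h'' * (2 * ((z - a) \<bullet> v))) * gen_grad y (z - a)))) (at z)"
      by (intro has_derivative_sum has_derivative_mult_right dH)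
    from has_derivative_transform_within_open[OF this \<open>open V\<close> \<open>z \<in> V\<close> dc[symmetric]]
    show ?thesis
      by (subst gen_deriv_eq, assumption)
         (simp only: gen_coeff_sum gen_coeff_scale gen_coeff_add gen_coeff_scale_right
           gen_coeff_inner gen_coeff_grad H_def add.commute mult.assoc)
  qed
  then have "ddc ?\<alpha> z K = (\<Sum>x\<in>UNIV. \<Sum>y\<in>UNIV. ?c * gen_sign y * H x y * gen_wedge x (gen_wedge y b) K)"
    unfolding ddc_def d_form_eq
    by (simp only: gen_wedge_sum) (simp only: mult.assoc mult.commute[of _ "H _ _"] gen_wedge_scale)
  also have "\<dots> = ?c * (\<Sum>x\<in>UNIV. \<Sum>y\<in>UNIV. gen_sign y * H x y * gen_wedge x (gen_wedge y b) K)"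
    by (simp only: sum_distrib_left mult.assoc)
  \<comment> \<open>Blocks with two generators of the same type cancel by symmetry. The two mixed
    blocks have opposite \<open>gen_sign\<close>, and one more sign from anticommutation makes them
    equal; the resulting 2 turns the constant of \<open>dc_form\<close> into
    \<open>ddc_const\<close>.\<close>
  also have "(\<Sum>x\<in>UNIV. \<Sum>y\<in>UNIV. gen_sign y * H x y * gen_wedge x (gen_wedge y b) K) =
     2 * (\<Sum>j\<in>UNIV. \<Sum>k\<in>UNIV. H (Inl j) (Inr k) * gen_wedge (Inl j) (gen_wedge (Inr k) b) K)"
  proof -
    have sym: "H x y = H y x" for x y
      by (cases x; cases y) (auto simp: H_def gen_hess_def)
    have ll: "(\<Sum>j\<in>UNIV. \<Sum>k\<in>UNIV. H (Inl j) (Inl k) * gen_wedge (Inl j) (gen_wedge (Inl k) b) K) = 0"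
      and rr: "(\<Sum>j\<in>UNIV. \<Sum>k\<in>UNIV. H (Inr j) (Inr k) * gen_wedge (Inr j) (gen_wedge (Inr k) b) K) = 0"
      by (rule gen_wedge_symmetric_sum, rule sym)+
    have "(\<Sum>j\<in>UNIV. \<Sum>k\<in>UNIV. H (Inr j) (Inl k) * gen_wedge (Inr j) (gen_wedge (Inl k) b) K) =
        (\<Sum>k\<in>UNIV. \<Sum>j\<in>UNIV. H (Inr j) (Inl k) * gen_wedge (Inr j) (gen_wedge (Inl k) b) K)"
      by (rule sum.swap)
    also have "\<dots> = - (\<Sum>k\<in>UNIV. \<Sum>j\<in>UNIV. H (Inl k) (Inr j) * gen_wedge (Inl k) (gen_wedge (Inr j) b) K)"
      unfolding sum_negf[symmetric]
      by (intro sum.cong refl) (subst gen_wedge_anticommute, simp add: sym)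
    finally show ?thesis
      unfolding sum_UNIV_Plus using ll rr
      by (simp add: gen_sign_def sum_negf sum.distrib sum_subtractf)
  qed
  finally show "ddc ?\<alpha> z K = hess_wedge (\<lambda>j k. of_real (h' ((norm (z - a))\<^sup>2)) * (if j = k then 1 else 0)
      + of_real h'' * (cnj ((z - a) $ j) * (z - a) $ k)) b K"
    unfolding hess_wedge_def
    by (simp add: H_def gen_grad_def gen_hess_def ddc_const_def add.commute mult.assoc)
qed

section \<open>Smooth functions\<close>

text \<open>The derivative is chosen existentially at each order, so closure properties become
  inductions on \<open>n\<close> over all functions, without formulas for higher
  derivatives.\<close>

fun deriv_times :: "nat \<Rightarrow> (real \<Rightarrow> real) \<Rightarrow> bool" where
  "deriv_times 0 f \<longleftrightarrow> True"
| "deriv_times (Suc n) f \<longleftrightarrow>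
    (\<exists>f'. (\<forall>x. (f has_real_derivative f' x) (at x)) \<and> deriv_times n f')"

lemma deriv_times_SucI:
  assumes "\<And>x. (f has_real_derivative f' x) (at x)" "deriv_times n f'"
  shows "deriv_times (Suc n) f"
  using assms by auto

lemma deriv_times_SucE:
  assumes "deriv_times (Suc n) f"
  obtains f' where "\<forall>x. (f has_real_derivative f' x) (at x)" "deriv_times n f'"
  using assms by auto

declare deriv_times.simps(2) [simp del]

lemma deriv_times_Suc: "deriv_times (Suc n) f \<Longrightarrow> deriv_times n f"
proof (induction n arbitrary: f)
  case (Suc n)
  from Suc.prems obtain f' where
    d: "\<forall>x. (f has_real_derivative f' x) (at x)" "deriv_times (Suc n) f'"
    by (rule deriv_times_SucE)
  note d = d(1)[rule_format] d(2)
  show ?case by (rule deriv_times_SucI[OF d(1) Suc.IH[OF d(2)]])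
qed simp

lemma deriv_times_const: "deriv_times n (\<lambda>x. c)"
proof (induction n arbitrary: c)
  case (Suc n)
  have "((\<lambda>x. c) has_real_derivative 0) (at x)" for x by simp
  then show ?case using Suc by (rule deriv_times_SucI)
qed simp

lemma deriv_times_add:
  "deriv_times n f \<Longrightarrow> deriv_times n g \<Longrightarrow> deriv_times n (\<lambda>x. f x + g x)"
proof (induction n arbitrary: f g)
  case (Suc n)
  from Suc.prems(1) obtain f' where
    d: "\<forall>x. (f has_real_derivative f' x) (at x)" "deriv_times n f'"
    by (rule deriv_times_SucE)
  note d = d(1)[rule_format] d(2)
  from Suc.prems(2) obtain g' where
    e: "\<forall>x. (g has_real_derivative g' x) (at x)" "deriv_times n g'"
    by (rule deriv_times_SucE)
  note e = e(1)[rule_format] e(2)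
  note d = d(1,2) e(1,2)
  show ?case by (rule deriv_times_SucI[OF DERIV_add[OF d(1,3)] Suc.IH[OF d(2,4)]])
qed simp

lemma deriv_times_mult:
  "deriv_times n f \<Longrightarrow> deriv_times n g \<Longrightarrow> deriv_times n (\<lambda>x. f x * g x)"
proof (induction n arbitrary: f g)
  case (Suc n)
  from Suc.prems(1) obtain f' where
    d: "\<forall>x. (f has_real_derivative f' x) (at x)" "deriv_times n f'"
    by (rule deriv_times_SucE)
  note d = d(1)[rule_format] d(2)
  from Suc.prems(2) obtain g' where
    e: "\<forall>x. (g has_real_derivative g' x) (at x)" "deriv_times n g'"
    by (rule deriv_times_SucE)
  note e = e(1)[rule_format] e(2)
  note d = d(1,2) e(1,2)
  have "deriv_times n (\<lambda>x. f' x * g x + g' x * f x)"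
    by (intro deriv_times_add Suc.IH d Suc.prems[THEN deriv_times_Suc])
  moreover have "((\<lambda>x. f x * g x) has_real_derivative f' x * g x + g' x * f x) (at x)" for x
    by (rule DERIV_mult[OF d(1,3)])
  ultimately show ?case by (rule deriv_times_SucI[rotated])
qed simp

lemma deriv_times_compose_affine: "deriv_times n f \<Longrightarrow> deriv_times n (\<lambda>x. f (c * x + d))"
proof (induction n arbitrary: f)
  case (Suc n)
  from Suc.prems(1) obtain f' where
    d: "\<forall>x. (f has_real_derivative f' x) (at x)" "deriv_times n f'"
    by (rule deriv_times_SucE)
  note d = d(1)[rule_format] d(2)
  have "((\<lambda>x. f (c * x + d)) has_real_derivative f' (c * x + d) * c) (at x)" for x
    by (rule DERIV_chain2[OF d(1)]) (auto intro!: derivative_eq_intros)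
  moreover have "deriv_times n (\<lambda>x. f' (c * x + d) * c)"
    by (intro deriv_times_mult deriv_times_const Suc.IH d)
  ultimately show ?case by (rule deriv_times_SucI)
qed simp

text \<open>The functions \<open>x\<^sup>-\<^sup>k exp (- 1 / x)\<close>, extended by zero to \<open>x \<le> 0\<close>, span a space closed under
  differentiation.\<close>

definition flat :: "nat \<Rightarrow> real \<Rightarrow> real" where
  "flat k x = (if x > 0 then inverse x ^ k * exp (- inverse x) else 0)"

lemma flat_has_derivative:
  "(flat k has_real_derivative - real k * flat (Suc k) x + flat (Suc (Suc k)) x) (at x)"
proof (cases x "0 :: real" rule: linorder_cases)
  case less
  have "(flat k has_real_derivative 0) (at x)"
    by (rule has_field_derivative_transform_within_open[of "\<lambda>x. 0" _ _ "{..<0}"])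
       (use less in \<open>auto simp: flat_def\<close>)
  with less show ?thesis by (simp add: flat_def)
next
  case equal
  \<comment> \<open>With \<open>y = inverse h\<close>, the right difference quotient at 0 is
    \<open>y ^ Suc k / exp y\<close>, which tends to 0 as \<open>y\<close> grows; the left one is
    identically 0.\<close>
  have "((\<lambda>y :: real. y ^ Suc k / exp y) \<longlongrightarrow> 0) at_top"
    by (rule tendsto_power_div_exp_0)
  from filterlim_compose[OF this filterlim_inverse_at_top_right]
  have "((\<lambda>h :: real. inverse h ^ Suc k / exp (inverse h)) \<longlongrightarrow> 0) (at_right 0)" .
  then have "((\<lambda>h. flat k h / h) \<longlongrightarrow> 0) (at_right 0)"
    by (rule Lim_transform_eventually)
       (auto simp: eventually_at_right_less flat_def exp_minus field_simps
         intro!: eventually_mono[OF eventually_at_right_less])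
  moreover have "((\<lambda>h. flat k h / h) \<longlongrightarrow> 0) (at_left 0)"
    by (rule Lim_transform_eventually[OF tendsto_const])
       (auto simp: eventually_at_left_field flat_def intro!: exI[of _ "-1"])
  ultimately have "((\<lambda>h. flat k h / h) \<longlongrightarrow> 0) (at 0)" by (simp add: filterlim_split_at)
  then have "(flat k has_real_derivative 0) (at 0)"
    by (simp add: DERIV_def flat_def)
  with equal show ?thesis by (simp add: flat_def)
next
  case greater
  have k: "k = 0 \<or> x ^ k = x * x ^ (k - Suc 0)" by (cases k) auto
  have "((\<lambda>x. inverse x ^ k * exp (- inverse x)) has_real_derivative
      - real k * flat (Suc k) x + flat (Suc (Suc k)) x) (at x)"
    using greater k
    by (auto intro!: derivative_eq_intros simp: flat_def field_simps power2_eq_square)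
  then show ?thesis
    by (rule has_field_derivative_transform_within_open[of _ _ _ "{0<..}"])
       (use greater in \<open>auto simp: flat_def\<close>)
qed

lemma deriv_times_flat: "deriv_times n (flat k)"
proof (induction n arbitrary: k)
  case (Suc n)
  have "deriv_times n (\<lambda>x. - real k * flat (Suc k) x + flat (Suc (Suc k)) x)"
    by (intro deriv_times_add deriv_times_mult deriv_times_const Suc)
  then show ?case using flat_has_derivative by (rule deriv_times_SucI[rotated])
qed simp

text \<open>The power is singular at 0, but \<open>g\<close> vanishes on a neighbourhood of the
  half-line \<open>s \<le> 0\<close>. The exponent is generalised in the induction because
  differentiation lowers it by 1.\<close>

lemma deriv_times_powr_mult:
  assumes "\<delta> > 0" "deriv_times n g" "\<And>s. s < \<delta> \<Longrightarrow> g s = 0"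
  shows "deriv_times n (\<lambda>s. s powr a * g s)"
  using assms(2,3)
proof (induction n arbitrary: a g)
  case (Suc n)
  from Suc.prems(1) obtain g' where
    d: "\<forall>x. (g has_real_derivative g' x) (at x)" "deriv_times n g'"
    by (rule deriv_times_SucE)
  note d = d(1)[rule_format] d(2)
  have z: "(g has_real_derivative 0) (at s)" if "s < \<delta>" for s
    by (rule has_field_derivative_transform_within_open[of "\<lambda>x. 0" _ _ "{..<\<delta>}"])
       (use that Suc.prems in auto)
  have z': "g' s = 0" if "s < \<delta>" for s using DERIV_unique[OF d(1) z[OF that]] .
  have "((\<lambda>s. s powr a * g s) has_real_derivative
      a * (s powr (a - 1) * g s) + s powr a * g' s) (at s)" for s
  proof (cases "s > 0")
    case True
    then have "((\<lambda>s. s powr a) has_real_derivative a * s powr (a - 1)) (at s)"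
      by (rule has_real_derivative_powr)
    from DERIV_mult[OF this d(1)] show ?thesis by (simp add: mult_ac)
  next
    case False
    then have s: "s < \<delta>" using assms(1) by simp
    have "((\<lambda>s. s powr a * g s) has_real_derivative 0) (at s)"
      by (rule has_field_derivative_transform_within_open[of "\<lambda>x. 0" _ _ "{..<\<delta>}"])
         (use s Suc.prems in auto)
    then show ?thesis using s z' Suc.prems by simp
  qed
  moreover have "deriv_times n (\<lambda>s. a * (s powr (a - 1) * g s) + s powr a * g' s)"
    by (intro deriv_times_add deriv_times_mult deriv_times_const Suc.IH d(2) z'
        Suc.prems(1)[THEN deriv_times_Suc] Suc.prems(2))
  ultimately show ?case by (rule deriv_times_SucI)
qed simp

text \<open>Lets smoothness be established for a second derivative alone and passed up to the
  function.\<close>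

lemma deriv_times_antiderivative:
  assumes "\<And>n. deriv_times n g" "\<And>x. (G has_real_derivative g x) (at x)"
  shows "deriv_times n G"
proof (cases n)
  case (Suc k)
  then show ?thesis using deriv_times_SucI[OF assms(2,1)] by simp
qed simp

section \<open>Finite-order differentiability in several variables\<close>

fun diff_times :: "nat \<Rightarrow> ('a::real_normed_vector \<Rightarrow> 'b::real_normed_vector) \<Rightarrow> bool" where
  "diff_times 0 f \<longleftrightarrow> True"
| "diff_times (Suc n) f \<longleftrightarrow>
    (\<exists>f'. (\<forall>x. (f has_derivative f' x) (at x)) \<and> (\<forall>v. diff_times n (\<lambda>x. f' x v)))"

lemma diff_times_SucI:
  assumes "\<And>x. (f has_derivative f' x) (at x)" "\<And>v. diff_times n (\<lambda>x. f' x v)"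
  shows "diff_times (Suc n) f"
  using assms by auto

lemma diff_times_SucE:
  assumes "diff_times (Suc n) f"
  obtains f' where "\<forall>x. (f has_derivative f' x) (at x)" "\<forall>v. diff_times n (\<lambda>x. f' x v)"
  using assms by auto

declare diff_times.simps(2) [simp del]

lemma smooth_funI:
  assumes "\<And>n. diff_times n f"
  shows "smooth_fun f"
proof -
  have "foldr dir_deriv vs f differentiable_on UNIV \<and> (\<forall>n. diff_times n f)"
    if "\<And>n. diff_times n f" for vs using that
  \<comment> \<open>\<open>foldr\<close> applies the last direction of the list first, so directions
    are split off at the end; the hypothesis, general in \<open>f\<close>, then fits
    \<open>dir_deriv v f\<close>.\<close>
  proof (induction vs arbitrary: f rule: rev_induct)
    case Nil
    from Nil[of "Suc 0"] obtain f' where "\<forall>x. (f has_derivative f' x) (at x)"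
      by (rule diff_times_SucE)
    then show ?case using Nil by (auto simp: differentiable_on_def differentiable_def)
  next
    case (snoc v vs)
    have "diff_times n (dir_deriv v f)" for n
    proof -
      from snoc.prems[of "Suc n"] obtain f' where
        f': "\<forall>x. (f has_derivative f' x) (at x)" "\<forall>v. diff_times n (\<lambda>x. f' x v)"
        by (rule diff_times_SucE)
      note f' = f'[rule_format]
      have "dir_deriv v f = (\<lambda>x. f' x v)"
        unfolding dir_deriv_def using frechet_derivative_at[OF f'(1)] by metis
      then show ?thesis using f'(2) by simp
    qed
    from snoc.IH[OF this] show ?case using snoc.prems by simp
  qed
  then show ?thesis unfolding smooth_fun_def using assms by blast
qed

lemma diff_times_Suc: "diff_times (Suc n) f \<Longrightarrow> diff_times n f"
proof (induction n arbitrary: f)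
  case (Suc n)
  from Suc.prems obtain f' where
    d: "\<forall>x. (f has_derivative f' x) (at x)" "\<forall>v. diff_times (Suc n) (\<lambda>x. f' x v)"
    by (rule diff_times_SucE)
  note d = d[rule_format]
  show ?case by (rule diff_times_SucI[OF d(1) Suc.IH[OF d(2)]])
qed simp

lemma diff_times_const: "diff_times n (\<lambda>x. c)"
proof (induction n arbitrary: c)
  case (Suc n)
  have "((\<lambda>x. c) has_derivative (\<lambda>v. 0)) (at x)" for x by simp
  then show ?case using Suc by (rule diff_times_SucI)
qed simp

lemma diff_times_add:
  "diff_times n f \<Longrightarrow> diff_times n g \<Longrightarrow> diff_times n (\<lambda>x. f x + g x)"
proof (induction n arbitrary: f g)
  case (Suc n)
  from Suc.prems(1) obtain f' where
    d: "\<forall>x. (f has_derivative f' x) (at x)" "\<forall>v. diff_times n (\<lambda>x. f' x v)"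
    by (rule diff_times_SucE)
  note d = d[rule_format]
  from Suc.prems(2) obtain g' where
    e: "\<forall>x. (g has_derivative g' x) (at x)" "\<forall>v. diff_times n (\<lambda>x. g' x v)"
    by (rule diff_times_SucE)
  note e = e[rule_format]
  note d = d(1,2) e(1,2)
  show ?case by (rule diff_times_SucI[OF has_derivative_add[OF d(1,3)] Suc.IH[OF d(2,4)]])
qed simp

lemma diff_times_sum:
  "(\<And>i. i \<in> I \<Longrightarrow> diff_times n (f i)) \<Longrightarrow> diff_times n (\<lambda>x. \<Sum>i\<in>I. f i x)"
  by (induction I rule: infinite_finite_induct) (auto intro: diff_times_const diff_times_add)

lemma diff_times_mult:
  fixes f g :: "'a::real_normed_vector \<Rightarrow> 'b::real_normed_algebra"
  shows "diff_times n f \<Longrightarrow> diff_times n g \<Longrightarrow> diff_times n (\<lambda>x. f x * g x)"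
proof (induction n arbitrary: f g)
  case (Suc n)
  from Suc.prems(1) obtain f' where
    d: "\<forall>x. (f has_derivative f' x) (at x)" "\<forall>v. diff_times n (\<lambda>x. f' x v)"
    by (rule diff_times_SucE)
  note d = d[rule_format]
  from Suc.prems(2) obtain g' where
    e: "\<forall>x. (g has_derivative g' x) (at x)" "\<forall>v. diff_times n (\<lambda>x. g' x v)"
    by (rule diff_times_SucE)
  note e = e[rule_format]
  note d = d(1,2) e(1,2)
  have "diff_times n (\<lambda>x. f x * g' x v + f' x v * g x)" for v
    by (intro diff_times_add Suc.IH d Suc.prems[THEN diff_times_Suc])
  moreover have "((\<lambda>x. f x * g x) has_derivative (\<lambda>v. f x * g' x v + f' x v * g x)) (at x)" for x
    by (rule has_derivative_mult[OF d(1,3)])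
  ultimately show ?case by (rule diff_times_SucI[rotated])
qed simp

lemma diff_times_linear:
  assumes "bounded_linear l"
  shows "diff_times n (\<lambda>w. l (w - a))"
proof (cases n)
  case (Suc k)
  have "((\<lambda>w. l (w - a)) has_derivative l) (at x)" for x
    by (rule bounded_linear.has_derivative[OF assms]) (auto intro!: derivative_eq_intros)
  from diff_times_SucI[OF this diff_times_const] show ?thesis using Suc by simp
qed simp

text \<open>A directional derivative of \<open>h(s)\<close> is \<open>h'(s)\<close> times a
  real-linear function of \<open>w - a\<close>, so the induction only meets products of a radial and
  a linear function.\<close>

lemma diff_times_radial:
  fixes a :: "complex ^ 'n::finite"
  shows "deriv_times n h \<Longrightarrow> diff_times n (\<lambda>w. complex_of_real (h ((norm (w - a))\<^sup>2)))"
proof (induction n arbitrary: h)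
  case (Suc n)
  from Suc.prems obtain h' where
    h': "\<forall>x. (h has_real_derivative h' x) (at x)" "deriv_times n h'"
    by (rule deriv_times_SucE)
  note h' = h'(1)[rule_format] h'(2)
  have "diff_times n (\<lambda>w. complex_of_real (h' ((norm (w - a))\<^sup>2)) * complex_of_real (2 * ((w - a) \<bullet> v)))" for v
    by (intro diff_times_mult Suc.IH h' diff_times_linear[where l = "\<lambda>w. complex_of_real (2 * (w \<bullet> v))"]
        bounded_linear_compose[OF bounded_linear_of_real] bounded_linear_mult_right[THEN bounded_linear_compose]
        bounded_linear_inner_left)
  then show ?case
    using has_derivative_radial[OF h'(1)] by (intro diff_times_SucI) auto
qed simp

section \<open>Radial test functions and test forms\<close>

lemma test_fun_radial:
  fixes a :: "complex ^ 'n::finite"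
  assumes "\<And>n. deriv_times n h" "\<And>s. s \<ge> R\<^sup>2 \<Longrightarrow> h s = 0" "R > 0" "cball a R \<subseteq> \<Omega>"
  shows "test_fun \<Omega> (\<lambda>w. complex_of_real (h ((norm (w - a))\<^sup>2)) * c)"
  unfolding test_fun_def
proof (intro conjI exI[of _ "cball a R"] allI impI)
  show "smooth_fun (\<lambda>w. complex_of_real (h ((norm (w - a))\<^sup>2)) * c)"
    by (intro smooth_funI diff_times_mult diff_times_const diff_times_radial assms)
  fix z assume "z \<notin> cball a R"
  then have "(norm (z - a))\<^sup>2 \<ge> R\<^sup>2" using assms(3) by (auto simp: dist_norm norm_minus_commute intro!: power_mono)
  then show "complex_of_real (h ((norm (z - a))\<^sup>2)) * c = 0" using assms(2) by simp
qed (use assms in auto)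

text \<open>Smoothness is read off the Hessian formula, whose coefficients combine radial functions
  with linear factors. As the closed ball serves as the compact set, vanishing is needed only for
  \<open>s > R\<^sup>2\<close>, where \<open>h\<close> is locally 0 and its derivatives vanish as
  well.\<close>

lemma test_form_ddc_radial:
  fixes a :: "complex ^ 'n::{finite,linorder}"
  assumes "\<And>n. deriv_times n h''" "\<And>s. (h has_real_derivative h' s) (at s)"
    and "\<And>s. (h' has_real_derivative h'' s) (at s)"
    and h: "\<And>s. s \<ge> R\<^sup>2 \<Longrightarrow> h s = 0" "R > 0" "cball a R \<subseteq> \<Omega>"
    and b: "\<And>K. K \<notin> bidegree_indices p p \<Longrightarrow> b K = 0"
  shows "test_form \<Omega> (Suc p) (ddc (\<lambda>w L. complex_of_real (h ((norm (w - a))\<^sup>2)) * b L))"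
proof -
  have h1: "deriv_times n h'" for n
    using deriv_times_antiderivative[OF assms(1,3)] .
  have ddc: "ddc (\<lambda>w L. complex_of_real (h ((norm (w - a))\<^sup>2)) * b L) z =
    hess_wedge (\<lambda>j k. of_real (h' ((norm (z - a))\<^sup>2)) * (if j = k then 1 else 0)
      + of_real (h'' ((norm (z - a))\<^sup>2)) * (cnj ((z - a) $ j) * (z - a) $ k)) b" for z
    by (rule ddc_radial[of UNIV]) (auto simp: assms)
  have 0: "(h has_real_derivative 0) (at s)" if "s > R\<^sup>2" for s
    by (rule has_field_derivative_transform_within_open[of "\<lambda>x. 0" _ _ "{R\<^sup>2<..}"])
       (use that h in auto)
  have h'0: "h' s = 0" if "s > R\<^sup>2" for s using DERIV_unique[OF assms(2) 0[OF that]] .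
  have 1: "(h' has_real_derivative 0) (at s)" if "s > R\<^sup>2" for s
    by (rule has_field_derivative_transform_within_open[of "\<lambda>x. 0" _ _ "{R\<^sup>2<..}"])
       (use that h'0 in auto)
  have h''0: "h'' s = 0" if "s > R\<^sup>2" for s using DERIV_unique[OF assms(3) 1[OF that]] .
  show ?thesis
    unfolding test_form_def test_fun_def
  proof (intro conjI allI exI[of _ "cball a R"] impI)
    fix K :: "('n + 'n) set"
    have "bounded_linear (\<lambda>w :: complex ^ 'n::{finite,linorder}. cnj (w $ j))"
      "bounded_linear (\<lambda>w :: complex ^ 'n::{finite,linorder}. w $ j)" for j
      by (simp_all add: bounded_linear_compose[OF bounded_linear_cnj bounded_linear_vec_nth]
          bounded_linear_vec_nth)
    note lin = diff_times_linear[OF this(1)] diff_times_linear[OF this(2)]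
    show "smooth_fun (\<lambda>z. ddc (\<lambda>w L. complex_of_real (h ((norm (w - a))\<^sup>2)) * b L) z K)"
      unfolding ddc hess_wedge_def
      by (intro smooth_funI diff_times_mult diff_times_const diff_times_radial diff_times_sum
          diff_times_add lin assms(1) h1)
  next
    fix K :: "('n + 'n) set" and z assume "z \<notin> cball a R"
    then have "(norm (z - a))\<^sup>2 > R\<^sup>2"
      using h(2) by (auto simp: dist_norm norm_minus_commute intro!: power_strict_mono)
    then show "ddc (\<lambda>w L. complex_of_real (h ((norm (w - a))\<^sup>2)) * b L) z K = 0"
      unfolding ddc by (simp add: h'0 h''0 hess_wedge_def)
  next
    fix z and K :: "('n + 'n) set" assume "K \<notin> bidegree_indices (Suc p) (Suc p)"
    then show "ddc (\<lambda>w L. complex_of_real (h ((norm (w - a))\<^sup>2)) * b L) z K = 0"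
      unfolding ddc by (intro hess_wedge_bidegree[OF b])
  qed (use h in auto)
qed

section \<open>Integrals against currents of order zero\<close>

lemma coeff_measure_represents:
  assumes "order_zero \<Omega> p T" "K \<in> bidegree_indices p p"
  shows "represents_coeff \<Omega> T K (coeff_measure \<Omega> T K)"
  unfolding coeff_measure_def using assms by (auto simp: order_zero_def intro: someI_ex)

lemma complex_radon_set_integrable:
  fixes A :: "'a::topological_space set"
  assumes \<nu>: "complex_radon \<Omega> \<nu>" and C: "compact C" "C \<in> sets borel" "C \<subseteq> \<Omega>"
    and A: "A \<in> sets borel" "A \<subseteq> C"
    and f: "f \<in> borel_measurable borel" "\<And>z. z \<in> A \<Longrightarrow> cmod (f z) \<le> B"
  shows "set_integrable (fst \<nu>) A (\<lambda>z. f z * snd \<nu> z)"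
  unfolding set_integrable_def
proof (rule integrableI_bounded_set[where A = C and B = "max B 0"])
  have s: "sets (fst \<nu>) = sets borel" and u: "snd \<nu> \<in> borel_measurable borel"
    using \<nu> by (auto simp: complex_radon_def)
  show "C \<in> sets (fst \<nu>)" using C s by simp
  show "(\<lambda>z. indicator A z *\<^sub>R (f z * snd \<nu> z)) \<in> borel_measurable (fst \<nu>)"
    unfolding measurable_cong_sets[OF s refl]
    using A f(1) u by (intro borel_measurable_scaleR borel_measurable_indicator borel_measurable_times) auto
  show "emeasure (fst \<nu>) C < \<infinity>" using \<nu> C by (auto simp: complex_radon_def)
  have "norm (indicator A z *\<^sub>R (f z * snd \<nu> z)) \<le> max B 0" for z
    using \<nu> f(2)[of z] by (auto simp: complex_radon_def norm_mult indicator_def le_max_iff_disj)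
  then show "AE z in fst \<nu>. z \<in> C \<longrightarrow> norm (indicator A z *\<^sub>R (f z * snd \<nu> z)) \<le> max B 0" by simp
qed (use A in \<open>auto simp: indicator_def\<close>)

definition bounded_borel_form :: "(complex ^ 'n::finite) set \<Rightarrow> 'n form \<Rightarrow> bool" where
  "bounded_borel_form A \<alpha> \<longleftrightarrow> (\<forall>K. (\<lambda>z. \<alpha> z K) \<in> borel_measurable borel \<and>
     (\<exists>B. \<forall>z\<in>A. cmod (\<alpha> z K) \<le> B))"

lemma bounded_borel_form_subset: "bounded_borel_form A \<alpha> \<Longrightarrow> B \<subseteq> A \<Longrightarrow> bounded_borel_form B \<alpha>"
  unfolding bounded_borel_form_def by blast

lemma current_int_cong:
  assumes "\<And>z K. z \<in> A \<Longrightarrow> \<alpha> z K = \<alpha>' z K"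
  shows "current_int \<Omega> p T A \<alpha> = current_int \<Omega> p T A \<alpha>'"
  unfolding current_int_def cmeasure_int_def set_lebesgue_integral_def
  by (intro sum.cong refl Bochner_Integration.integral_cong) (auto simp: indicator_def assms)

lemma current_int_eq_subset:
  assumes "B \<subseteq> A" "\<And>z K. z \<in> A - B \<Longrightarrow> \<alpha> z K = 0"
  shows "current_int \<Omega> p T A \<alpha> = current_int \<Omega> p T B \<alpha>"
  unfolding current_int_def cmeasure_int_def set_lebesgue_integral_def
  by (intro sum.cong refl Bochner_Integration.integral_cong) (use assms in \<open>auto simp: indicator_def\<close>)

lemma current_int_scale: "current_int \<Omega> p T A (\<lambda>z K. c * \<alpha> z K) = c * current_int \<Omega> p T A \<alpha>"
  unfolding current_int_def cmeasure_int_def by (simp add: sum_distrib_left mult.assoc)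

context
  fixes \<Omega> C :: "(complex ^ 'n::finite) set" and p :: nat and T :: "'n form \<Rightarrow> complex"
  assumes ord: "order_zero \<Omega> p T" and C: "compact C" "C \<subseteq> \<Omega>"
begin

lemma coeff_measure_set_integrable:
  assumes "K \<in> bidegree_indices p p" "A \<in> sets borel" "A \<subseteq> C" "bounded_borel_form A \<alpha>"
  shows "set_integrable (fst (coeff_measure \<Omega> T K)) A (\<lambda>z. \<alpha> z K * snd (coeff_measure \<Omega> T K) z)"
proof -
  obtain B where "\<forall>z\<in>A. cmod (\<alpha> z K) \<le> B" using assms(4) by (auto simp: bounded_borel_form_def)
  moreover have "complex_radon \<Omega> (coeff_measure \<Omega> T K)"
    using coeff_measure_represents[OF ord assms(1)] by (simp add: represents_coeff_def)
  ultimately show ?thesis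
    using assms C by (intro complex_radon_set_integrable[where C = C])
      (auto simp: bounded_borel_form_def intro: borel_compact)
qed

lemma current_int_add:
  assumes "A \<in> sets borel" "A \<subseteq> C" "bounded_borel_form A \<alpha>" "bounded_borel_form A \<beta>"
  shows "current_int \<Omega> p T A (\<lambda>z K. \<alpha> z K + \<beta> z K) =
    current_int \<Omega> p T A \<alpha> + current_int \<Omega> p T A \<beta>"
  unfolding current_int_def cmeasure_int_def sum.distrib[symmetric] distrib_right
  using assms by (intro sum.cong refl set_integral_add(2) coeff_measure_set_integrable)

lemma current_int_Un:
  assumes "A \<in> sets borel" "A \<subseteq> C" "B \<in> sets borel" "B \<subseteq> C" "A \<inter> B = {}"
    and "bounded_borel_form (A \<union> B) \<alpha>"
  shows "current_int \<Omega> p T (A \<union> B) \<alpha> = current_int \<Omega> p T A \<alpha> + current_int \<Omega> p T B \<alpha>"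
proof -
  have "bounded_borel_form A \<alpha>" "bounded_borel_form B \<alpha>"
    using assms(6) by (auto intro: bounded_borel_form_subset)
  then show ?thesis
    unfolding current_int_def cmeasure_int_def sum.distrib[symmetric]
    using assms by (intro sum.cong refl set_integral_Un coeff_measure_set_integrable)
qed

text \<open>The coefficient measures have finite mass on the compact set \<open>C\<close>, so a
  constant is a dominating function. This use of order zero is what admits discontinuous limits,
  such as forms cut off along a sphere.\<close>

lemma current_int_dominated_convergence:
  assumes A: "A \<in> sets borel" "A \<subseteq> C"
    and meas: "\<And>i K. (\<lambda>z. \<alpha> i z K) \<in> borel_measurable borel"
    and bound: "\<And>K. \<exists>B. \<forall>i. \<forall>z\<in>A. cmod (\<alpha> i z K) \<le> B"
    and lim: "\<And>z K. z \<in> A \<Longrightarrow> (\<lambda>i. \<alpha> i z K) \<longlonglongrightarrow> \<alpha>' z K"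
  shows "(\<lambda>i. current_int \<Omega> p T A (\<alpha> i)) \<longlonglongrightarrow> current_int \<Omega> p T A \<alpha>'"
  unfolding current_int_def cmeasure_int_def set_lebesgue_integral_def
proof (rule tendsto_sum)
  fix K :: "('n + 'n) set" assume K: "K \<in> bidegree_indices p p"
  define \<nu> where "\<nu> = coeff_measure \<Omega> T K"
  have \<nu>: "complex_radon \<Omega> \<nu>"
    using coeff_measure_represents[OF ord K] by (simp add: represents_coeff_def \<nu>_def)
  then have s: "sets (fst \<nu>) = sets borel" and u: "snd \<nu> \<in> borel_measurable borel"
    by (auto simp: complex_radon_def)
  obtain B where B: "\<And>i z. z \<in> A \<Longrightarrow> cmod (\<alpha> i z K) \<le> B" using bound[of K] by auto
  let ?f = "\<lambda>i z. indicator A z *\<^sub>R (\<alpha> i z K * snd \<nu> z)"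
  have m: "?f i \<in> borel_measurable (fst \<nu>)" for i
    unfolding measurable_cong_sets[OF s refl]
    using A meas u by (intro borel_measurable_scaleR borel_measurable_indicator borel_measurable_times) auto
  have l: "(\<lambda>i. ?f i z) \<longlonglongrightarrow> indicator A z *\<^sub>R (\<alpha>' z K * snd \<nu> z)" for z
  proof (cases "z \<in> A")
    case True
    then show ?thesis using tendsto_mult[OF lim[OF True, of K] tendsto_const] by simp
  qed simp
  have "(\<lambda>i. integral\<^sup>L (fst \<nu>) (?f i)) \<longlonglongrightarrow> (LINT z|fst \<nu>. indicator A z *\<^sub>R (\<alpha>' z K * snd \<nu> z))"
  proof (rule integral_dominated_convergence[where w = "\<lambda>z. indicator C z * \<bar>B\<bar>"])
    show "(\<lambda>z. indicator A z *\<^sub>R (\<alpha>' z K * snd \<nu> z)) \<in> borel_measurable (fst \<nu>)"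
      by (rule borel_measurable_LIMSEQ_metric[OF m l])
    have "emeasure (fst \<nu>) C < \<infinity>" using \<nu> C by (auto simp: complex_radon_def)
    then show "integrable (fst \<nu>) (\<lambda>z. indicator C z * \<bar>B\<bar>)"
      using C s by (intro integrable_mult_left integrable_real_indicator) (auto intro: borel_compact)
    show "AE z in fst \<nu>. cmod (?f i z) \<le> indicator C z * \<bar>B\<bar>" for i
    proof (rule AE_I2)
      fix z
      show "cmod (?f i z) \<le> indicator C z * \<bar>B\<bar>"
        using B[of z i] \<nu> A by (auto simp: complex_radon_def norm_mult indicator_def)
    qed
  qed (use m l in auto)
  then show "(\<lambda>i. LINT z|fst (coeff_measure \<Omega> T K). indicator A z *\<^sub>R (\<alpha> i z K * snd (coeff_measure \<Omega> T K) z))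
      \<longlonglongrightarrow> (LINT z|fst (coeff_measure \<Omega> T K). indicator A z *\<^sub>R (\<alpha>' z K * snd (coeff_measure \<Omega> T K) z))"
    by (simp add: \<nu>_def)
qed

end

section \<open>Test forms and the values of a current of order zero\<close>

lemma smooth_fun_diff_times: "smooth_fun f \<Longrightarrow> diff_times n f"
proof (induction n arbitrary: f)
  case (Suc n)
  have "foldr dir_deriv [] f differentiable_on UNIV"
    using Suc.prems unfolding smooth_fun_def by blast
  then have "f differentiable (at x)" for x by (simp add: differentiable_on_def)
  then have 1: "(f has_derivative frechet_derivative f (at x)) (at x)" for x
    by (simp add: frechet_derivative_works)
  have "smooth_fun (dir_deriv v f)" for v
    unfolding smooth_fun_def
  proof
    fix vs
    have "foldr dir_deriv (vs @ [v]) f differentiable_on UNIV"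
      using Suc.prems unfolding smooth_fun_def by blast
    then show "foldr dir_deriv vs (dir_deriv v f) differentiable_on UNIV" by simp
  qed
  then have "diff_times n (\<lambda>x. frechet_derivative f (at x) v)" for v
    using Suc.IH by (simp add: dir_deriv_def)
  with 1 show ?case by (rule diff_times_SucI)
qed simp

text \<open>Additivity is hard to see from iterated directional derivatives, so it is obtained
  through \<open>diff_times\<close>; the union of the two supports is again compact.\<close>

lemma test_fun_add:
  assumes "test_fun \<Omega> f" "test_fun \<Omega> g"
  shows "test_fun \<Omega> (\<lambda>z. f z + g z)"
proof -
  obtain C where C: "compact C" "C \<subseteq> \<Omega>" "\<forall>z. z \<notin> C \<longrightarrow> f z = 0"
    using assms(1) by (auto simp: test_fun_def)
  obtain D where D: "compact D" "D \<subseteq> \<Omega>" "\<forall>z. z \<notin> D \<longrightarrow> g z = 0"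
    using assms(2) by (auto simp: test_fun_def)
  have "smooth_fun f" "smooth_fun g" using assms by (auto simp: test_fun_def)
  then have "smooth_fun (\<lambda>z. f z + g z)"
    by (intro smooth_funI diff_times_add) (auto dest: smooth_fun_diff_times)
  moreover have "compact (C \<union> D) \<and> C \<union> D \<subseteq> \<Omega> \<and> (\<forall>z. z \<notin> C \<union> D \<longrightarrow> f z + g z = 0)"
    using C D by (simp add: compact_Un)
  ultimately show ?thesis unfolding test_fun_def by (intro conjI exI[of _ "C \<union> D"]) simp_all
qed

lemma test_fun_zero: "test_fun \<Omega> (\<lambda>z. 0)"
  unfolding test_fun_def by (intro conjI smooth_funI diff_times_const exI[of _ "{}"]) simp_all

lemma test_form_add:
  "test_form \<Omega> p \<phi> \<Longrightarrow> test_form \<Omega> p \<psi> \<Longrightarrow> test_form \<Omega> p (\<lambda>z K. \<phi> z K + \<psi> z K)"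
  unfolding test_form_def by (simp add: test_fun_add)

lemma test_form_zero: "test_form \<Omega> p (\<lambda>z K. 0)"
  unfolding test_form_def by (simp add: test_fun_zero)

lemma current_add:
  assumes "is_current \<Omega> p T" "test_form \<Omega> p \<phi>" "test_form \<Omega> p \<psi>"
  shows "T (\<lambda>z K. \<phi> z K + \<psi> z K) = T \<phi> + T \<psi>"
proof -
  have "\<forall>\<phi> \<psi>. test_form \<Omega> p \<phi> \<and> test_form \<Omega> p \<psi> \<longrightarrow> T (\<lambda>z K. \<phi> z K + \<psi> z K) = T \<phi> + T \<psi>"
    using assms(1) unfolding is_current_def by (rule conjunct1)
  from this[THEN spec, THEN spec, of \<phi> \<psi>] show ?thesis using assms(2,3) by simp
qed

lemma current_zero:
  assumes "is_current \<Omega> p T"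
  shows "T (\<lambda>z K. 0) = 0"
proof -
  have "\<forall>c \<phi>. test_form \<Omega> p \<phi> \<longrightarrow> T (\<lambda>z K. c * \<phi> z K) = c * T \<phi>"
    using assms unfolding is_current_def by (elim conjE)
  from this[THEN spec, THEN spec, of "\<lambda>z K. 0" 0] show ?thesis using test_form_zero[of \<Omega> p] by simp
qed

lemma current_sum:
  assumes T: "is_current \<Omega> p T" and "finite S" and "\<And>i. i \<in> S \<Longrightarrow> test_form \<Omega> p (\<psi> i)"
  shows "test_form \<Omega> p (\<lambda>z K. \<Sum>i\<in>S. \<psi> i z K) \<and> T (\<lambda>z K. \<Sum>i\<in>S. \<psi> i z K) = (\<Sum>i\<in>S. T (\<psi> i))"
  using assms(2,3)
proof (induction S rule: finite_induct)
  case empty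
  show ?case using test_form_zero current_zero[OF T] by simp
next
  case (insert i S)
  then have 1: "test_form \<Omega> p (\<psi> i)" "test_form \<Omega> p (\<lambda>z K. \<Sum>i\<in>S. \<psi> i z K)"
    "T (\<lambda>z K. \<Sum>i\<in>S. \<psi> i z K) = (\<Sum>i\<in>S. T (\<psi> i))" by auto
  have "T (\<lambda>z K. \<psi> i z K + (\<Sum>i\<in>S. \<psi> i z K)) = T (\<psi> i) + T (\<lambda>z K. \<Sum>i\<in>S. \<psi> i z K)"
    by (rule current_add[OF T 1(1,2)])
  with 1 test_form_add[OF 1(1,2)] insert.hyps show ?case by simp
qed

text \<open>Expanded in basis covectors, the form becomes a finite sum of test forms, each of which
  is evaluated by one coefficient measure.\<close>

lemma current_eq_current_int:
  assumes T: "is_current \<Omega> p T" "order_zero \<Omega> p T" and \<phi>: "test_form \<Omega> p \<phi>"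
  shows "T \<phi> = current_int \<Omega> p T \<Omega> \<phi>"
proof -
  have \<phi>K: "test_fun \<Omega> (\<lambda>z. \<phi> z K)" for K using \<phi> by (simp add: test_form_def)
  have 1: "test_form \<Omega> p (\<lambda>z L. \<phi> z K * basis_covec K L)" if "K \<in> bidegree_indices p p" for K
  proof -
    have "test_fun \<Omega> (\<lambda>z. \<phi> z K * basis_covec K L)" for L
      using \<phi>K test_fun_zero by (cases "K = L") (simp_all add: basis_covec_def)
    then show ?thesis using that by (auto simp: test_form_def basis_covec_def)
  qed
  have "\<phi> = (\<lambda>z L. \<Sum>K\<in>bidegree_indices p p. \<phi> z K * basis_covec K L)"
    by (rule ext, rule covec_basis_expansion) (use \<phi> in \<open>simp add: test_form_def\<close>)
  then have "T \<phi> = T (\<lambda>z L. \<Sum>K\<in>bidegree_indices p p. \<phi> z K * basis_covec K L)" by simp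
  also have "\<dots> = (\<Sum>K\<in>bidegree_indices p p. T (\<lambda>z L. \<phi> z K * basis_covec K L))"
    by (rule current_sum[OF T(1), THEN conjunct2]) (simp_all add: 1)
  also have "\<dots> = current_int \<Omega> p T \<Omega> \<phi>"
    unfolding current_int_def
    using coeff_measure_represents[OF T(2)] \<phi>K
    by (intro sum.cong refl) (simp add: represents_coeff_def)
  finally show ?thesis .
qed

text \<open>Both integrals are the value of \<open>T\<close> at the \<open>ddc\<close> of
  \<open>h(s)\<close> times \<open>b\<close>: one uses the coefficient measures of \<open>T\<close>,
  the other those of \<open>ddc_current T\<close>. Since \<open>h\<close> vanishes from
  \<open>R\<^sup>2\<close> on, nothing is lost by integrating over the closed ball instead of
  \<Omega>.\<close>

lemma current_int_ddc_radial:
  fixes a :: "complex ^ 'n::{finite,linorder}"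
  assumes T: "is_current \<Omega> (Suc p) T" "order_zero \<Omega> (Suc p) T"
    and ddcT: "order_zero \<Omega> p (ddc_current T)"
    and h: "\<And>n. deriv_times n h''" "\<And>s. (h has_real_derivative h' s) (at s)"
      "\<And>s. (h' has_real_derivative h'' s) (at s)" "\<And>s. s \<ge> R\<^sup>2 \<Longrightarrow> h s = 0"
    and R: "R > 0" "cball a R \<subseteq> \<Omega>"
    and b: "\<And>K. K \<notin> bidegree_indices p p \<Longrightarrow> b K = 0"
  shows "current_int \<Omega> (Suc p) T (cball a R) (\<lambda>z.
      hess_wedge (\<lambda>j k. of_real (h' ((norm (z - a))\<^sup>2)) * (if j = k then 1 else 0)
        + of_real (h'' ((norm (z - a))\<^sup>2)) * (cnj ((z - a) $ j) * (z - a) $ k)) b) =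
    current_int \<Omega> p (ddc_current T) (cball a R) (\<lambda>z K. of_real (h ((norm (z - a))\<^sup>2)) * b K)"
proof -
  let ?h = "\<lambda>w. complex_of_real (h ((norm (w - a))\<^sup>2))"
  let ?I = "bidegree_indices p p :: ('n + 'n) set set"
  have ddc: "ddc (\<lambda>w L. ?h w * c L) z =
    hess_wedge (\<lambda>j k. of_real (h' ((norm (z - a))\<^sup>2)) * (if j = k then 1 else 0)
      + of_real (h'' ((norm (z - a))\<^sup>2)) * (cnj ((z - a) $ j) * (z - a) $ k)) c" for z and c :: "'n covec"
    by (rule ddc_radial[of UNIV]) (simp_all add: h(2,3))
  define bb where "bb K = (\<lambda>L. b K * basis_covec K L)" for K :: "('n + 'n) set"
  have bb: "bb K L = 0" if "K \<in> ?I" "L \<notin> ?I" for K L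
    using that by (auto simp: bb_def basis_covec_def)
  have tests: "test_form \<Omega> (Suc p) (ddc (\<lambda>w L. ?h w * bb K L))" if "K \<in> ?I" for K
    by (rule test_form_ddc_radial[OF h R bb[OF that]])
  have test: "test_form \<Omega> (Suc p) (ddc (\<lambda>w L. ?h w * b L))"
    by (rule test_form_ddc_radial[OF h R b])
  have h1: "deriv_times n h'" for n by (rule deriv_times_antiderivative[OF h(1,3)])
  have h0: "deriv_times n h" for n by (rule deriv_times_antiderivative[OF h1 h(2)])
  have off: "?h z = 0" if "z \<notin> cball a R" for z
  proof -
    have "(norm (z - a))\<^sup>2 \<ge> R\<^sup>2"
      using that R(1) by (intro power_mono) (auto simp: dist_norm norm_minus_commute)
    then show ?thesis by (simp add: h(4))
  qed
  have ddc_off: "ddc (\<lambda>w L. ?h w * b L) z K = 0" if "z \<notin> cball a R" for z K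
  proof -
    have s: "(norm (z - a))\<^sup>2 > R\<^sup>2"
      using that R(1) by (intro power_strict_mono) (auto simp: dist_norm norm_minus_commute)
    have "ddc (\<lambda>w L. complex_of_real (h ((norm (w - a))\<^sup>2)) * b L) z =
      hess_wedge (\<lambda>j k. of_real 0 * (if j = k then 1 else 0)
        + of_real 0 * (cnj ((z - a) $ j) * (z - a) $ k)) b"
    \<comment> \<open>Beyond the ball \<open>h\<close> is locally 0, so the Hessian formula applies
      there with both derivatives equal to 0.\<close>
    proof (rule ddc_radial[of "{R\<^sup>2<..}" _ _ _ "\<lambda>_. 0"])
      fix s assume "s \<in> {R\<^sup>2<..}"
      show "(h has_real_derivative 0) (at s)"
        by (rule has_field_derivative_transform_within_open[OF _ _ \<open>s \<in> {R\<^sup>2<..}\<close>, of "\<lambda>x. 0"])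
          (simp_all add: h(4))
    qed (use s in auto)
    then show ?thesis by (simp add: hess_wedge_def)
  qed
  have "current_int \<Omega> p (ddc_current T) (cball a R) (\<lambda>z K. ?h z * b K) =
      current_int \<Omega> p (ddc_current T) \<Omega> (\<lambda>z K. ?h z * b K)"
    using R(2) off by (intro current_int_eq_subset[symmetric]) simp_all
  also have "\<dots> = (\<Sum>K\<in>?I. T (ddc (\<lambda>w L. ?h w * bb K L)))"
    unfolding current_int_def
  proof (rule sum.cong)
    fix K assume K: "K \<in> ?I"
    have "test_fun \<Omega> (\<lambda>z. ?h z * b K)" by (rule test_fun_radial[OF h0 h(4) R])
    then have "cmeasure_int (coeff_measure \<Omega> (ddc_current T) K) \<Omega> (\<lambda>z. ?h z * b K) =
        ddc_current T (\<lambda>z L. ?h z * b K * basis_covec K L)"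
      using coeff_measure_represents[OF ddcT K] by (simp add: represents_coeff_def)
    then show "cmeasure_int (coeff_measure \<Omega> (ddc_current T) K) \<Omega> (\<lambda>z. ?h z * b K) =
        T (ddc (\<lambda>w L. ?h w * bb K L))"
      by (simp add: ddc_current_def bb_def mult.assoc)
  qed simp
  also have "\<dots> = T (\<lambda>z L. \<Sum>K\<in>?I. ddc (\<lambda>w L. ?h w * bb K L) z L)"
    by (rule current_sum[OF T(1), THEN conjunct2, symmetric]) (simp_all add: tests)
  \<comment> \<open>Additivity of \<open>ddc\<close> in the covector is taken from the Hessian
    formula, whose right-hand side is linear in it.\<close>
  also have "(\<lambda>z L. \<Sum>K\<in>?I. ddc (\<lambda>w L. ?h w * bb K L) z L) = ddc (\<lambda>w L. ?h w * b L)"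
  proof (rule ext)
    fix z
    have "b = (\<lambda>L. \<Sum>K\<in>?I. bb K L)"
      unfolding bb_def by (rule covec_basis_expansion) (rule b)
    then show "(\<lambda>L. \<Sum>K\<in>?I. ddc (\<lambda>w L. ?h w * bb K L) z L) = ddc (\<lambda>w L. ?h w * b L) z"
      unfolding ddc by (simp only: hess_wedge_sum)
  qed
  also have "T (ddc (\<lambda>w L. ?h w * b L)) = current_int \<Omega> (Suc p) T \<Omega> (ddc (\<lambda>w L. ?h w * b L))"
    by (rule current_eq_current_int[OF T test])
  also have "\<dots> = current_int \<Omega> (Suc p) T (cball a R) (ddc (\<lambda>w L. ?h w * b L))"
    using R(2) ddc_off by (intro current_int_eq_subset) simp_all
  also have "ddc (\<lambda>w L. ?h w * b L) = (\<lambda>z.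
      hess_wedge (\<lambda>j k. of_real (h' ((norm (z - a))\<^sup>2)) * (if j = k then 1 else 0)
        + of_real (h'' ((norm (z - a))\<^sup>2)) * (cnj ((z - a) $ j) * (z - a) $ k)) b)"
    by (rule ext) (rule ddc)
  finally show ?thesis by (rule sym)
qed

definition beta_wedge :: "'n::{finite,linorder} covec \<Rightarrow> 'n covec" where
  "beta_wedge = hess_wedge (\<lambda>j k. if j = k then 1 else 0)"

text \<open>Wedge multiplication by \<open>d|w|\<^sup>2 \<and> d\<^sup>c|w|\<^sup>2\<close>.\<close>

definition levi_wedge :: "complex ^ 'n::{finite,linorder} \<Rightarrow> 'n covec \<Rightarrow> 'n covec" where
  "levi_wedge w = hess_wedge (\<lambda>j k. cnj (w $ j) * w $ k)"

lemma hess_wedge_radial: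
  "hess_wedge (\<lambda>j k. u * (if j = k then 1 else 0) + v * (cnj (w $ j) * w $ k)) b =
    (\<lambda>K. u * beta_wedge b K + v * levi_wedge w b K)"
  unfolding beta_wedge_def levi_wedge_def by (rule hess_wedge_lincomb)

lemma levi_wedge_measurable: "(\<lambda>z. levi_wedge (z - a) b K) \<in> borel_measurable borel"
  unfolding levi_wedge_def hess_wedge_def
  by (intro borel_measurable_continuous_onI continuous_intros)

lemma levi_wedge_bounded:
  fixes a :: "complex ^ 'n::{finite,linorder}"
  shows "\<exists>M. \<forall>z\<in>cball a R. cmod (levi_wedge (z - a) b K) \<le> M"
proof -
  have "continuous_on (cball a R) (\<lambda>z. levi_wedge (z - a) b K)"
    unfolding levi_wedge_def hess_wedge_def by (intro continuous_intros)
  then have "bounded ((\<lambda>z. levi_wedge (z - a) b K) ` cball a R)"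
    by (intro compact_imp_bounded compact_continuous_image compact_cball)
  then show ?thesis by (auto simp: bounded_iff)
qed

lemma borel_measurable_radial:
  fixes a :: "'a::euclidean_space"
  assumes "f \<in> borel_measurable borel"
  shows "(\<lambda>z. complex_of_real (f ((norm (z - a))\<^sup>2))) \<in> borel_measurable borel"
proof -
  have "(\<lambda>z. (norm (z - a))\<^sup>2) \<in> borel_measurable borel"
    by (intro borel_measurable_continuous_onI continuous_intros)
  from measurable_compose[OF this assms] show ?thesis by measurable
qed

section \<open>Convergence of primitives that vanish at the outer radius\<close>

lemma set_integral_Ioo_FTC:
  fixes F f :: "real \<Rightarrow> real"
  assumes "a \<le> b" "\<And>x. x \<in> {a..b} \<Longrightarrow> (F has_real_derivative f x) (at x)" "continuous_on {a..b} f"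
  shows "(LINT x:{a<..<b}|lborel. f x) = F b - F a"
proof -
  have "(LBINT x=a..b. f x) = F b - F a"
    using assms
    by (intro interval_integral_FTC_finite)
      (auto simp: has_real_derivative_iff_has_vector_derivative intro: has_vector_derivative_at_within)
  then show ?thesis using assms(1) by (simp add: interval_integral_Ioo)
qed

lemma set_integral_Ioo_bounded_convergence:
  fixes f :: "nat \<Rightarrow> real \<Rightarrow> real"
  assumes meas: "\<And>i. f i \<in> borel_measurable borel"
    and bound: "\<And>i x. x \<in> {a<..<b} \<Longrightarrow> \<bar>f i x\<bar> \<le> B"
    and lim: "\<And>x. x \<in> {a<..<b} \<Longrightarrow> (\<lambda>i. f i x) \<longlonglongrightarrow> g x"
  shows "(\<lambda>i. LINT x:{a<..<b}|lborel. f i x) \<longlonglongrightarrow> (LINT x:{a<..<b}|lborel. g x)"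
  unfolding set_lebesgue_integral_def
proof (rule integral_dominated_convergence[where w = "\<lambda>x. indicator {a<..<b} x * \<bar>B\<bar>"])
  have m: "(\<lambda>x. indicator {a<..<b} x *\<^sub>R f i x) \<in> borel_measurable lborel" for i
    using meas by (intro borel_measurable_scaleR borel_measurable_indicator) auto
  have l: "(\<lambda>i. indicator {a<..<b} x *\<^sub>R f i x) \<longlonglongrightarrow> indicator {a<..<b} x *\<^sub>R g x" for x
    using lim[of x] by (cases "x \<in> {a<..<b}") simp_all
  show "(\<lambda>x. indicator {a<..<b} x *\<^sub>R g x) \<in> borel_measurable lborel"
    by (rule borel_measurable_LIMSEQ_metric[OF m l])
  show "integrable lborel (\<lambda>x. indicator {a<..<b} x * \<bar>B\<bar>)"
    using emeasure_bounded_finite[of "{a<..<b}"]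
    by (intro integrable_mult_left integrable_real_indicator) auto
  show "AE x in lborel. norm (indicator {a<..<b} x *\<^sub>R f i x) \<le> indicator {a<..<b} x * \<bar>B\<bar>" for i
  proof (rule AE_I2)
    fix x
    show "norm (indicator {a<..<b} x *\<^sub>R f i x) \<le> indicator {a<..<b} x * \<bar>B\<bar>"
      using bound[of x i] by (cases "x \<in> {a<..<b}") simp_all
  qed
qed (use assms in \<open>auto intro!: borel_measurable_scaleR borel_measurable_indicator
    simp: indicator_def split: if_splits\<close>)

lemma deriv_times_continuous:
  assumes "\<And>n. deriv_times n f"
  shows "isCont f x"
proof -
  obtain f' where "\<forall>x. (f has_real_derivative f' x) (at x)"
    using assms[of "Suc 0"] by (rule deriv_times_SucE)
  then show ?thesis by (auto intro: DERIV_isCont)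
qed

text \<open>Fixing the constant of integration at \<open>c\<close> makes the primitive vanish beyond
  \<open>c\<close> just as \<open>k\<close> does, so the construction can be repeated. The integral
  representation later lets pointwise limits of \<open>k\<close> pass to the primitive.\<close>

lemma vanishing_antiderivative:
  fixes c :: real
  assumes k: "\<And>n. deriv_times n k" "\<And>s. s \<ge> c \<Longrightarrow> k s = 0"
  shows "\<exists>G. (\<forall>s. (G has_real_derivative k s) (at s)) \<and> (\<forall>n. deriv_times n G) \<and>
    (\<forall>s\<ge>c. G s = 0) \<and> (\<forall>s\<le>c. G s = - (LINT u:{s<..<c}|lborel. k u))"
proof -
  have cont: "continuous_on S k" for S
    using deriv_times_continuous[OF k(1)] by (simp add: continuous_at_imp_continuous_on)
  obtain F where "\<forall>x. - \<infinity> < ereal x \<longrightarrow> ereal x < \<infinity> \<longrightarrow> (F has_vector_derivative k x) (at x)"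
    using einterval_antiderivative[of "- \<infinity>" "\<infinity>" k] deriv_times_continuous[OF k(1)] by auto
  then have F: "(F has_real_derivative k x) (at x)" for x
    by (simp add: has_real_derivative_iff_has_vector_derivative)
  define G where "G s = F s - F c" for s
  have G: "(G has_real_derivative k s) (at s)" for s
    using DERIV_diff[OF F[of s] DERIV_const[of "F c"]] by (simp add: G_def[abs_def])
  show ?thesis
  proof (intro exI[of _ G] conjI allI impI)
    show "deriv_times n G" for n by (rule deriv_times_antiderivative[OF k(1) G])
    fix s
    show "G s = 0" if "s \<ge> c"
    proof -
      have "F s - F c = (LINT u:{c<..<s}|lborel. k u)"
        by (rule set_integral_Ioo_FTC[symmetric]) (use that F cont in auto)
      also have "\<dots> = (LINT u:{c<..<s}|lborel. 0)"
        by (rule set_lebesgue_integral_cong) (auto simp: k(2))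
      finally show ?thesis by (simp add: G_def)
    qed
    show "G s = - (LINT u:{s<..<c}|lborel. k u)" if "s \<le> c"
      using set_integral_Ioo_FTC[OF that F cont] by (simp add: G_def)
  qed (rule G)
qed

text \<open>The mean value theorem between \<open>s\<close> and \<open>c\<close> gives a bound that
  depends on \<open>k\<close> only through \<open>B\<close>, hence is uniform along a sequence.
  Applied twice, it bounds \<open>h'\<close> and \<open>h\<close>.\<close>

lemma vanishing_primitive_bound:
  fixes G :: "real \<Rightarrow> real"
  assumes G: "\<And>s. (G has_real_derivative k s) (at s)" "G c = 0"
    and k: "\<And>s. s \<in> {0..c} \<Longrightarrow> \<bar>k s\<bar> \<le> B" and s: "s \<in> {0..c}"
  shows "\<bar>G s\<bar> \<le> B * c"
proof (cases "s = c")
  case True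
  then show ?thesis using G(2) s k[of s] by auto
next
  case False
  then have "s < c" using s by auto
  from MVT2[OF this G(1)] obtain z where z: "s < z" "z < c" "G c - G s = (c - s) * k z" by auto
  then have "\<bar>G s\<bar> = (c - s) * \<bar>k z\<bar>" using G(2) \<open>s < c\<close> by (simp add: abs_mult flip: abs_minus_cancel[of "G s"])
  also have "\<dots> \<le> c * B" using z s k[of z] by (intro mult_mono) auto
  finally show ?thesis by (simp add: mult.commute)
qed

text \<open>Only second derivatives are approximated. Integrating from \<open>s\<close> to
  \<open>R\<^sup>2\<close> turns their bounded pointwise convergence into that of \<open>h'\<close>
  and then of \<open>h\<close>, so dominated convergence applies on both sides. The limit \<kappa>
  may jump, but convergence is demanded at every \<open>s\<close>, because a sphere can carry mass
  of a coefficient measure.\<close>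

lemma current_int_ddc_radial_limit:
  fixes a :: "complex ^ 'n::{finite,linorder}" and R :: real
  assumes T: "is_current \<Omega> (Suc p) T" "order_zero \<Omega> (Suc p) T"
    and ddcT: "order_zero \<Omega> p (ddc_current T)"
    and R: "R > 0" "cball a R \<subseteq> \<Omega>"
    and b: "\<And>K. K \<notin> bidegree_indices p p \<Longrightarrow> b K = 0"
    and k: "\<And>i n. deriv_times n (k i)" "\<And>i s. s \<ge> R\<^sup>2 \<Longrightarrow> k i s = 0" "\<And>i s. \<bar>k i s\<bar> \<le> B"
    and lim: "\<And>s. (\<lambda>i. k i s) \<longlonglongrightarrow> \<kappa> s"
    and H\<^sub>1: "\<And>s. s \<in> {0..R\<^sup>2} \<Longrightarrow> H\<^sub>1 s = - (LINT u:{s<..<R\<^sup>2}|lborel. \<kappa> u)"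
  shows "current_int \<Omega> (Suc p) T (cball a R) (\<lambda>z K. of_real (H\<^sub>1 ((norm (z - a))\<^sup>2)) * beta_wedge b K
      + of_real (\<kappa> ((norm (z - a))\<^sup>2)) * levi_wedge (z - a) b K) =
    current_int \<Omega> p (ddc_current T) (cball a R)
      (\<lambda>z K. of_real (- (LINT t:{norm (z - a)<..<R}|lborel. H\<^sub>1 (t\<^sup>2) * (2 * t))) * b K)"
proof -
  have "\<exists>G. (\<forall>s. (G has_real_derivative k i s) (at s)) \<and> (\<forall>n. deriv_times n G) \<and>
    (\<forall>s\<ge>R\<^sup>2. G s = 0) \<and> (\<forall>s\<le>R\<^sup>2. G s = - (LINT u:{s<..<R\<^sup>2}|lborel. k i u))" for i
    by (rule vanishing_antiderivative[OF k(1,2)])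
  then obtain h' where h': "\<And>i s. (h' i has_real_derivative k i s) (at s)" "\<And>i n. deriv_times n (h' i)"
    "\<And>i s. s \<ge> R\<^sup>2 \<Longrightarrow> h' i s = 0" "\<And>i s. s \<le> R\<^sup>2 \<Longrightarrow> h' i s = - (LINT u:{s<..<R\<^sup>2}|lborel. k i u)"
    by metis
  have "\<exists>G. (\<forall>s. (G has_real_derivative h' i s) (at s)) \<and> (\<forall>n. deriv_times n G) \<and>
    (\<forall>s\<ge>R\<^sup>2. G s = 0) \<and> (\<forall>s\<le>R\<^sup>2. G s = - (LINT u:{s<..<R\<^sup>2}|lborel. h' i u))" for i
    by (rule vanishing_antiderivative[OF h'(2,3)])
  then obtain h where h: "\<And>i s. (h i has_real_derivative h' i s) (at s)" "\<And>i n. deriv_times n (h i)"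
    "\<And>i s. s \<ge> R\<^sup>2 \<Longrightarrow> h i s = 0"
    by metis
  have cont: "continuous_on S (k i)" "continuous_on S (h' i)" "continuous_on S (h i)" for S i
    using deriv_times_continuous[OF k(1)] deriv_times_continuous[OF h'(2)] deriv_times_continuous[OF h(2)]
    by (simp_all add: continuous_at_imp_continuous_on)
  have meas: "k i \<in> borel_measurable borel" "h' i \<in> borel_measurable borel" "h i \<in> borel_measurable borel" for i
    by (intro borel_measurable_continuous_onI cont)+
  have h'_bound: "\<bar>h' i s\<bar> \<le> B * R\<^sup>2" if "s \<in> {0..R\<^sup>2}" for i s
    by (rule vanishing_primitive_bound[OF h'(1)]) (use k h' that in auto)
  have h_bound: "\<bar>h i s\<bar> \<le> B * R\<^sup>2 * R\<^sup>2" if "s \<in> {0..R\<^sup>2}" for i s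
    by (rule vanishing_primitive_bound[OF h(1)]) (use h h'_bound that in auto)
  have h'_lim: "(\<lambda>i. h' i s) \<longlonglongrightarrow> H\<^sub>1 s" if "s \<in> {0..R\<^sup>2}" for s
  proof -
    have "(\<lambda>i. - (LINT u:{s<..<R\<^sup>2}|lborel. k i u)) \<longlonglongrightarrow> - (LINT u:{s<..<R\<^sup>2}|lborel. \<kappa> u)"
      by (intro tendsto_minus set_integral_Ioo_bounded_convergence[where B = B] meas k lim)
    then show ?thesis using that h'(4)[of s] H\<^sub>1[OF that] by simp
  qed
  have sq: "t\<^sup>2 \<in> {0..R\<^sup>2}" if "t \<in> {0..R}" for t :: real
    using that by (auto intro: power_mono)
  \<comment> \<open>Substituting the square of the radius for \<open>s\<close> writes
    \<open>h\<close> as an integral over radii, the form in which Fubini's theorem produces balls;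
    this is the origin of the weight \<open>2 * t\<close> in the formula.\<close>
  have h_eq: "h i (t\<^sup>2) = - (LINT x:{t<..<R}|lborel. h' i (x\<^sup>2) * (2 * x))" if "t \<in> {0..R}" for i t
  proof -
    have "(LINT x:{t<..<R}|lborel. h' i (x\<^sup>2) * (2 * x)) = h i (R\<^sup>2) - h i (t\<^sup>2)"
    proof (rule set_integral_Ioo_FTC[where F = "\<lambda>x. h i (x\<^sup>2)"])
      show "((\<lambda>x. h i (x\<^sup>2)) has_real_derivative h' i (x\<^sup>2) * (2 * x)) (at x)" for x
        by (rule DERIV_chain2[OF h(1)]) (auto intro!: derivative_eq_intros)
      show "continuous_on {t..R} (\<lambda>x. h' i (x\<^sup>2) * (2 * x))"
        by (intro continuous_intros continuous_on_compose2[OF cont(2)[of UNIV]]) auto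
    qed (use that in auto)
    then show ?thesis using h(3) by simp
  qed
  have h_lim: "(\<lambda>i. h i (t\<^sup>2)) \<longlonglongrightarrow> - (LINT x:{t<..<R}|lborel. H\<^sub>1 (x\<^sup>2) * (2 * x))" if t: "t \<in> {0..R}" for t
    unfolding h_eq[OF t]
  proof (intro tendsto_minus set_integral_Ioo_bounded_convergence[where B = "B * R\<^sup>2 * (2 * R)"])
    show "(\<lambda>x. h' i (x\<^sup>2) * (2 * x)) \<in> borel_measurable borel" for i
      by (intro borel_measurable_continuous_onI continuous_intros continuous_on_compose2[OF cont(2)[of UNIV]]) auto
    fix x assume x: "x \<in> {t<..<R}"
    then have x': "x \<in> {0..R}" using t by auto
    show "\<bar>h' i (x\<^sup>2) * (2 * x)\<bar> \<le> B * R\<^sup>2 * (2 * R)" for i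
      unfolding abs_mult using h'_bound[OF sq[OF x'], of i] x' by (intro mult_mono) auto
    show "(\<lambda>i. h' i (x\<^sup>2) * (2 * x)) \<longlonglongrightarrow> H\<^sub>1 (x\<^sup>2) * (2 * x)"
      by (intro tendsto_mult h'_lim sq x' tendsto_const)
  qed
  have t: "norm (z - a) \<in> {0..R}" if "z \<in> cball a R" for z
    using that by (auto simp: dist_norm norm_minus_commute)
  let ?C = "cball a R"
  have lim1: "(\<lambda>i. current_int \<Omega> (Suc p) T ?C (\<lambda>z K. of_real (h' i ((norm (z - a))\<^sup>2)) * beta_wedge b K
      + of_real (k i ((norm (z - a))\<^sup>2)) * levi_wedge (z - a) b K)) \<longlonglongrightarrow>
    current_int \<Omega> (Suc p) T ?C (\<lambda>z K. of_real (H\<^sub>1 ((norm (z - a))\<^sup>2)) * beta_wedge b K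
      + of_real (\<kappa> ((norm (z - a))\<^sup>2)) * levi_wedge (z - a) b K)"
  proof (rule current_int_dominated_convergence[OF T(2) compact_cball R(2)])
    show "(\<lambda>z. of_real (h' i ((norm (z - a))\<^sup>2)) * beta_wedge b K
        + of_real (k i ((norm (z - a))\<^sup>2)) * levi_wedge (z - a) b K) \<in> borel_measurable borel" for i K
      by (intro borel_measurable_add borel_measurable_times borel_measurable_radial meas levi_wedge_measurable
          borel_measurable_const)
  next
    fix K
    obtain M where M: "\<forall>z\<in>?C. cmod (levi_wedge (z - a) b K) \<le> M" using levi_wedge_bounded by blast
    have "cmod (of_real (h' i ((norm (z - a))\<^sup>2)) * beta_wedge b K
        + of_real (k i ((norm (z - a))\<^sup>2)) * levi_wedge (z - a) b K) \<le>
        B * R\<^sup>2 * cmod (beta_wedge b K) + B * M" if z: "z \<in> ?C" for i z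
    proof -
      have "cmod (of_real (h' i ((norm (z - a))\<^sup>2)) * beta_wedge b K) \<le> B * R\<^sup>2 * cmod (beta_wedge b K)"
        unfolding norm_mult norm_of_real using h'_bound[OF sq[OF t[OF z]]] by (intro mult_right_mono) auto
      moreover have "cmod (of_real (k i ((norm (z - a))\<^sup>2)) * levi_wedge (z - a) b K) \<le> B * M"
        unfolding norm_mult norm_of_real using k(3) M z
        by (intro mult_mono) (auto intro: order_trans[OF abs_ge_zero])
      ultimately show ?thesis by (intro norm_triangle_le) linarith
    qed
    then show "\<exists>B. \<forall>i. \<forall>z\<in>?C. cmod (of_real (h' i ((norm (z - a))\<^sup>2)) * beta_wedge b K
        + of_real (k i ((norm (z - a))\<^sup>2)) * levi_wedge (z - a) b K) \<le> B" by blast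
  next
    fix z K assume "z \<in> ?C"
    then show "(\<lambda>i. of_real (h' i ((norm (z - a))\<^sup>2)) * beta_wedge b K
        + of_real (k i ((norm (z - a))\<^sup>2)) * levi_wedge (z - a) b K) \<longlonglongrightarrow>
      of_real (H\<^sub>1 ((norm (z - a))\<^sup>2)) * beta_wedge b K
        + of_real (\<kappa> ((norm (z - a))\<^sup>2)) * levi_wedge (z - a) b K"
      by (intro tendsto_intros h'_lim lim sq t)
  qed simp_all
  have lim2: "(\<lambda>i. current_int \<Omega> p (ddc_current T) ?C (\<lambda>z K. of_real (h i ((norm (z - a))\<^sup>2)) * b K)) \<longlonglongrightarrow>
    current_int \<Omega> p (ddc_current T) ?C
      (\<lambda>z K. of_real (- (LINT t:{norm (z - a)<..<R}|lborel. H\<^sub>1 (t\<^sup>2) * (2 * t))) * b K)"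
  proof (rule current_int_dominated_convergence[OF ddcT compact_cball R(2)])
    show "(\<lambda>z. of_real (h i ((norm (z - a))\<^sup>2)) * b K) \<in> borel_measurable borel" for i K
      by (intro borel_measurable_times borel_measurable_radial meas borel_measurable_const)
  next
    fix K
    have "cmod (of_real (h i ((norm (z - a))\<^sup>2)) * b K) \<le> B * R\<^sup>2 * R\<^sup>2 * cmod (b K)" if "z \<in> ?C" for i z
      unfolding norm_mult norm_of_real using h_bound[OF sq[OF t[OF that]]] by (intro mult_right_mono) auto
    then show "\<exists>B. \<forall>i. \<forall>z\<in>?C. cmod (of_real (h i ((norm (z - a))\<^sup>2)) * b K) \<le> B" by blast
  next
    fix z K assume "z \<in> ?C"
    then show "(\<lambda>i. of_real (h i ((norm (z - a))\<^sup>2)) * b K) \<longlonglongrightarrow>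
        of_real (- (LINT t:{norm (z - a)<..<R}|lborel. H\<^sub>1 (t\<^sup>2) * (2 * t))) * b K"
      by (intro tendsto_mult tendsto_of_real h_lim t tendsto_const)
  qed simp_all
  have eq: "current_int \<Omega> (Suc p) T ?C (\<lambda>z K. of_real (h' i ((norm (z - a))\<^sup>2)) * beta_wedge b K
      + of_real (k i ((norm (z - a))\<^sup>2)) * levi_wedge (z - a) b K) =
    current_int \<Omega> p (ddc_current T) ?C (\<lambda>z K. of_real (h i ((norm (z - a))\<^sup>2)) * b K)" for i
    by (rule current_int_ddc_radial[OF T ddcT k(1) h(1) h'(1) h(3) R, where b = b,
          unfolded hess_wedge_radial]) (simp_all add: b)
  show ?thesis by (rule LIMSEQ_unique[OF lim1[unfolded eq] lim2])
qed

section \<open>Integration over balls and smooth cut-offs\<close>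

text \<open>The integrals are exchanged over the region \<open>d x < t < R\<close>, whose slice at
  fixed \<open>t\<close> is a sublevel set and later an open ball; the integrand is bounded on a
  product of finite measure. Integrability is recorded too, because splitting the radial integral at
  an inner radius requires it.\<close>

lemma finite_measure_radial_Fubini:
  fixes u :: "'a \<Rightarrow> complex" and d :: "'a \<Rightarrow> real" and g :: "real \<Rightarrow> real"
  assumes "finite_measure M"
    and [measurable]: "u \<in> borel_measurable M" "d \<in> borel_measurable M" "g \<in> borel_measurable borel"
    and u: "\<And>x. cmod (u x) \<le> 1" and d: "\<And>x. d x \<ge> 0"
    and g: "\<And>t. t \<in> {0<..<R} \<Longrightarrow> \<bar>g t\<bar> \<le> B"
  shows "set_integrable lborel {0<..<R} (\<lambda>t. of_real (g t) * (LINT x|M. indicator {x. d x < t} x *\<^sub>R u x))"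
    and "(LINT x|M. of_real (LINT t:{d x<..<R}|lborel. g t) * u x) =
      (LINT t:{0<..<R}|lborel. of_real (g t) * (LINT x|M. indicator {x. d x < t} x *\<^sub>R u x))"
proof -
  interpret M: finite_measure M by fact
  interpret P: pair_sigma_finite M lborel ..
  define f where "f x t = (if 0 < t \<and> t < R \<and> d x < t then of_real (g t) * u x else 0)" for x t
  have "case_prod f \<in> borel_measurable (M \<Otimes>\<^sub>M lborel)"
    unfolding f_def[abs_def] by measurable
  then have int: "integrable (M \<Otimes>\<^sub>M lborel) (case_prod f)"
  proof (rule integrableI_bounded_set[where A = "space M \<times> {0<..<R}" and B = "\<bar>B\<bar>", rotated])
    show "emeasure (M \<Otimes>\<^sub>M lborel) (space M \<times> {0<..<R}) < \<infinity>"
    proof -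
      have "emeasure M (space M) < top" "emeasure lborel {0<..<R} < top"
        using emeasure_bounded_finite[of "{0<..<R}"] M.emeasure_finite[of "space M"]
        by (auto simp flip: less_top)
      then show ?thesis
        by (subst lborel.emeasure_pair_measure_Times) (auto simp: ennreal_mult_less_top)
    qed
    have "norm (f x t) \<le> \<bar>B\<bar>" for x t
      using g[of t] u[of x] mult_mono[of "\<bar>g t\<bar>" "\<bar>B\<bar>" "cmod (u x)" 1]
      by (auto simp: f_def norm_mult)
    then show "AE x in M \<Otimes>\<^sub>M lborel. x \<in> space M \<times> {0<..<R} \<longrightarrow> norm (case x of (x, t) \<Rightarrow> f x t) \<le> \<bar>B\<bar>"
      by auto
    show "AE x in M \<Otimes>\<^sub>M lborel. x \<notin> space M \<times> {0<..<R} \<longrightarrow> (case x of (x, t) \<Rightarrow> f x t) = 0"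
      by (rule AE_I2) (auto simp: f_def space_pair_measure split: if_splits)
  qed measurable
  have inner_M: "(LINT x|M. f x t) =
      indicator {0<..<R} t *\<^sub>R (of_real (g t) * (LINT x|M. indicator {x. d x < t} x *\<^sub>R u x))" for t
  proof -
    have "f x t = (indicator {0<..<R} t *\<^sub>R of_real (g t)) * (indicator {x. d x < t} x *\<^sub>R u x)" for x
      by (auto simp: f_def indicator_def)
    then have "(LINT x|M. f x t) =
        (indicator {0<..<R} t *\<^sub>R of_real (g t)) * (LINT x|M. indicator {x. d x < t} x *\<^sub>R u x)"
      by (simp only: integral_mult_right_zero)
    then show ?thesis by (simp only: mult_scaleR_left)
  qed
  have inner_lborel: "(LINT t|lborel. f x t) = of_real (LINT t:{d x<..<R}|lborel. g t) * u x" for x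
  proof -
    have "f x t = of_real (indicator {d x<..<R} t *\<^sub>R g t) * u x" for t
      using d[of x] by (auto simp: f_def indicator_def)
    then show ?thesis
      by (simp only: set_lebesgue_integral_def integral_mult_left_zero integral_complex_of_real)
  qed
  show "set_integrable lborel {0<..<R} (\<lambda>t. of_real (g t) * (LINT x|M. indicator {x. d x < t} x *\<^sub>R u x))"
    using P.integrable_snd[OF int] unfolding inner_M set_integrable_def .
  show "(LINT x|M. of_real (LINT t:{d x<..<R}|lborel. g t) * u x) =
      (LINT t:{0<..<R}|lborel. of_real (g t) * (LINT x|M. indicator {x. d x < t} x *\<^sub>R u x))"
    using P.integral_fst[OF int] P.integral_snd[OF int]
    unfolding inner_M inner_lborel set_lebesgue_integral_def by simp
qed

lemma cmeasure_int_radial_Fubini: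
  fixes a :: "'a::euclidean_space" and g :: "real \<Rightarrow> real"
  assumes \<nu>: "complex_radon \<Omega> \<nu>" and R: "cball a R \<subseteq> \<Omega>"
    and g: "g \<in> borel_measurable borel" "\<And>t. t \<in> {0<..<R} \<Longrightarrow> \<bar>g t\<bar> \<le> B"
  shows "set_integrable lborel {0<..<R} (\<lambda>t. of_real (g t) * cmeasure_int \<nu> (ball a t) (\<lambda>z. c))"
    and "cmeasure_int \<nu> (cball a R) (\<lambda>z. of_real (LINT t:{norm (z - a)<..<R}|lborel. g t) * c) =
      (LINT t:{0<..<R}|lborel. of_real (g t) * cmeasure_int \<nu> (ball a t) (\<lambda>z. c))"
proof -
  \<comment> \<open>Finiteness is known only on compact subsets of \<Omega>, so the measure is
    restricted to the closed ball.\<close>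
  define M where "M = restrict_space (fst \<nu>) (cball a R)"
  have s: "sets (fst \<nu>) = sets borel" and u: "snd \<nu> \<in> borel_measurable borel" "\<And>x. cmod (snd \<nu> x) = 1"
    and fin: "emeasure (fst \<nu>) (cball a R) < \<infinity>"
    using \<nu> R by (auto simp: complex_radon_def)
  have sp: "space (fst \<nu>) = UNIV" using sets_eq_imp_space_eq[OF s] by simp
  have fM: "finite_measure M"
    by (rule finite_measureI)
      (use fin s sp in \<open>auto simp: M_def space_restrict_space emeasure_restrict_space\<close>)
  have meas: "f \<in> borel_measurable M" if "f \<in> borel_measurable borel" for f :: "'a \<Rightarrow> 'b::topological_space"
    unfolding M_def using that by (intro measurable_restrict_space1) (simp cong: measurable_cong_sets add: s)
  have d: "(\<lambda>z. norm (z - a)) \<in> borel_measurable borel"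
    by (intro borel_measurable_continuous_onI continuous_intros)
  have "cmod (snd \<nu> x) \<le> 1" for x using u(2)[of x] by simp
  note F = finite_measure_radial_Fubini[OF fM meas[OF u(1)] meas[OF d] g(1) this norm_ge_zero g(2)]
  have ball: "cmeasure_int \<nu> (ball a t) (\<lambda>z. c) =
      c * (LINT x|M. indicator {x. norm (x - a) < t} x *\<^sub>R snd \<nu> x)" if "t \<in> {0<..<R}" for t
  proof -
    have "indicator (ball a t) z *\<^sub>R (c * snd \<nu> z) =
        c * (indicator (cball a R) z *\<^sub>R (indicator {x. norm (x - a) < t} z *\<^sub>R snd \<nu> z))" for z
      using that by (auto simp: indicator_def dist_norm norm_minus_commute)
    then have "cmeasure_int \<nu> (ball a t) (\<lambda>z. c) = (LINT z|fst \<nu>.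
        c * (indicator (cball a R) z *\<^sub>R (indicator {x. norm (x - a) < t} z *\<^sub>R snd \<nu> z)))"
      unfolding cmeasure_int_def set_lebesgue_integral_def
      by (intro Bochner_Integration.integral_cong refl)
    also have "\<dots> = c * (LINT z|fst \<nu>.
        indicator (cball a R) z *\<^sub>R (indicator {x. norm (x - a) < t} z *\<^sub>R snd \<nu> z))"
      by (rule integral_mult_right_zero)
    finally show ?thesis
      unfolding M_def by (subst integral_restrict_space) (simp_all add: s sp)
  qed
  have cball: "cmeasure_int \<nu> (cball a R) (\<lambda>z. of_real (LINT t:{norm (z - a)<..<R}|lborel. g t) * c) =
      c * (LINT x|M. of_real (LINT t:{norm (x - a)<..<R}|lborel. g t) * snd \<nu> x)"
  proof -
    have "indicator (cball a R) z *\<^sub>R (of_real (LINT t:{norm (z - a)<..<R}|lborel. g t) * c * snd \<nu> z) =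
        c * (indicator (cball a R) z *\<^sub>R (of_real (LINT t:{norm (z - a)<..<R}|lborel. g t) * snd \<nu> z))" for z
      by simp
    then have "cmeasure_int \<nu> (cball a R) (\<lambda>z. of_real (LINT t:{norm (z - a)<..<R}|lborel. g t) * c) =
      (LINT z|fst \<nu>. c * (indicator (cball a R) z *\<^sub>R
        (of_real (LINT t:{norm (z - a)<..<R}|lborel. g t) * snd \<nu> z)))"
      unfolding cmeasure_int_def set_lebesgue_integral_def[of "fst \<nu>"]
      by (intro Bochner_Integration.integral_cong refl)
    also have "\<dots> = c * (LINT z|fst \<nu>. indicator (cball a R) z *\<^sub>R
        (of_real (LINT t:{norm (z - a)<..<R}|lborel. g t) * snd \<nu> z))"
      by (rule integral_mult_right_zero)
    finally show ?thesis
      unfolding M_def by (subst integral_restrict_space) (simp_all add: s sp)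
  qed
  have eq: "indicator {0<..<R} t *\<^sub>R (of_real (g t) * cmeasure_int \<nu> (ball a t) (\<lambda>z. c)) =
      c * (indicator {0<..<R} t *\<^sub>R
        (of_real (g t) * (LINT x|M. indicator {x. norm (x - a) < t} x *\<^sub>R snd \<nu> x)))" for t
    using ball[of t] by (cases "t \<in> {0<..<R}") simp_all
  show "set_integrable lborel {0<..<R} (\<lambda>t. of_real (g t) * cmeasure_int \<nu> (ball a t) (\<lambda>z. c))"
    unfolding set_integrable_def eq
    by (intro integrable_mult_right F(1)[unfolded set_integrable_def])
  have "cmeasure_int \<nu> (cball a R) (\<lambda>z. of_real (LINT t:{norm (z - a)<..<R}|lborel. g t) * c) =
      c * (LINT t:{0<..<R}|lborel. of_real (g t) * (LINT x|M. indicator {x. norm (x - a) < t} x *\<^sub>R snd \<nu> x))"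
    unfolding cball by (rule arg_cong[where f = "(*) c"]) (rule F(2))
  also have "\<dots> = (LINT t:{0<..<R}|lborel. of_real (g t) * cmeasure_int \<nu> (ball a t) (\<lambda>z. c))"
    unfolding set_lebesgue_integral_def eq by (rule integral_mult_right_zero[symmetric])
  finally show "cmeasure_int \<nu> (cball a R) (\<lambda>z. of_real (LINT t:{norm (z - a)<..<R}|lborel. g t) * c) =
      (LINT t:{0<..<R}|lborel. of_real (g t) * cmeasure_int \<nu> (ball a t) (\<lambda>z. c))" .
qed

lemma current_int_radial_Fubini:
  fixes a :: "complex ^ 'n::finite" and g :: "real \<Rightarrow> real"
  assumes S: "order_zero \<Omega> p S" and R: "cball a R \<subseteq> \<Omega>"
    and g: "g \<in> borel_measurable borel" "\<And>t. t \<in> {0<..<R} \<Longrightarrow> \<bar>g t\<bar> \<le> B"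
  shows "set_integrable lborel {0<..<R} (\<lambda>t. of_real (g t) * current_int \<Omega> p S (ball a t) (\<lambda>z. b))"
    and "current_int \<Omega> p S (cball a R) (\<lambda>z K. of_real (LINT t:{norm (z - a)<..<R}|lborel. g t) * b K) =
      (LINT t:{0<..<R}|lborel. of_real (g t) * current_int \<Omega> p S (ball a t) (\<lambda>z. b))"
proof -
  have \<nu>: "complex_radon \<Omega> (coeff_measure \<Omega> S K)" if "K \<in> bidegree_indices p p" for K
    using coeff_measure_represents[OF S that] by (simp add: represents_coeff_def)
  note F = cmeasure_int_radial_Fubini[OF \<nu> R g]
  have eq: "indicator {0<..<R} t *\<^sub>R (of_real (g t) * current_int \<Omega> p S (ball a t) (\<lambda>z. b)) =
    (\<Sum>K\<in>bidegree_indices p p. indicator {0<..<R} t *\<^sub>R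
      (of_real (g t) * cmeasure_int (coeff_measure \<Omega> S K) (ball a t) (\<lambda>z. b K)))" for t
    by (simp add: current_int_def sum_distrib_left scaleR_sum_right)
  have int: "integrable lborel (\<lambda>t. indicator {0<..<R} t *\<^sub>R
      (of_real (g t) * cmeasure_int (coeff_measure \<Omega> S K) (ball a t) (\<lambda>z. b K)))"
    if "K \<in> bidegree_indices p p" for K
    using F(1)[OF that] by (simp add: set_integrable_def)
  show "set_integrable lborel {0<..<R} (\<lambda>t. of_real (g t) * current_int \<Omega> p S (ball a t) (\<lambda>z. b))"
    unfolding set_integrable_def eq by (intro Bochner_Integration.integrable_sum int)
  have "(LINT t:{0<..<R}|lborel. of_real (g t) * current_int \<Omega> p S (ball a t) (\<lambda>z. b)) =
    (\<Sum>K\<in>bidegree_indices p p. LINT t|lborel. indicator {0<..<R} t *\<^sub>R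
      (of_real (g t) * cmeasure_int (coeff_measure \<Omega> S K) (ball a t) (\<lambda>z. b K)))"
    unfolding set_lebesgue_integral_def eq by (intro Bochner_Integration.integral_sum int)
  also have "\<dots> = current_int \<Omega> p S (cball a R)
      (\<lambda>z K. of_real (LINT t:{norm (z - a)<..<R}|lborel. g t) * b K)"
    unfolding current_int_def using F(2)
    by (intro sum.cong refl) (simp add: set_lebesgue_integral_def[of lborel "{0<..<R}"])
  finally show "current_int \<Omega> p S (cball a R)
      (\<lambda>z K. of_real (LINT t:{norm (z - a)<..<R}|lborel. g t) * b K) =
    (LINT t:{0<..<R}|lborel. of_real (g t) * current_int \<Omega> p S (ball a t) (\<lambda>z. b))" by simp
qed

section \<open>Smooth cut-offs of powers\<close>

lemma flat_0_bounds: "0 \<le> flat 0 x" "flat 0 x \<le> 1"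
  by (simp_all add: flat_def)

lemma flat_0_eq_0 [simp]: "x \<le> 0 \<Longrightarrow> flat 0 x = 0"
  by (simp add: flat_def)

lemma flat_0_tendsto_1:
  assumes "c > 0" "\<And>i. x i \<ge> real (Suc i) * c"
  shows "(\<lambda>i. flat 0 (x i)) \<longlonglongrightarrow> 1"
proof -
  have "filterlim (\<lambda>i. c * real (Suc i)) at_top sequentially"
    using assms(1) filterlim_compose[OF filterlim_real_sequentially filterlim_Suc]
    by (intro filterlim_tendsto_pos_mult_at_top[OF tendsto_const]) auto
  then have x: "filterlim x at_top sequentially"
    by (rule filterlim_at_top_mono) (use assms(2) in \<open>auto simp: mult.commute\<close>)
  have "((\<lambda>x :: real. exp (- inverse x)) \<longlongrightarrow> exp (- 0)) at_top"
    by (intro tendsto_exp tendsto_minus tendsto_inverse_0_at_top filterlim_ident)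
  then have "((\<lambda>x :: real. exp (- inverse x)) \<longlongrightarrow> 1) at_top" by simp
  then have "(flat 0 \<longlongrightarrow> 1) at_top"
    by (rule Lim_transform_eventually)
       (auto simp: flat_def intro!: eventually_mono[OF eventually_gt_at_top[of 0]])
  then show ?thesis by (rule filterlim_compose[OF _ x])
qed

lemma powr_bound_interval:
  fixes s \<alpha> \<beta> \<gamma> :: real
  assumes "0 < \<beta>" "\<beta> \<le> s" "s \<le> \<gamma>"
  shows "s powr \<alpha> \<le> \<beta> powr \<alpha> + \<gamma> powr \<alpha>"
proof (cases "\<alpha> \<ge> 0")
  case True
  then have "s powr \<alpha> \<le> \<gamma> powr \<alpha>" using assms by (intro powr_mono2) auto
  then show ?thesis by (smt (verit) powr_ge_zero)
next
  case False
  then have "s powr \<alpha> \<le> \<beta> powr \<alpha>" using assms by (intro powr_mono2') auto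
  then show ?thesis by (smt (verit) powr_ge_zero)
qed

text \<open>The inner endpoint is approximated from either side, so that its inclusion can be chosen.\<close>

lemma smooth_cutoff_powr:
  fixes s\<^sub>1 s\<^sub>2 c \<alpha> :: real
  assumes s: "0 < s\<^sub>1" "s\<^sub>1 < s\<^sub>2" and I: "I = {s\<^sub>1..<s\<^sub>2} \<or> I = {s\<^sub>1<..<s\<^sub>2}"
  shows "\<exists>k B. (\<forall>i n. deriv_times n (k i)) \<and> (\<forall>i. \<forall>s\<ge>s\<^sub>2. k i s = 0) \<and> (\<forall>i s. \<bar>k i s\<bar> \<le> B) \<and>
    (\<forall>s. (\<lambda>i. k i s) \<longlonglongrightarrow> indicator I s * (c * s powr \<alpha>))"
proof -
  \<comment> \<open>In the open case the argument is positive exactly for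
    \<open>s > s\<^sub>1\<close>. In the closed case the shift by \<open>s\<^sub>1 / 2\<close> moves
    the zero to \<open>s\<^sub>1 - s\<^sub>1 / (2 * real (Suc i))\<close>, which tends to
    \<open>s\<^sub>1\<close> from the left but never falls below \<open>s\<^sub>1 / 2\<close>; the
    outer factor sends the value at \<open>s\<^sub>1\<close> itself to infinity.\<close>
  define lo where "lo i s = (if I = {s\<^sub>1..<s\<^sub>2} then real (Suc i) * (real (Suc i) * (s - s\<^sub>1) + s\<^sub>1 / 2)
    else real (Suc i) * (s - s\<^sub>1))" for i s
  define up where "up i s = real (Suc i) * (s\<^sub>2 - s)" for i s
  define k where "k i s = c * (s powr \<alpha> * (flat 0 (lo i s) * flat 0 (up i s)))" for i s
  have lo_neg: "lo i s \<le> 0" if "s < s\<^sub>1 / 2" for i s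
  proof -
    define q where "q = real (Suc i) * (s - s\<^sub>1)"
    have "q \<le> 1 * (s - s\<^sub>1)"
      unfolding q_def using that s by (intro mult_right_mono_neg) auto
    then have "q + s\<^sub>1 / 2 \<le> 0 \<and> q \<le> 0"
      using that s by simp
    then have "real (Suc i) * (s - s\<^sub>1) + s\<^sub>1 / 2 \<le> 0 \<and> real (Suc i) * (s - s\<^sub>1) \<le> 0"
      unfolding q_def .
    then show ?thesis
      by (auto simp: lo_def intro: mult_nonneg_nonpos)
  qed
  have up_neg: "up i s \<le> 0" if "s \<ge> s\<^sub>2" for i s
    using that by (auto simp: up_def intro: mult_nonneg_nonpos)
  have "deriv_times n (k i)" for n i
  proof -
    have "lo i = (\<lambda>s. (if I = {s\<^sub>1..<s\<^sub>2} then real (Suc i) * real (Suc i) else real (Suc i)) * s +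
      (if I = {s\<^sub>1..<s\<^sub>2} then real (Suc i) * (s\<^sub>1 / 2 - real (Suc i) * s\<^sub>1) else - real (Suc i) * s\<^sub>1))"
      by (auto simp: lo_def fun_eq_iff algebra_simps)
    then have 1: "deriv_times n (\<lambda>s. flat 0 (lo i s))"
      by (simp only:) (rule deriv_times_compose_affine[OF deriv_times_flat])
    have "up i = (\<lambda>s. (- real (Suc i)) * s + real (Suc i) * s\<^sub>2)"
      by (auto simp: up_def fun_eq_iff algebra_simps)
    then have 2: "deriv_times n (\<lambda>s. flat 0 (up i s))"
      by (simp only:) (rule deriv_times_compose_affine[OF deriv_times_flat])
    have "deriv_times n (\<lambda>s. s powr \<alpha> * (flat 0 (lo i s) * flat 0 (up i s)))"
      by (rule deriv_times_powr_mult[of "s\<^sub>1 / 2", OF _ deriv_times_mult[OF 1 2]])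
        (use s lo_neg in auto)
    from deriv_times_mult[OF deriv_times_const this] show ?thesis unfolding k_def[abs_def] .
  qed
  moreover have "k i s = 0" if "s \<ge> s\<^sub>2" for i s using up_neg[OF that] by (simp add: k_def)
  \<comment> \<open>The cut-offs lie between 0 and 1 and their product vanishes outside the interval
    from \<open>s\<^sub>1 / 2\<close> to \<open>s\<^sub>2\<close>, on which the power is bounded;
    hence the bound does not depend on \<open>i\<close>.\<close>
  moreover have "\<bar>k i s\<bar> \<le> \<bar>c\<bar> * (((s\<^sub>1 / 2) powr \<alpha> + s\<^sub>2 powr \<alpha>) * (1 * 1))" for i s
  proof (cases "s < s\<^sub>1 / 2 \<or> s \<ge> s\<^sub>2")
    case True
    then have "k i s = 0" using up_neg lo_neg by (auto simp: k_def)
    then show ?thesis by simp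
  next
    case False
    then show ?thesis
      unfolding k_def abs_mult using s flat_0_bounds
      by (intro mult_mono mult_nonneg_nonneg) (auto simp: powr_bound_interval)
  qed
  moreover have "(\<lambda>i. k i s) \<longlonglongrightarrow> indicator I s * (c * s powr \<alpha>)" for s
  proof -
    have up: "(\<lambda>i. flat 0 (up i s)) \<longlonglongrightarrow> (if s < s\<^sub>2 then 1 else 0)"
      using flat_0_tendsto_1[of "s\<^sub>2 - s" "\<lambda>i. up i s"] up_neg[of s] by (auto simp: up_def)
    have lo: "(\<lambda>i. flat 0 (lo i s)) \<longlonglongrightarrow> (if s \<in> I \<or> s \<ge> s\<^sub>2 then 1 else 0)"
    proof (cases "I = {s\<^sub>1..<s\<^sub>2}")
      case True
      show ?thesis
      proof (cases "s \<ge> s\<^sub>1")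
        case ge: True
        have "lo i s \<ge> real (Suc i) * (s\<^sub>1 / 2)" for i
          using ge True unfolding lo_def by (auto intro!: mult_left_mono)
        then have "(\<lambda>i. flat 0 (lo i s)) \<longlonglongrightarrow> 1"
          using s by (intro flat_0_tendsto_1[of "s\<^sub>1 / 2"]) auto
        then show ?thesis using ge True by auto
      next
        case lt: False
        have "0 < s\<^sub>1 - s" using lt by simp
        from reals_Archimedean3[OF this] obtain N where N: "s\<^sub>1 / 2 < real N * (s\<^sub>1 - s)" by blast
        have "flat 0 (lo i s) = 0" if "i \<ge> N" for i
        proof -
          have "real N * (s\<^sub>1 - s) \<le> real (Suc i) * (s\<^sub>1 - s)"
            using that lt by (intro mult_right_mono) auto
          then have "real (Suc i) * (s - s\<^sub>1) + s\<^sub>1 / 2 \<le> 0" using N by (simp add: algebra_simps)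
          then show ?thesis using True by (intro flat_0_eq_0) (auto simp: lo_def intro: mult_nonneg_nonpos)
        qed
        then have "(\<lambda>i. flat 0 (lo i s)) \<longlonglongrightarrow> 0"
          by (intro tendsto_eventually) (auto simp: eventually_sequentially)
        then show ?thesis using lt True s by auto
      qed
    next
      case False
      then have I': "I = {s\<^sub>1<..<s\<^sub>2}" using I by auto
      show ?thesis
        using flat_0_tendsto_1[of "s - s\<^sub>1" "\<lambda>i. lo i s"] False s
        by (cases "s > s\<^sub>1") (auto simp: lo_def I' mult_nonneg_nonpos)
    qed
    have "(\<lambda>i. k i s) \<longlonglongrightarrow> c * (s powr \<alpha> * ((if s \<in> I \<or> s \<ge> s\<^sub>2 then 1 else 0) * (if s < s\<^sub>2 then 1 else 0)))"
      unfolding k_def by (intro tendsto_mult tendsto_const lo up)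
    moreover have "s \<in> I \<Longrightarrow> s < s\<^sub>2" using I by auto
    ultimately show ?thesis by (auto simp: indicator_def split: if_splits)
  qed
  ultimately show ?thesis by blast
qed

section \<open>The forms \<open>\<beta>\<close> and \<open>dd\<^sup>c\<phi>\<close>\<close>

lemma bounded_borel_form_radial:
  fixes a :: "complex ^ 'n::{finite,linorder}"
  assumes "f \<in> borel_measurable borel" "g \<in> borel_measurable borel"
    and fg: "\<And>s. \<bar>f s\<bar> \<le> F" "\<And>s. \<bar>g s\<bar> \<le> G"
  shows "bounded_borel_form (cball a R) (\<lambda>z K. of_real (f ((norm (z - a))\<^sup>2)) * x K
      + of_real (g ((norm (z - a))\<^sup>2)) * levi_wedge (z - a) y K)"
  unfolding bounded_borel_form_def
proof (intro allI conjI)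
  fix K
  show "(\<lambda>z. of_real (f ((norm (z - a))\<^sup>2)) * x K
      + of_real (g ((norm (z - a))\<^sup>2)) * levi_wedge (z - a) y K) \<in> borel_measurable borel"
    using assms by (intro borel_measurable_add borel_measurable_times borel_measurable_radial
        levi_wedge_measurable borel_measurable_const)
  obtain M where M: "\<forall>z\<in>cball a R. cmod (levi_wedge (z - a) y K) \<le> M" using levi_wedge_bounded by blast
  have "cmod (of_real (f ((norm (z - a))\<^sup>2)) * x K + of_real (g ((norm (z - a))\<^sup>2)) * levi_wedge (z - a) y K)
      \<le> F * cmod (x K) + G * M" if z: "z \<in> cball a R" for z
  proof -
    have "cmod (of_real (f ((norm (z - a))\<^sup>2)) * x K) \<le> F * cmod (x K)"
      unfolding norm_mult norm_of_real using fg(1) by (intro mult_right_mono) auto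
    moreover have "cmod (of_real (g ((norm (z - a))\<^sup>2)) * levi_wedge (z - a) y K) \<le> G * M"
      unfolding norm_mult norm_of_real using fg(2) M z
      by (intro mult_mono) (auto intro: order_trans[OF abs_ge_zero])
    ultimately show ?thesis by (intro norm_triangle_le) linarith
  qed
  then show "\<exists>B. \<forall>z\<in>cball a R. cmod (of_real (f ((norm (z - a))\<^sup>2)) * x K
      + of_real (g ((norm (z - a))\<^sup>2)) * levi_wedge (z - a) y K) \<le> B" by blast
qed

lemma bounded_borel_form_const: "bounded_borel_form A (\<lambda>z. b)"
  unfolding bounded_borel_form_def by auto

lemma beta_form_eq: "beta_form z = beta_wedge (basis_covec {})"
proof -
  have "beta_form z = ddc (\<lambda>w L. complex_of_real ((norm (w - 0))\<^sup>2) * basis_covec {} L) z"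
    by (simp add: beta_form_def fun_form_def)
  also have "\<dots> = hess_wedge (\<lambda>j k. of_real 1 * (if j = k then 1 else 0)
      + of_real 0 * (cnj ((z - 0) $ j) * (z - 0) $ k)) (basis_covec {})"
    by (rule ddc_radial[of UNIV z 0 "\<lambda>s. s" "\<lambda>_. 1" 0]) (auto intro: derivative_eq_intros)
  also have "\<dots> = beta_wedge (basis_covec {})"
    by (simp add: beta_wedge_def)
  finally show ?thesis .
qed

lemma form_power_beta: "form_power beta_form k z = (beta_wedge ^^ k) (basis_covec {})"
  and wedge_form_power_beta: "wedge (form_power beta_form k z) b = (beta_wedge ^^ k) b"
  using form_power_hess_wedge[OF beta_form_eq[unfolded beta_wedge_def]]
  by (simp_all add: beta_wedge_def)

lemma beta_wedge_power_lincomb: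
  "(beta_wedge ^^ k) (\<lambda>K. c * x K + d * y K) =
    (\<lambda>K. c * (beta_wedge ^^ k) x K + d * (beta_wedge ^^ k) y K)"
  by (induction k) (simp_all add: beta_wedge_def hess_wedge_add hess_wedge_scale)

lemma beta_wedge_power_levi_wedge:
  "(beta_wedge ^^ k) (levi_wedge w x) = levi_wedge w ((beta_wedge ^^ k) x)"
  by (induction k) (simp_all add: beta_wedge_def levi_wedge_def hess_wedge_commute)

section \<open>Powers of \<open>ddc\<close> of \<open>phi_tilde\<close>\<close>

lemma phi_tilde_eq:
  fixes w :: "complex ^ 'n::finite" and m :: nat
  defines "\<mu> \<equiv> real CARD('n) / real m - 1"
  shows "phi_tilde m w = - (1 / \<mu>) * ((norm w)\<^sup>2) powr (- \<mu>)"
proof (cases "w = 0")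
  case False
  then have "(norm w)\<^sup>2 = norm w powr 2" by simp
  then have "((norm w)\<^sup>2) powr (- \<mu>) = 1 / (norm w powr (2 * \<mu>))"
    by (simp only: powr_powr powr_minus_divide mult_minus_right)
  then show ?thesis by (simp add: phi_tilde_def phi_def \<mu>_def)
\<comment> \<open>At the pole both sides are 0, by \<open>0 powr x = 0\<close> and division by 0.
  The identity then holds everywhere, so the function inside \<open>ddc\<close> can be rewritten as
  a whole.\<close>
qed (simp add: phi_tilde_def phi_def)

text \<open>The normalising factor in \<open>phi\<close> makes the derivative in \<open>s\<close>
  exactly \<open>s powr (- \<nu>)\<close>; cancelling it needs \<open>\<nu> \<noteq> 1\<close>,
  which follows from \<open>m < CARD('n)\<close>.\<close>

lemma ddc_phi_tilde:
  fixes z a :: "complex ^ 'n::{finite,linorder}" and m :: nat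
  defines "\<nu> \<equiv> real CARD('n) / real m"
  assumes m: "1 \<le> m" "m < CARD('n)" and z: "z \<noteq> a"
  shows "ddc (fun_form (\<lambda>\<xi>. of_real (phi_tilde m (\<xi> - a)))) z =
    hess_wedge (\<lambda>j k. of_real (((norm (z - a))\<^sup>2) powr (- \<nu>)) * (if j = k then 1 else 0)
      + of_real (- \<nu> * ((norm (z - a))\<^sup>2) powr (- \<nu> - 1)) * (cnj ((z - a) $ j) * (z - a) $ k))
      (basis_covec {})"
proof -
  have \<nu>: "\<nu> - 1 \<noteq> 0" using m by (simp add: \<nu>_def field_simps)
  have "fun_form (\<lambda>\<xi>. of_real (phi_tilde m (\<xi> - a))) =
      (\<lambda>w L. complex_of_real (- (1 / (\<nu> - 1)) * ((norm (w - a))\<^sup>2) powr (- (\<nu> - 1))) * basis_covec {} L)"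
    by (simp add: fun_form_def phi_tilde_eq \<nu>_def)
  then show ?thesis
  proof (simp only:, intro ddc_radial[of "{0<..}"])
    show "((\<lambda>s. - (1 / (\<nu> - 1)) * s powr (- (\<nu> - 1))) has_real_derivative s powr (- \<nu>)) (at s)"
      if "s \<in> {0<..}" for s
    proof -
      have "((\<lambda>s. s powr (- (\<nu> - 1))) has_real_derivative - (\<nu> - 1) * s powr (- (\<nu> - 1) - 1)) (at s)"
        using that by (intro has_real_derivative_powr) auto
      from DERIV_cmult[OF this, of "- (1 / (\<nu> - 1))"] show ?thesis
        by (rule DERIV_cong) (use \<nu> in \<open>simp add: field_simps\<close>)
    qed
    show "((\<lambda>s. s powr (- \<nu>)) has_real_derivative - \<nu> * ((norm (z - a))\<^sup>2) powr (- \<nu> - 1))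
        (at ((norm (z - a))\<^sup>2))"
      using z by (intro has_real_derivative_powr) auto
  qed (use z in auto)
qed

lemma powr_power_mult: "0 < s \<Longrightarrow> (s powr a) ^ q = s powr (real q * a)" for s :: real
  by (simp add: powr_def mult.assoc flip: exp_of_nat_mult)

text \<open>As the rank-one part squares to 0, the power has only two terms. Their coefficients are
  \<open>s powr (- \<theta>)\<close>, for the number \<theta> defined here, and its derivative in
  \<open>s\<close>: the pattern \<open>h'\<close>, \<open>h''\<close> of the Hessian
  formula.\<close>

lemma beta_power_wedge_ddc_phi_power:
  fixes z a :: "complex ^ 'n::{finite,linorder}" and m k q :: nat
  defines "\<theta> \<equiv> real q * (real CARD('n) / real m)"
  assumes m: "1 \<le> m" "m < CARD('n)" and z: "z \<noteq> a" and k: "k \<ge> 1"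
  shows "(form_power beta_form k \<and>\<^sub>f form_power (ddc (fun_form (\<lambda>\<xi>. of_real (phi_tilde m (\<xi> - a))))) q) z K =
    of_real (((norm (z - a))\<^sup>2) powr (- \<theta>)) * (beta_wedge ^^ (k + q)) (basis_covec {}) K
    + of_real (- \<theta> * ((norm (z - a))\<^sup>2) powr (- \<theta> - 1)) *
      levi_wedge (z - a) ((beta_wedge ^^ (k + q - 1)) (basis_covec {})) K"
proof -
  let ?s = "(norm (z - a))\<^sup>2" and ?one = "basis_covec {} :: 'n covec"
  define \<nu> where "\<nu> = real CARD('n) / real m"
  have s: "?s > 0" using z by simp
  define u where "u = ?s powr (- \<nu>)"
  define v where "v = - \<nu> * ?s powr (- \<nu> - 1)"
  have "form_power (ddc (fun_form (\<lambda>\<xi>. of_real (phi_tilde m (\<xi> - a))))) q z =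
      (hess_wedge (\<lambda>j k. of_real u * (if j = k then 1 else 0)
        + of_real v * (cnj ((z - a) $ j) * (z - a) $ k)) ^^ q) ?one"
    unfolding u_def v_def \<nu>_def by (rule form_power_hess_wedge(1)) (rule ddc_phi_tilde[OF m z])
  also have "\<dots> = (\<lambda>K. of_real u ^ q * (beta_wedge ^^ q) ?one K +
      (of_nat q * of_real u ^ (q - 1) * of_real v) * levi_wedge (z - a) ((beta_wedge ^^ (q - 1)) ?one) K)"
    unfolding beta_wedge_def levi_wedge_def
    by (rule ext, rule hess_wedge_power_lincomb, rule hess_wedge_rank_one_square)
  finally have "(form_power beta_form k \<and>\<^sub>f form_power (ddc (fun_form (\<lambda>\<xi>. of_real (phi_tilde m (\<xi> - a))))) q) z K =
      of_real u ^ q * (beta_wedge ^^ k) ((beta_wedge ^^ q) ?one) K +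
      (of_nat q * of_real u ^ (q - 1) * of_real v) *
        levi_wedge (z - a) ((beta_wedge ^^ k) ((beta_wedge ^^ (q - 1)) ?one)) K"
    by (simp add: form_wedge_def wedge_form_power_beta beta_wedge_power_lincomb beta_wedge_power_levi_wedge)
  also have "of_real u ^ q = (of_real (?s powr (- \<theta>)) :: complex)"
    unfolding u_def of_real_power[symmetric] powr_power_mult[OF s] by (simp add: \<theta>_def \<nu>_def)
  \<comment> \<open>The exponents add up: \<open>q - 1\<close> times \<open>- \<nu>\<close>, plus
    \<open>- \<nu> - 1\<close>, is \<open>- \<theta> - 1\<close>. For \<open>q = 0\<close> both
    sides are 0.\<close>
  also have "(of_nat q * of_real u ^ (q - 1) * of_real v :: complex) = of_real (- \<theta> * ?s powr (- \<theta> - 1))"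
  proof (cases q)
    case (Suc q')
    have "u ^ q' * ?s powr (- \<nu> - 1) = ?s powr (- \<theta> - 1)"
      unfolding u_def powr_power_mult[OF s] powr_add[symmetric]
      by (simp add: \<theta>_def \<nu>_def Suc algebra_simps add_divide_distrib)
    then have "real q * u ^ (q - 1) * v = - \<theta> * ?s powr (- \<theta> - 1)"
      by (simp add: v_def Suc \<theta>_def \<nu>_def)
    then have "complex_of_real (- \<theta> * ?s powr (- \<theta> - 1)) = of_real (real q * u ^ (q - 1) * v)"
      by (simp only:)
    then show ?thesis by (simp only: of_real_mult of_real_power of_real_of_nat_eq)
  qed (simp add: \<theta>_def)
  finally show ?thesis
  \<comment> \<open>For \<open>q = 0\<close> the truncated difference \<open>q - 1\<close> breaks
    the count of factors in the second term, but its coefficient contains \<theta>, which is then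
    0.\<close>
  proof (cases q)
    case (Suc q')
    assume eq: "(form_power beta_form k \<and>\<^sub>f form_power (ddc (fun_form (\<lambda>\<xi>. of_real (phi_tilde m (\<xi> - a))))) q) z K =
      of_real (?s powr (- \<theta>)) * (beta_wedge ^^ k) ((beta_wedge ^^ q) ?one) K +
      of_real (- \<theta> * ?s powr (- \<theta> - 1)) *
        levi_wedge (z - a) ((beta_wedge ^^ k) ((beta_wedge ^^ (q - 1)) ?one)) K"
    have "(beta_wedge ^^ k) ((beta_wedge ^^ j) ?one) = (beta_wedge ^^ (k + j)) ?one" for j
      by (simp add: funpow_add)
    moreover have "k + (q - 1) = k + q - 1" using Suc by simp
    ultimately show ?thesis using eq by (simp only:)
  qed (simp add: \<theta>_def)
qed

lemma square_powr_half:
  fixes t e :: real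
  assumes "t > 0"
  shows "(t\<^sup>2) powr (- (e / 2)) = 1 / t powr e"
proof -
  have "t\<^sup>2 = t powr 2" using assms by simp
  then have "(t\<^sup>2) powr (- (e / 2)) = (t powr 2) powr (- (e / 2))" by (simp only:)
  also have "\<dots> = 1 / t powr (2 * (e / 2))" by (simp only: powr_powr powr_minus_divide mult_minus_right)
  finally show ?thesis by simp
qed

text \<open>A ball is connected: with its centre in \<Omega> and another point outside, it would
  meet the frontier at distance at most \<open>r\<close>. An empty frontier is covered, since the
  infimum is then infinite.\<close>

lemma cball_subset_boundary_dist:
  fixes a :: "'a::real_normed_vector"
  assumes "a \<in> \<Omega>" "ereal r < boundary_dist a \<Omega>"
  shows "cball a r \<subseteq> \<Omega>"
proof (rule ccontr)
  assume "\<not> cball a r \<subseteq> \<Omega>"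
  then obtain z where z: "z \<in> cball a r" "z \<notin> \<Omega>" by blast
  then have "r \<ge> 0" by (auto intro: order_trans[OF zero_le_dist])
  then have "a \<in> cball a r \<inter> \<Omega>" using assms(1) by simp
  with z have "cball a r \<inter> frontier \<Omega> \<noteq> {}"
    by (intro connected_Int_frontier convex_connected convex_cball) blast+
  then obtain y where y: "y \<in> frontier \<Omega>" "dist a y \<le> r" by auto
  then have "boundary_dist a \<Omega> \<le> ereal (dist a y)" unfolding boundary_dist_def by (intro INF_lower)
  with y(2) assms(2) show False by (metis ereal_less_eq(3) leD order_trans)
qed

section \<open>The Lelong-Jensen formula\<close>

text \<open>The two choices of \<open>I\<close> differ in one point, a Lebesgue null set, so they
  produce the same \<open>h'\<close>; the inner sphere is seen by \<open>h''\<close> only.\<close>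

lemma set_integral_cutoff_powr:
  fixes s\<^sub>1 s\<^sub>2 s e :: real
  assumes "0 < s\<^sub>1" "s\<^sub>1 < s\<^sub>2" "s \<le> s\<^sub>2" and I: "I = {s\<^sub>1..<s\<^sub>2} \<or> I = {s\<^sub>1<..<s\<^sub>2}"
  shows "(LINT u:{s<..<s\<^sub>2}|lborel. indicator I u * (- e * u powr (- e - 1))) =
    s\<^sub>2 powr (- e) - (max s s\<^sub>1) powr (- e)"
proof -
  have [measurable]: "I \<in> sets borel" using I by auto
  have "(LINT u:{s<..<s\<^sub>2}|lborel. indicator I u * (- e * u powr (- e - 1))) =
      (LINT u:{max s s\<^sub>1<..<s\<^sub>2}|lborel. - e * u powr (- e - 1))"
    unfolding set_lebesgue_integral_def
  proof (rule integral_cong_AE)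
    show "AE u in lborel. indicator {s<..<s\<^sub>2} u *\<^sub>R (indicator I u * (- e * u powr (- e - 1))) =
        indicator {max s s\<^sub>1<..<s\<^sub>2} u *\<^sub>R (- e * u powr (- e - 1))"
      using AE_lborel_singleton[of s\<^sub>1] by eventually_elim (use I in \<open>auto simp: indicator_def\<close>)
  qed measurable
  also have "\<dots> = s\<^sub>2 powr (- e) - (max s s\<^sub>1) powr (- e)"
  proof (rule set_integral_Ioo_FTC)
    show "((\<lambda>u. u powr (- e)) has_real_derivative - e * x powr (- e - 1)) (at x)"
      if "x \<in> {max s s\<^sub>1..s\<^sub>2}" for x
      using that assms(1) by (intro has_real_derivative_powr) auto
    show "continuous_on {max s s\<^sub>1..s\<^sub>2} (\<lambda>u. - e * u powr (- e - 1))"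
      using assms(1) by (intro continuous_intros) auto
  qed (use assms in auto)
  finally show ?thesis .
qed

lemma sets_borel_annulus: "annulus a r\<^sub>1 r\<^sub>2 \<in> sets borel" for a :: "'a::metric_space"
proof -
  have "annulus a r\<^sub>1 r\<^sub>2 = ball a r\<^sub>2 - cball a r\<^sub>1" by (auto simp: annulus_def)
  then show ?thesis by simp
qed

text \<open>\<open>D\<close> and \<open>A\<close> partition the open ball of radius
  \<open>r\<^sub>2\<close>, and the inner sphere goes with \<open>A\<close> exactly when
  \<open>r\<^sub>1\<^sup>2\<close> lies in \<open>I\<close>: the value of \<open>h''\<close> there
  decides whether the sphere contributes a \<open>levi_wedge\<close> term. Treating both variants at
  once leaves the choice of the cut-off open.\<close>

lemma lelong_jensen_split:
  fixes a :: "complex ^ 'n::{finite,linorder}" and e r\<^sub>1 r\<^sub>2 :: real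
  assumes T: "is_current \<Omega> (Suc p) T" "order_zero \<Omega> (Suc p) T"
    and ddcT: "order_zero \<Omega> p (ddc_current T)"
    and r: "0 < r\<^sub>1" "r\<^sub>1 < r\<^sub>2" "cball a r\<^sub>2 \<subseteq> \<Omega>" and e: "e \<ge> 0"
    and b: "\<And>K. K \<notin> bidegree_indices p p \<Longrightarrow> b K = 0"
    and AD: "(I = {r\<^sub>1\<^sup>2..<r\<^sub>2\<^sup>2} \<and> A = sphere a r\<^sub>1 \<union> annulus a r\<^sub>1 r\<^sub>2 \<and> D = ball a r\<^sub>1) \<or>
      (I = {r\<^sub>1\<^sup>2<..<r\<^sub>2\<^sup>2} \<and> A = annulus a r\<^sub>1 r\<^sub>2 \<and> D = cball a r\<^sub>1)"
    and \<Phi>: "\<And>z K. z \<in> A \<Longrightarrow> \<Phi> z K = of_real (((norm (z - a))\<^sup>2) powr (- (e / 2))) * beta_wedge b K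
      + of_real (- (e / 2) * ((norm (z - a))\<^sup>2) powr (- (e / 2) - 1)) * levi_wedge (z - a) b K"
  shows "of_real (1 / r\<^sub>2 powr e) * current_int \<Omega> (Suc p) T (ball a r\<^sub>2) (\<lambda>z. beta_wedge b)
      - of_real (1 / r\<^sub>1 powr e) * current_int \<Omega> (Suc p) T D (\<lambda>z. beta_wedge b) =
    (LBINT t=r\<^sub>1..r\<^sub>2. of_real ((1 / t powr e - 1 / r\<^sub>2 powr e) * (2 * t)) *
      current_int \<Omega> p (ddc_current T) (ball a t) (\<lambda>z. b))
    + (LBINT t=0..r\<^sub>1. of_real ((1 / r\<^sub>1 powr e - 1 / r\<^sub>2 powr e) * (2 * t)) *
      current_int \<Omega> p (ddc_current T) (ball a t) (\<lambda>z. b))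
    + current_int \<Omega> (Suc p) T A \<Phi>"
proof -
  let ?X = "current_int \<Omega> (Suc p) T" and ?Y = "\<lambda>t. current_int \<Omega> p (ddc_current T) (ball a t) (\<lambda>z. b)"
  let ?\<beta> = "\<lambda>z :: complex ^ 'n::{finite,linorder}. beta_wedge b"
  have sq: "0 < r\<^sub>1\<^sup>2" "r\<^sub>1\<^sup>2 < r\<^sub>2\<^sup>2" using r by (auto intro: power_strict_mono)
  have I: "I = {r\<^sub>1\<^sup>2..<r\<^sub>2\<^sup>2} \<or> I = {r\<^sub>1\<^sup>2<..<r\<^sub>2\<^sup>2}" using AD by auto
  have I_meas [measurable]: "I \<in> sets borel" using I by auto
  define \<kappa> where "\<kappa> s = indicator I s * (- (e / 2) * s powr (- (e / 2) - 1))" for s :: real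
  \<comment> \<open>The limit of \<open>h'\<close>, normalised to vanish at
    \<open>r\<^sub>2\<^sup>2\<close>. The maximum freezes it inside the inner sphere and so removes
    the singularity at the centre.\<close>
  define H where "H s = (max s (r\<^sub>1\<^sup>2)) powr (- (e / 2)) - (r\<^sub>2\<^sup>2) powr (- (e / 2))" for s
  have meas: "\<kappa> \<in> borel_measurable borel" "H \<in> borel_measurable borel"
    unfolding \<kappa>_def[abs_def] H_def[abs_def] by measurable
  have H_bound: "\<bar>H s\<bar> \<le> 2 * (r\<^sub>1\<^sup>2) powr (- (e / 2))" for s
  proof -
    have "(max s (r\<^sub>1\<^sup>2)) powr (- (e / 2)) \<le> (r\<^sub>1\<^sup>2) powr (- (e / 2))"
      "(r\<^sub>2\<^sup>2) powr (- (e / 2)) \<le> (r\<^sub>1\<^sup>2) powr (- (e / 2))"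
      using sq e by (intro powr_mono2'; simp)+
    moreover have "0 \<le> (max s (r\<^sub>1\<^sup>2)) powr (- (e / 2))" "0 \<le> (r\<^sub>2\<^sup>2) powr (- (e / 2))"
      by (rule powr_ge_zero)+
    ultimately show ?thesis unfolding H_def by linarith
  qed
  have \<kappa>_bound: "\<bar>\<kappa> s\<bar> \<le> e / 2 * (r\<^sub>1\<^sup>2) powr (- (e / 2) - 1)" for s
  proof (cases "s \<in> I")
    case True
    then have "s \<ge> r\<^sub>1\<^sup>2" using I by auto
    then have "s powr (- (e / 2) - 1) \<le> (r\<^sub>1\<^sup>2) powr (- (e / 2) - 1)"
      using sq e by (intro powr_mono2') auto
    then show ?thesis using True e by (simp add: \<kappa>_def abs_mult mult_left_mono)
  next
    case False
    then show ?thesis using e by (simp add: \<kappa>_def)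
  qed
  define \<Psi> where "\<Psi> z K = of_real (H ((norm (z - a))\<^sup>2)) * beta_wedge b K
      + of_real (\<kappa> ((norm (z - a))\<^sup>2)) * levi_wedge (z - a) b K" for z K
  define J where "J = (LINT t:{0<..<r\<^sub>2}|lborel. of_real (H (t\<^sup>2) * (2 * t)) * ?Y t)"
  have g: "(\<lambda>t. H (t\<^sup>2) * (2 * t)) \<in> borel_measurable borel"
    using measurable_compose[OF _ meas(2), of "\<lambda>t. t\<^sup>2" borel] by measurable
  have g_bound: "\<bar>H (t\<^sup>2) * (2 * t)\<bar> \<le> 2 * (r\<^sub>1\<^sup>2) powr (- (e / 2)) * (2 * r\<^sub>2)" if "t \<in> {0<..<r\<^sub>2}" for t
    unfolding abs_mult using H_bound[of "t\<^sup>2"] that by (intro mult_mono) auto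
  have Fubini:
    "set_integrable lborel {0<..<r\<^sub>2} (\<lambda>t. of_real (H (t\<^sup>2) * (2 * t)) * ?Y t)"
    "current_int \<Omega> p (ddc_current T) (cball a r\<^sub>2)
      (\<lambda>z K. of_real (LINT t:{norm (z - a)<..<r\<^sub>2}|lborel. H (t\<^sup>2) * (2 * t)) * b K) = J"
    unfolding J_def by (rule current_int_radial_Fubini[OF ddcT r(3) g g_bound]; assumption)+

  have J: "?X (cball a r\<^sub>2) \<Psi> = - J"
  proof -
    obtain k B where k: "\<forall>i n. deriv_times n (k i)" "\<forall>i. \<forall>s\<ge>r\<^sub>2\<^sup>2. k i s = 0" "\<forall>i s. \<bar>k i s\<bar> \<le> B"
      "\<forall>s. (\<lambda>i. k i s) \<longlonglongrightarrow> indicator I s * (- (e / 2) * s powr (- (e / 2) - 1))"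
      using smooth_cutoff_powr[OF sq I, of "- (e / 2)" "- (e / 2) - 1"] by blast
    have lim: "(\<lambda>i. k i s) \<longlonglongrightarrow> \<kappa> s" for s using k(4) by (simp add: \<kappa>_def)
    have H: "H s = - (LINT u:{s<..<r\<^sub>2\<^sup>2}|lborel. \<kappa> u)" if "s \<in> {0..r\<^sub>2\<^sup>2}" for s
      using set_integral_cutoff_powr[OF sq _ I, of s "e / 2"] that by (simp add: H_def \<kappa>_def)
    have "?X (cball a r\<^sub>2) \<Psi> = current_int \<Omega> p (ddc_current T) (cball a r\<^sub>2)
        (\<lambda>z K. of_real (- (LINT t:{norm (z - a)<..<r\<^sub>2}|lborel. H (t\<^sup>2) * (2 * t))) * b K)"
      unfolding \<Psi>_def
      by (rule current_int_ddc_radial_limit[OF T ddcT _ r(3) b, where k = k and B = B])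
        (use r k lim H in auto)
    also have "\<dots> = current_int \<Omega> p (ddc_current T) (cball a r\<^sub>2)
        (\<lambda>z K. - 1 * (of_real (LINT t:{norm (z - a)<..<r\<^sub>2}|lborel. H (t\<^sup>2) * (2 * t)) * b K))"
      by (rule current_int_cong) simp
    also have "\<dots> = - 1 * J"
      unfolding current_int_scale Fubini(2) ..
    finally show ?thesis by simp
  qed

  have J_split: "J = (LBINT t=r\<^sub>1..r\<^sub>2. of_real ((1 / t powr e - 1 / r\<^sub>2 powr e) * (2 * t)) * ?Y t)
    + (LBINT t=0..r\<^sub>1. of_real ((1 / r\<^sub>1 powr e - 1 / r\<^sub>2 powr e) * (2 * t)) * ?Y t)"
  proof -
    let ?f = "\<lambda>t. complex_of_real (H (t\<^sup>2) * (2 * t)) * ?Y t"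
    have ein: "einterval 0 (ereal x) = {0<..<x}" for x by (auto simp: einterval_def)
    have "interval_lebesgue_integrable lborel 0 (ereal r\<^sub>2) ?f"
      using Fubini(1) r by (simp add: interval_lebesgue_integrable_def ein)
    moreover have "min 0 (min (ereal r\<^sub>1) (ereal r\<^sub>2)) = 0" "max 0 (max (ereal r\<^sub>1) (ereal r\<^sub>2)) = ereal r\<^sub>2"
      using r by (auto simp: min_def max_def)
    ultimately have "(LBINT t=0..r\<^sub>1. ?f t) + (LBINT t=r\<^sub>1..r\<^sub>2. ?f t) = (LBINT t=0..r\<^sub>2. ?f t)"
      by (intro interval_integral_sum) simp
    moreover have "(LBINT t=0..r\<^sub>2. ?f t) = J"
      using r by (simp add: interval_lebesgue_integral_def ein J_def)
    moreover have "(LBINT t=0..r\<^sub>1. ?f t) =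
        (LBINT t=0..r\<^sub>1. of_real ((1 / r\<^sub>1 powr e - 1 / r\<^sub>2 powr e) * (2 * t)) * ?Y t)"
    proof (rule interval_integral_cong)
      fix t assume "t \<in> einterval (min 0 (ereal r\<^sub>1)) (max 0 (ereal r\<^sub>1))"
      then have t: "0 < t" "t < r\<^sub>1" using r by (auto simp: ein min_def max_def)
      then have "max (t\<^sup>2) (r\<^sub>1\<^sup>2) = r\<^sub>1\<^sup>2" by (auto intro!: max_absorb2 power_mono)
      then show "?f t = of_real ((1 / r\<^sub>1 powr e - 1 / r\<^sub>2 powr e) * (2 * t)) * ?Y t"
        using r by (simp only: H_def square_powr_half)
    qed
    moreover have "(LBINT t=r\<^sub>1..r\<^sub>2. ?f t) =
        (LBINT t=r\<^sub>1..r\<^sub>2. of_real ((1 / t powr e - 1 / r\<^sub>2 powr e) * (2 * t)) * ?Y t)"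
    proof (rule interval_integral_cong)
      fix t assume "t \<in> einterval (min (ereal r\<^sub>1) (ereal r\<^sub>2)) (max (ereal r\<^sub>1) (ereal r\<^sub>2))"
      then have t: "r\<^sub>1 < t" "0 < t" using r by (auto simp: einterval_def min_def max_def)
      then have "max (t\<^sup>2) (r\<^sub>1\<^sup>2) = t\<^sup>2" using r by (auto intro!: max_absorb1 power_mono)
      then show "?f t = of_real ((1 / t powr e - 1 / r\<^sub>2 powr e) * (2 * t)) * ?Y t"
        using r t by (simp only: H_def square_powr_half)
    qed
    ultimately show ?thesis by (simp only: add.commute)
  qed

  have A_meas: "A \<in> sets borel" and D_meas: "D \<in> sets borel"
    using AD sets_borel_annulus[of a r\<^sub>1 r\<^sub>2] by auto
  have AD_un: "D \<union> A = ball a r\<^sub>2" and AD_int: "D \<inter> A = {}"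
    using AD r by (auto simp: annulus_def)
  have AD_sub: "A \<subseteq> cball a r\<^sub>2" "D \<subseteq> cball a r\<^sub>2"
    using AD_un ball_subset_cball[of a r\<^sub>2] by blast+
  note current_lemmas = T(2) compact_cball r(3)
  have \<Psi>_bounded: "bounded_borel_form (cball a r\<^sub>2) \<Psi>"
    unfolding \<Psi>_def by (rule bounded_borel_form_radial[OF meas(2,1) H_bound \<kappa>_bound])
  have dist_sq: "(norm (z - a))\<^sup>2 = (dist a z)\<^sup>2" for z
    by (simp add: dist_norm norm_minus_commute)

  \<comment> \<open>On the outer sphere \<open>H\<close> vanishes by its normalisation and \<kappa>
    because \<open>I\<close> is open at \<open>r\<^sub>2\<^sup>2\<close>. Hence the closed ball,
    used for compactness, may be replaced by the open one.\<close>
  have "\<Psi> z K = 0" if "z \<in> cball a r\<^sub>2 - ball a r\<^sub>2" for z K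
  proof -
    have "dist a z = r\<^sub>2" using that by auto
    then show ?thesis using sq I by (auto simp: \<Psi>_def dist_sq H_def \<kappa>_def max_absorb1)
  qed
  then have "?X (cball a r\<^sub>2) \<Psi> = ?X (ball a r\<^sub>2) \<Psi>"
    by (intro current_int_eq_subset ball_subset_cball)
  also have "\<dots> = ?X D \<Psi> + ?X A \<Psi>"
    unfolding AD_un[symmetric]
    by (rule current_int_Un[OF current_lemmas D_meas AD_sub(2) A_meas AD_sub(1) AD_int])
      (rule bounded_borel_form_subset[OF \<Psi>_bounded], use AD_sub in auto)
  also have "?X D \<Psi> = of_real (1 / r\<^sub>1 powr e - 1 / r\<^sub>2 powr e) * ?X D ?\<beta>"
  proof -
    have "\<Psi> z K = of_real (1 / r\<^sub>1 powr e - 1 / r\<^sub>2 powr e) * beta_wedge b K" if z: "z \<in> D" for z K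
    proof -
      have "(dist a z)\<^sup>2 \<notin> I \<and> (dist a z)\<^sup>2 \<le> r\<^sub>1\<^sup>2"
        using AD
      proof (elim disjE conjE)
        assume "I = {r\<^sub>1\<^sup>2..<r\<^sub>2\<^sup>2}" "D = ball a r\<^sub>1"
        moreover from this z have "(dist a z)\<^sup>2 < r\<^sub>1\<^sup>2" by (intro power_strict_mono) auto
        ultimately show ?thesis by auto
      next
        assume "I = {r\<^sub>1\<^sup>2<..<r\<^sub>2\<^sup>2}" "D = cball a r\<^sub>1"
        moreover from this z have "(dist a z)\<^sup>2 \<le> r\<^sub>1\<^sup>2" by (intro power_mono) auto
        ultimately show ?thesis by auto
      qed
      then have "(dist a z)\<^sup>2 \<notin> I" "max ((dist a z)\<^sup>2) (r\<^sub>1\<^sup>2) = r\<^sub>1\<^sup>2" by auto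
      then show ?thesis using r by (simp add: \<Psi>_def dist_sq \<kappa>_def H_def square_powr_half)
    qed
    then have "?X D \<Psi> = ?X D (\<lambda>z K. of_real (1 / r\<^sub>1 powr e - 1 / r\<^sub>2 powr e) * beta_wedge b K)"
      by (rule current_int_cong)
    then show ?thesis by (simp only: current_int_scale)
  qed
  finally have 1: "- J = of_real (1 / r\<^sub>1 powr e - 1 / r\<^sub>2 powr e) * ?X D ?\<beta> + ?X A \<Psi>"
    unfolding J .

  \<comment> \<open>On \<open>A\<close> the two forms differ only by the constant subtracted in
    \<open>H\<close>; it supplies the share of \<open>A\<close> in the term with radius
    \<open>r\<^sub>2\<close>.\<close>
  have "\<Phi> z K = \<Psi> z K + of_real (1 / r\<^sub>2 powr e) * beta_wedge b K" if z: "z \<in> A" for z K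
  proof -
    have "r\<^sub>1 \<le> dist a z" "dist a z < r\<^sub>2" using AD z r by (auto simp: annulus_def)
    then have mono: "r\<^sub>1\<^sup>2 \<le> (dist a z)\<^sup>2" "(dist a z)\<^sup>2 < r\<^sub>2\<^sup>2" "dist a z > 0"
      using r by (auto intro: power_mono power_strict_mono)
    have "(dist a z)\<^sup>2 \<in> I"
      using AD
    proof (elim disjE conjE)
      assume "I = {r\<^sub>1\<^sup>2<..<r\<^sub>2\<^sup>2}" "A = annulus a r\<^sub>1 r\<^sub>2"
      moreover from this z have "r\<^sub>1\<^sup>2 < (dist a z)\<^sup>2"
        using r by (intro power_strict_mono) (auto simp: annulus_def)
      ultimately show ?thesis using mono by auto
    qed (use mono in auto)
    moreover have "max ((dist a z)\<^sup>2) (r\<^sub>1\<^sup>2) = (dist a z)\<^sup>2" using mono by auto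
    ultimately show ?thesis
      using r unfolding \<Phi>[OF z] \<Psi>_def dist_sq \<kappa>_def H_def by (simp add: square_powr_half algebra_simps)
  qed
  then have "?X A \<Phi> = ?X A (\<lambda>z K. \<Psi> z K + of_real (1 / r\<^sub>2 powr e) * beta_wedge b K)"
    by (rule current_int_cong)
  also have "\<dots> = ?X A \<Psi> + ?X A (\<lambda>z K. of_real (1 / r\<^sub>2 powr e) * beta_wedge b K)"
    by (rule current_int_add[OF current_lemmas A_meas AD_sub(1)
          bounded_borel_form_subset[OF \<Psi>_bounded AD_sub(1)] bounded_borel_form_const])
  finally have 2: "?X A \<Phi> = ?X A \<Psi> + of_real (1 / r\<^sub>2 powr e) * ?X A ?\<beta>"
    by (simp only: current_int_scale)
  have 3: "?X (ball a r\<^sub>2) ?\<beta> = ?X D ?\<beta> + ?X A ?\<beta>"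
    unfolding AD_un[symmetric]
    by (rule current_int_Un[OF current_lemmas D_meas AD_sub(2) A_meas AD_sub(1) AD_int
          bounded_borel_form_const])
  have "of_real (1 / r\<^sub>2 powr e) * ?X (ball a r\<^sub>2) ?\<beta> - of_real (1 / r\<^sub>1 powr e) * ?X D ?\<beta> = J + ?X A \<Phi>"
    using 1 unfolding 2 3 of_real_diff by algebra
  then show ?thesis unfolding J_split .
qed

theorem proposition3:
  fixes \<Omega> :: "(complex ^ 'n::{finite,linorder}) set"
    and T :: "'n form \<Rightarrow> complex"
    and a :: "complex ^ 'n::{finite,linorder}"
    and n m p :: nat
    and r\<^sub>1 r\<^sub>2 :: real
  assumes "n = CARD('n)"
    and "1 \<le> m" and "m < n" and "p \<le> n" and "n \<le> m + p"
    and "open \<Omega>"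
    and "is_current \<Omega> p T"
    and "order_zero \<Omega> p T"
    and "order_zero \<Omega> (p - 1) (ddc_current T)"
    and "a \<in> \<Omega>"
    and "0 < r\<^sub>1" and "r\<^sub>1 < r\<^sub>2" and "ereal r\<^sub>2 < boundary_dist a \<Omega>"
  shows
    "let e = lelong_exponent n m p;
         T\<beta> = (\<lambda>A. current_int \<Omega> p T A (form_power beta_form p));
         ddcT\<beta> = (\<lambda>A. current_int \<Omega> (p - 1) (ddc_current T) A (form_power beta_form (p - 1)));
         T\<phi> = (\<lambda>A. current_int \<Omega> p T A
                (form_power beta_form (n - m) \<and>\<^sub>f
                 form_power (ddc (fun_form (\<lambda>\<xi>. of_real (phi_tilde m (\<xi> - a))))) (m + p - n)));
         formula = (\<lambda>A.
           lelong_nu \<Omega> m p T a r\<^sub>2 - lelong_nu \<Omega> m p T a r\<^sub>1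
             = of_real (1 / r\<^sub>2 powr e) * T\<beta> (ball a r\<^sub>2) - of_real (1 / r\<^sub>1 powr e) * T\<beta> (ball a r\<^sub>1)
           \<and> of_real (1 / r\<^sub>2 powr e) * T\<beta> (ball a r\<^sub>2) - of_real (1 / r\<^sub>1 powr e) * T\<beta> (ball a r\<^sub>1)
             = (LBINT t=r\<^sub>1..r\<^sub>2. of_real ((1 / t powr e - 1 / r\<^sub>2 powr e) * (2 * t)) * ddcT\<beta> (ball a t))
             + (LBINT t=0..r\<^sub>1. of_real ((1 / r\<^sub>1 powr e - 1 / r\<^sub>2 powr e) * (2 * t)) * ddcT\<beta> (ball a t))
             + T\<phi> A)
     in formula (sphere a r\<^sub>1 \<union> annulus a r\<^sub>1 r\<^sub>2)
        \<and> (T\<beta> (sphere a r\<^sub>1) = 0 \<longrightarrow> formula (annulus a r\<^sub>1 r\<^sub>2))"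
proof -
  \<comment> \<open>\<open>m < n\<close> and \<open>n \<le> m + p\<close> force
    \<open>p \<ge> 1\<close>, so \<open>p - 1\<close> is a genuine predecessor.\<close>
  obtain p' where p': "p = Suc p'" using assms(3,5) by (cases p) auto
  have n: "CARD('n) = n" using assms(1) by simp
  define q where "q = m + p - n"
  define e where "e = lelong_exponent n m p"
  define b where "b = (beta_wedge ^^ p') (basis_covec {} :: 'n covec)"
  define \<Phi> where "\<Phi> = (form_power beta_form (n - m) \<and>\<^sub>f
    form_power (ddc (fun_form (\<lambda>\<xi>. complex_of_real (phi_tilde m (\<xi> - a))))) q)"
  have q: "real q = real m + real p - real n" using assms(5) by (simp add: q_def)
  then have e_half: "real q * (real n / real m) = e / 2"
    by (simp add: e_def lelong_exponent_def)
  have "e / 2 \<ge> 0" unfolding e_half[symmetric] by simp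
  then have e: "e \<ge> 0" by simp
  have \<beta>: "form_power beta_form p = (\<lambda>z. beta_wedge b)" "form_power beta_form (p - 1) = (\<lambda>z. b)"
    unfolding p' b_def diff_Suc_1
    by (rule ext, simp only: form_power_beta funpow.simps comp_apply)+
  have b: "b K = 0" if "K \<notin> bidegree_indices p' p'" for K
    using hess_wedge_power_bidegree[OF that] by (simp add: b_def beta_wedge_def)
  have cball: "cball a r\<^sub>2 \<subseteq> \<Omega>" by (rule cball_subset_boundary_dist[OF assms(10,13)])
  have \<Phi>: "\<Phi> z K = of_real (((norm (z - a))\<^sup>2) powr (- (e / 2))) * beta_wedge b K
      + of_real (- (e / 2) * ((norm (z - a))\<^sup>2) powr (- (e / 2) - 1)) * levi_wedge (z - a) b K"
    if "z \<noteq> a" for z K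
  proof -
    \<comment> \<open>The degrees match: \<open>n - m\<close> factors \<beta> and \<open>q\<close>
      factors from \<phi> give \<open>p\<close> in total.\<close>
    have "n - m + q = Suc p'" "n - m + q - 1 = p'" using assms(3,5) p' by (auto simp: q_def)
    then show ?thesis
      using beta_power_wedge_ddc_phi_power[of m z a "n - m" q K] assms(2,3) that
      unfolding \<Phi>_def n e_half b_def by simp
  qed
  have split: "of_real (1 / r\<^sub>2 powr e) * current_int \<Omega> p T (ball a r\<^sub>2) (\<lambda>z. beta_wedge b)
      - of_real (1 / r\<^sub>1 powr e) * current_int \<Omega> p T D (\<lambda>z. beta_wedge b) =
    (LBINT t=r\<^sub>1..r\<^sub>2. of_real ((1 / t powr e - 1 / r\<^sub>2 powr e) * (2 * t)) *
      current_int \<Omega> (p - 1) (ddc_current T) (ball a t) (\<lambda>z. b))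
    + (LBINT t=0..r\<^sub>1. of_real ((1 / r\<^sub>1 powr e - 1 / r\<^sub>2 powr e) * (2 * t)) *
      current_int \<Omega> (p - 1) (ddc_current T) (ball a t) (\<lambda>z. b))
    + current_int \<Omega> p T A \<Phi>"
    if AD: "(I = {r\<^sub>1\<^sup>2..<r\<^sub>2\<^sup>2} \<and> A = sphere a r\<^sub>1 \<union> annulus a r\<^sub>1 r\<^sub>2 \<and> D = ball a r\<^sub>1) \<or>
      (I = {r\<^sub>1\<^sup>2<..<r\<^sub>2\<^sup>2} \<and> A = annulus a r\<^sub>1 r\<^sub>2 \<and> D = cball a r\<^sub>1)" for I A D
  proof -
    \<comment> \<open>\<open>r\<^sub>1 > 0\<close> keeps \<open>A\<close> away from the centre, the
      pole of \<phi>.\<close>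
    have "z \<noteq> a" if "z \<in> A" for z using that AD assms(11) by (auto simp: annulus_def)
    note \<Phi>' = \<Phi>[OF this]
    have ddcT: "order_zero \<Omega> p' (ddc_current T)" using assms(9) by (simp add: p')
    show ?thesis
      using lelong_jensen_split[OF assms(7,8)[unfolded p'] ddcT assms(11,12) cball e b AD \<Phi>']
      unfolding p' by simp
  qed
  have closed: "of_real (1 / r\<^sub>2 powr e) * current_int \<Omega> p T (ball a r\<^sub>2) (\<lambda>z. beta_wedge b)
      - of_real (1 / r\<^sub>1 powr e) * current_int \<Omega> p T (ball a r\<^sub>1) (\<lambda>z. beta_wedge b) =
    (LBINT t=r\<^sub>1..r\<^sub>2. of_real ((1 / t powr e - 1 / r\<^sub>2 powr e) * (2 * t)) *
      current_int \<Omega> (p - 1) (ddc_current T) (ball a t) (\<lambda>z. b))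
    + (LBINT t=0..r\<^sub>1. of_real ((1 / r\<^sub>1 powr e - 1 / r\<^sub>2 powr e) * (2 * t)) *
      current_int \<Omega> (p - 1) (ddc_current T) (ball a t) (\<lambda>z. b))
    + current_int \<Omega> p T (sphere a r\<^sub>1 \<union> annulus a r\<^sub>1 r\<^sub>2) \<Phi>"
    by (rule split[OF disjI1[OF conjI[OF refl conjI[OF refl refl]]]])
  \<comment> \<open>With the open annulus the split identity has the closed inner ball on the left.
    Its excess over the open ball is the integral of \<open>beta_wedge b\<close> against
    \<open>T\<close> over the sphere, so the vanishing of this one number suffices.\<close>
  have "open": "of_real (1 / r\<^sub>2 powr e) * current_int \<Omega> p T (ball a r\<^sub>2) (\<lambda>z. beta_wedge b)
      - of_real (1 / r\<^sub>1 powr e) * current_int \<Omega> p T (ball a r\<^sub>1) (\<lambda>z. beta_wedge b) =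
    (LBINT t=r\<^sub>1..r\<^sub>2. of_real ((1 / t powr e - 1 / r\<^sub>2 powr e) * (2 * t)) *
      current_int \<Omega> (p - 1) (ddc_current T) (ball a t) (\<lambda>z. b))
    + (LBINT t=0..r\<^sub>1. of_real ((1 / r\<^sub>1 powr e - 1 / r\<^sub>2 powr e) * (2 * t)) *
      current_int \<Omega> (p - 1) (ddc_current T) (ball a t) (\<lambda>z. b))
    + current_int \<Omega> p T (annulus a r\<^sub>1 r\<^sub>2) \<Phi>"
    if sphere: "current_int \<Omega> p T (sphere a r\<^sub>1) (\<lambda>z. beta_wedge b) = 0"
  proof -
    have "current_int \<Omega> p T (ball a r\<^sub>1 \<union> sphere a r\<^sub>1) (\<lambda>z. beta_wedge b) =
        current_int \<Omega> p T (ball a r\<^sub>1) (\<lambda>z. beta_wedge b) + current_int \<Omega> p T (sphere a r\<^sub>1) (\<lambda>z. beta_wedge b)"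
      by (rule current_int_Un[OF assms(8) compact_cball cball])
        (use assms(12) in \<open>auto simp: bounded_borel_form_const\<close>)
    moreover have cball: "ball a r\<^sub>1 \<union> sphere a r\<^sub>1 = cball a r\<^sub>1" by auto
    ultimately have "current_int \<Omega> p T (cball a r\<^sub>1) (\<lambda>z. beta_wedge b) =
        current_int \<Omega> p T (ball a r\<^sub>1) (\<lambda>z. beta_wedge b)"
      unfolding cball sphere by simp
    moreover note split[OF disjI2[OF conjI[OF refl conjI[OF refl refl]]]]
    ultimately show ?thesis by simp
  qed
  show ?thesis
    unfolding Let_def lelong_nu_def n \<beta> e_def[symmetric] q_def[symmetric] \<Phi>_def[symmetric]
    using closed "open" by blast
qed

end
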